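(* Let ${\mathcal C}$ be a subcategory of $\mathbf{T_2Unif}$. Then the following are equivalent: 1) ${\mathcal C}$ is an epireflective subcategory of $\mathbf{T_2Unif}$, closed under epi images. 2) Either $\mathrm{Ob}\,{\mathcal C}=\{X\in \mathrm{Ob}\,\mathbf{T_2Unif}\mid |X|\le 1\}$, or $\mathrm{Ob}\,{\mathcal C}=\{X\in \mathrm{Ob}\,\mathbf{T_2Unif}\mid X\text{ is compact }T_2\}$, or there exists an infinite cardinal $\lambda_0$ such that $\mathrm{Ob}\,{\mathcal C}=\{X\in \mathrm{Ob}\,\mathbf{T_2Unif}\mid X\text{ has covering character at most }\lambda_0\}$, or ${\mathcal C}=\mathbf{T_2Unif}$. Moreover, if 1) is written as the conjunction of the four properties: closedness under products, under extremal subobjects, under bimorphic images, and under extremal epi images, then none of these four properties can be omitted without invalidating the implication $1)\Rightarrow 2)$ (that is, for each of the four properties there is a subcategory of $\mathbf{T_2Unif}$ having the other three properties but not of the form in 2)).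
   Context: $\mathbf{T_2Unif}$ is the category of $T_2$ (Hausdorff) uniform spaces and uniformly continuous maps. Subcategories are always full and isomorphism closed, and are identified with the classes of their objects. A subcategory is epireflective if it is reflective with all reflection arrows epimorphisms of the ambient category; in $\mathbf{T_2Unif}$ this is equivalent to being closed under products (including the empty product) and extremal subobjects. In $\mathbf{T_2Unif}$ the epimorphisms are the morphisms with dense image, the bimorphisms are the injective morphisms with dense image, the extremal monomorphisms are the closed embeddings (so extremal subobjects are the closed subspaces), and the extremal epimorphisms are the quotient maps in $\mathbf{T_2Unif}$ (surjections whose codomain carries the finest structure making the map a morphism). For a class $\mathbf{E}$ of epimorphisms, ${\mathcal C}$ is closed under $\mathbf{E}$-images if $C\in\mathrm{Ob}\,{\mathcal C}$ and $e:C\to D$ with $e\in\mathbf{E}$ imply $D\in \mathrm{Ob}\,{\mathcal C}$; epi images, bimorphic images and extremal epi images correspond to $\mathbf E$ being the class of all epimorphisms, of all bimorphisms, and of all extremal epimorphisms, respectively. The covering character of a uniform space $X$ is the smallest infinite cardinal $\lambda$ such that $X$ admits a base of uniform coverings of cardinalities less than $\lambda$ (equivalently, the smallest infinite cardinal $\lambda$ such that $X$ has no uniformly discrete subspace of cardinality $\lambda$). *)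

theory Defs
  imports "HOL-Analysis.Analysis"
begin

unbundle cardinal_syntax

section \<open>The set-theoretic universe\<close>

text \<open>
  The category of all Hausdorff uniform spaces is large, and its full subcategories are proper
  classes. Both are rendered relative to a type \<open>'u\<close> of strongly inaccessible cardinality
  \<open>\<kappa>\<close>: small sets are the sets with fewer than \<open>\<kappa>\<close> elements, classes are arbitrary sets, and
  cardinals are the cardinals below \<open>\<kappa>\<close>. Every small set has a copy among the small subsets of
  \<open>'u\<close>, so spaces (and index sets) may be taken to be carried by small subsets of \<open>'u\<close>.
\<close>

definition strongly_inaccessible :: "'u rel \<Rightarrow> bool" where
  "strongly_inaccessible k \<longleftrightarrow>
     Card_order k \<and> natLeq <o k \<and> regularCard k \<and>
     (\<forall>A. A \<subseteq> Field k \<and> |A| <o k \<longrightarrow> |Pow A| <o k)"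

definition small :: "'u set \<Rightarrow> bool" where
  "small A \<longleftrightarrow> |A| <o |UNIV :: 'u set|"


section \<open>Uniform spaces\<close>

record 'u uspace =
  points :: "'u set"
  entourages :: "('u \<times> 'u) set set"

definition is_uspace :: "'u uspace \<Rightarrow> bool" where
  "is_uspace X \<longleftrightarrow>
     points X \<times> points X \<in> entourages X \<and>
     (\<forall>E\<in>entourages X. Id_on (points X) \<subseteq> E \<and> E \<subseteq> points X \<times> points X) \<and>
     (\<forall>E\<in>entourages X. \<forall>F. E \<subseteq> F \<and> F \<subseteq> points X \<times> points X \<longrightarrow> F \<in> entourages X) \<and>
     (\<forall>E\<in>entourages X. \<forall>F\<in>entourages X. E \<inter> F \<in> entourages X) \<and>
     (\<forall>E\<in>entourages X. E\<inverse> \<in> entourages X) \<and>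
     (\<forall>E\<in>entourages X. \<exists>D\<in>entourages X. D O D \<subseteq> E)"

definition utopology :: "'u uspace \<Rightarrow> 'u topology" where
  "utopology X =
     topology (\<lambda>S. S \<subseteq> points X \<and> (\<forall>x\<in>S. \<exists>E\<in>entourages X. E `` {x} \<subseteq> S))"

lemma openin_utopology:
  assumes "is_uspace X"
  shows "openin (utopology X) S \<longleftrightarrow>
           S \<subseteq> points X \<and> (\<forall>x\<in>S. \<exists>E\<in>entourages X. E `` {x} \<subseteq> S)"
proof -
  define nb where "nb S \<longleftrightarrow> (\<forall>x\<in>S. \<exists>E\<in>entourages X. E `` {x} \<subseteq> S)" for S
  have inter: "\<forall>E\<in>entourages X. \<forall>F\<in>entourages X. E \<inter> F \<in> entourages X"
    using assms unfolding is_uspace_def by (elim conjE)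
  have nb_Int: "nb (S \<inter> T)" if S: "nb S" and T: "nb T" for S T
    unfolding nb_def
  proof
    fix x assume x: "x \<in> S \<inter> T"
    obtain E where E: "E \<in> entourages X" "E `` {x} \<subseteq> S"
      using S x unfolding nb_def by blast
    obtain F where F: "F \<in> entourages X" "F `` {x} \<subseteq> T"
      using T x unfolding nb_def by blast
    have "(E \<inter> F) `` {x} \<subseteq> S \<inter> T"
      using E(2) F(2) by blast
    then show "\<exists>E\<in>entourages X. E `` {x} \<subseteq> S \<inter> T"
      using inter[rule_format, OF E(1) F(1)] by (rule bexI)
  qed
  have nb_Union: "nb (\<Union>\<K>)" if K: "\<And>K. K \<in> \<K> \<Longrightarrow> nb K" for \<K>
    unfolding nb_def
  proof
    fix x assume "x \<in> \<Union>\<K>"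
    then obtain K where "K \<in> \<K>" "x \<in> K" by (rule UnionE)
    moreover obtain E where "E \<in> entourages X" "E `` {x} \<subseteq> K"
      using K[OF \<open>K \<in> \<K>\<close>, unfolded nb_def, rule_format, OF \<open>x \<in> K\<close>] by (rule bexE)
    ultimately show "\<exists>E\<in>entourages X. E `` {x} \<subseteq> \<Union>\<K>"
      by (meson Union_upper subset_trans)
  qed
  have "istopology (\<lambda>S. S \<subseteq> points X \<and> nb S)"
    unfolding istopology_def
  proof (intro conjI allI impI)
    fix S T assume "S \<subseteq> points X \<and> nb S" "T \<subseteq> points X \<and> nb T"
    then show "S \<inter> T \<subseteq> points X" "nb (S \<inter> T)"
      using nb_Int by (blast, simp)
  next
    fix \<K> assume K: "\<forall>K\<in>\<K>. K \<subseteq> points X \<and> nb K"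
    then show "\<Union>\<K> \<subseteq> points X"
      by (intro Union_least) simp
    show "nb (\<Union>\<K>)"
      by (rule nb_Union) (simp add: K)
  qed
  then have "openin (utopology X) = (\<lambda>S. S \<subseteq> points X \<and> nb S)"
    unfolding utopology_def nb_def by (rule topology_inverse')
  then show ?thesis
    unfolding nb_def by (rule fun_cong)
qed

lemma topspace_utopology:
  assumes "is_uspace X"
  shows "topspace (utopology X) = points X"
proof (rule subset_antisym)
  show "topspace (utopology X) \<subseteq> points X"
    using openin_utopology[OF assms, THEN iffD1, OF openin_topspace] by (rule conjunct1)
  have "\<exists>E\<in>entourages X. E `` {x} \<subseteq> points X" for x
  proof (rule bexI)
    show "(points X \<times> points X) `` {x} \<subseteq> points X"
      by auto
    show "points X \<times> points X \<in> entourages X"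
      using assms unfolding is_uspace_def by (rule conjunct1)
  qed
  then have "openin (utopology X) (points X)"
    using openin_utopology[OF assms, of "points X"] by simp
  then show "points X \<subseteq> topspace (utopology X)"
    by (rule openin_subset)
qed

definition uniform_cover :: "'u uspace \<Rightarrow> 'u set set \<Rightarrow> bool" where
  "uniform_cover X \<U> \<longleftrightarrow>
     \<Union>\<U> = points X \<and> (\<exists>E\<in>entourages X. \<forall>x\<in>points X. \<exists>A\<in>\<U>. E `` {x} \<subseteq> A)"

definition refines :: "'u set set \<Rightarrow> 'u set set \<Rightarrow> bool" where
  "refines \<V> \<U> \<longleftrightarrow> (\<forall>V\<in>\<V>. \<exists>U\<in>\<U>. V \<subseteq> U)"

definition has_cover_base_below :: "'u uspace \<Rightarrow> 'u rel \<Rightarrow> bool" where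
  "has_cover_base_below X l \<longleftrightarrow>
     (\<exists>B. (\<forall>\<V>\<in>B. uniform_cover X \<V> \<and> |\<V>| <o l) \<and>
          (\<forall>\<U>. uniform_cover X \<U> \<longrightarrow> (\<exists>\<V>\<in>B. refines \<V> \<U>)))"

text \<open>Cardinals are represented by cardinal orders, hence determined only up to \<open>=o\<close>.\<close>

definition is_covering_character :: "'u uspace \<Rightarrow> 'u rel \<Rightarrow> bool" where
  "is_covering_character X l \<longleftrightarrow>
     Cinfinite l \<and> has_cover_base_below X l \<and>
     (\<forall>m :: 'u rel. Cinfinite m \<and> has_cover_base_below X m \<longrightarrow> l \<le>o m)"


section \<open>The category of Hausdorff uniform spaces\<close>

definition T2Unif :: "'u uspace set" where
  "T2Unif = {X. is_uspace X \<and> small (points X) \<and> Hausdorff_space (utopology X)}"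

text \<open>Morphisms are extensional functions, so that equality of morphisms is equality in HOL.\<close>

definition hom :: "'u uspace \<Rightarrow> 'u uspace \<Rightarrow> ('u \<Rightarrow> 'u) set" where
  "hom X Y = {f \<in> points X \<rightarrow>\<^sub>E points Y.
     \<forall>F\<in>entourages Y. \<exists>E\<in>entourages X. \<forall>(x, y)\<in>E. (f x, f y) \<in> F}"

definition ident :: "'u uspace \<Rightarrow> 'u \<Rightarrow> 'u" where
  "ident X = restrict id (points X)"

abbreviation comp_from :: "'u uspace \<Rightarrow> ('u \<Rightarrow> 'u) \<Rightarrow> ('u \<Rightarrow> 'u) \<Rightarrow> 'u \<Rightarrow> 'u" where
  "comp_from X g f \<equiv> compose (points X) g f"

definition isomorphism :: "'u uspace \<Rightarrow> 'u uspace \<Rightarrow> ('u \<Rightarrow> 'u) \<Rightarrow> bool" where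
  "isomorphism X Y f \<longleftrightarrow>
     f \<in> hom X Y \<and>
     (\<exists>g\<in>hom Y X. comp_from X g f = ident X \<and> comp_from Y f g = ident Y)"

definition monomorphism :: "'u uspace \<Rightarrow> 'u uspace \<Rightarrow> ('u \<Rightarrow> 'u) \<Rightarrow> bool" where
  "monomorphism X Y m \<longleftrightarrow>
     m \<in> hom X Y \<and>
     (\<forall>Z\<in>T2Unif. \<forall>g\<in>hom Z X. \<forall>h\<in>hom Z X. comp_from Z m g = comp_from Z m h \<longrightarrow> g = h)"

definition epimorphism :: "'u uspace \<Rightarrow> 'u uspace \<Rightarrow> ('u \<Rightarrow> 'u) \<Rightarrow> bool" where
  "epimorphism X Y e \<longleftrightarrow>
     e \<in> hom X Y \<and>
     (\<forall>Z\<in>T2Unif. \<forall>g\<in>hom Y Z. \<forall>h\<in>hom Y Z. comp_from X g e = comp_from X h e \<longrightarrow> g = h)"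

definition bimorphism :: "'u uspace \<Rightarrow> 'u uspace \<Rightarrow> ('u \<Rightarrow> 'u) \<Rightarrow> bool" where
  "bimorphism X Y f \<longleftrightarrow> monomorphism X Y f \<and> epimorphism X Y f"

definition extremal_mono :: "'u uspace \<Rightarrow> 'u uspace \<Rightarrow> ('u \<Rightarrow> 'u) \<Rightarrow> bool" where
  "extremal_mono X Y m \<longleftrightarrow>
     monomorphism X Y m \<and>
     (\<forall>Z\<in>T2Unif. \<forall>e g. epimorphism X Z e \<and> g \<in> hom Z Y \<and> m = comp_from X g e \<longrightarrow>
        isomorphism X Z e)"

definition extremal_epi :: "'u uspace \<Rightarrow> 'u uspace \<Rightarrow> ('u \<Rightarrow> 'u) \<Rightarrow> bool" where
  "extremal_epi X Y e \<longleftrightarrow>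
     epimorphism X Y e \<and>
     (\<forall>Z\<in>T2Unif. \<forall>g m. g \<in> hom X Z \<and> monomorphism Z Y m \<and> e = comp_from X m g \<longrightarrow>
        isomorphism Z Y m)"

definition is_product ::
    "'u set \<Rightarrow> ('u \<Rightarrow> 'u uspace) \<Rightarrow> 'u uspace \<Rightarrow> ('u \<Rightarrow> 'u \<Rightarrow> 'u) \<Rightarrow> bool" where
  "is_product I X P p \<longleftrightarrow>
     P \<in> T2Unif \<and> (\<forall>i\<in>I. p i \<in> hom P (X i)) \<and>
     (\<forall>Z\<in>T2Unif. \<forall>f. (\<forall>i\<in>I. f i \<in> hom Z (X i)) \<longrightarrow>
        (\<exists>!g. g \<in> hom Z P \<and> (\<forall>i\<in>I. comp_from Z (p i) g = f i)))"


section \<open>Subcategories\<close>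

text \<open>Full isomorphism-closed subcategories are identified with their classes of objects.\<close>

definition subcategory :: "'u uspace set \<Rightarrow> bool" where
  "subcategory C \<longleftrightarrow>
     C \<subseteq> T2Unif \<and> (\<forall>X\<in>C. \<forall>Y\<in>T2Unif. (\<exists>f. isomorphism X Y f) \<longrightarrow> Y \<in> C)"

definition reflection_arrow ::
    "'u uspace set \<Rightarrow> 'u uspace \<Rightarrow> 'u uspace \<Rightarrow> ('u \<Rightarrow> 'u) \<Rightarrow> bool" where
  "reflection_arrow C X R r \<longleftrightarrow>
     R \<in> C \<and> r \<in> hom X R \<and>
     (\<forall>Y\<in>C. \<forall>f\<in>hom X Y. \<exists>!g. g \<in> hom R Y \<and> comp_from X g r = f)"

definition reflective :: "'u uspace set \<Rightarrow> bool" where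
  "reflective C \<longleftrightarrow> (\<forall>X\<in>T2Unif. \<exists>R r. reflection_arrow C X R r)"

definition epireflective :: "'u uspace set \<Rightarrow> bool" where
  "epireflective C \<longleftrightarrow>
     reflective C \<and>
     (\<forall>X\<in>T2Unif. \<forall>R r. reflection_arrow C X R r \<longrightarrow> epimorphism X R r)"

definition closed_under_products :: "'u uspace set \<Rightarrow> bool" where
  "closed_under_products C \<longleftrightarrow>
     (\<forall>I X P p. small I \<and> (\<forall>i\<in>I. X i \<in> C) \<and> is_product I X P p \<longrightarrow> P \<in> C)"

definition closed_under_extremal_subobjects :: "'u uspace set \<Rightarrow> bool" where
  "closed_under_extremal_subobjects C \<longleftrightarrow>
     (\<forall>Y\<in>C. \<forall>X\<in>T2Unif. \<forall>m. extremal_mono X Y m \<longrightarrow> X \<in> C)"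

definition closed_under_images ::
    "('u uspace \<Rightarrow> 'u uspace \<Rightarrow> ('u \<Rightarrow> 'u) \<Rightarrow> bool) \<Rightarrow> 'u uspace set \<Rightarrow> bool" where
  "closed_under_images E C \<longleftrightarrow> (\<forall>X\<in>C. \<forall>Y\<in>T2Unif. \<forall>e. E X Y e \<longrightarrow> Y \<in> C)"

definition of_listed_form :: "'u uspace set \<Rightarrow> bool" where
  "of_listed_form C \<longleftrightarrow>
     C = {X \<in> T2Unif. finite (points X) \<and> card (points X) \<le> 1} \<or>
     C = {X \<in> T2Unif. compact_space (utopology X)} \<or>
     (\<exists>l0 :: 'u rel. Cinfinite l0 \<and> l0 <o |UNIV :: 'u set| \<and>
        C = {X \<in> T2Unif. \<exists>l. is_covering_character X l \<and> l \<le>o l0}) \<or>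
     C = T2Unif"

end

theory Submission
  imports Defs
begin

text \<open>
  Let \<open>C\<close> be closed under products, closed subspaces and images with dense range. A Hausdorff uniform space
  \<open>X\<close> is coded by the product \<open>P\<close> of maximal \<open>E\<close>-separated sets \<open>A E\<close>, taken as uniformly discrete
  spaces, over all symmetric entourages \<open>E\<close>: the codes that converge in \<open>X\<close> form a subspace
  \<open>W\<close> of \<open>P\<close> that maps onto \<open>X\<close>, and no completeness of \<open>X\<close> is needed. If \<open>X\<close> is compact, then every \<open>A E\<close>
  is finite and \<open>W\<close> is closed. If \<open>C\<close> has a noncompact member, then \<open>C\<close> contains the cubes
  \<open>{0, 1}\<^sup>K\<close> without the point \<open>0\<close>, so all complements of points in \<open>P\<close> belong to \<open>C\<close>, and with them
  every subspace of \<open>P\<close>, being a closed subspace of a product of such complements. Hence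
  membership in \<open>C\<close> only depends on the cardinalities of the separated sets, and the covering character is
  the least infinite cardinal exceeding all of these.
\<close>

section \<open>Uniform spaces on arbitrary types\<close>

text \<open>What a noncompact member Z contributes is a map \<phi> from a space of the class into a
  cube that never takes the value 0 but has 0 in the closure of its range. If Z has an infinite
  uniformly discrete subset D, the indicators \<open>w = m\<close> with m in D form such a map.
  Otherwise all nets of Z are finite and its space of codes is compact; the convergent codes then
  cannot form a closed set, since Z would be compact as their image. A code f in their closure that
  has no limit yields the coordinates \<open>g E \<noteq> f E\<close>. The convergent codes are not
  known to belong to the class, but the graph of convergence is closed in codes times Z, so it does,
  and \<phi> is defined on this graph. Dense images that are not onto are needed in the
  classification only to fill the punctured cubes. The cardinal \<open>l0\<close> is the least size
  of a small discrete space outside the class; if there is none, the class consists of all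
  spaces.\<close>

definition ucont :: "'a uspace \<Rightarrow> 'b uspace \<Rightarrow> ('a \<Rightarrow> 'b) \<Rightarrow> bool" where
  "ucont X Y f \<longleftrightarrow> f ` points X \<subseteq> points Y \<and>
     (\<forall>F\<in>entourages Y. \<exists>E\<in>entourages X. \<forall>x y. (x, y) \<in> E \<longrightarrow> (f x, f y) \<in> F)"

definition t2space :: "'a uspace \<Rightarrow> bool" where
  "t2space X \<longleftrightarrow> is_uspace X \<and>
     (\<forall>x\<in>points X. \<forall>y\<in>points X. x \<noteq> y \<longrightarrow> (\<exists>E\<in>entourages X. (x, y) \<notin> E))"

definition uiso :: "'a uspace \<Rightarrow> 'b uspace \<Rightarrow> ('a \<Rightarrow> 'b) \<Rightarrow> ('b \<Rightarrow> 'a) \<Rightarrow> bool" where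
  "uiso X Y j k \<longleftrightarrow> ucont X Y j \<and> ucont Y X k \<and>
     (\<forall>x\<in>points X. k (j x) = x) \<and> (\<forall>y\<in>points Y. j (k y) = y)"

text \<open>\<open>ucont\<close> isolates the continuity half of \<open>hom\<close>, without
  extensionality and with possibly different types for source and target. Cubes, code spaces, glued
  spaces and the unit interval live on other types than \<open>'u\<close> and are copied there only
  when an object of the category is needed.\<close>

lemma hom_iff: "f \<in> hom X Y \<longleftrightarrow> f \<in> extensional (points X) \<and> ucont X Y f"
proof -
  have "(\<forall>(x, y)\<in>E. (f x, f y) \<in> F) \<longleftrightarrow> (\<forall>x y. (x, y) \<in> E \<longrightarrow> (f x, f y) \<in> F)" for E F
    by auto
  then show ?thesis
    by (auto simp: hom_def ucont_def PiE_def Pi_def)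
qed

lemma hom_ucont: "f \<in> hom X Y \<Longrightarrow> ucont X Y f"
  by (simp add: hom_iff)

lemma ucontI:
  assumes "\<And>x. x \<in> points X \<Longrightarrow> f x \<in> points Y"
    and "\<And>F. F \<in> entourages Y \<Longrightarrow> \<exists>E\<in>entourages X. \<forall>x y. (x, y) \<in> E \<longrightarrow> (f x, f y) \<in> F"
  shows "ucont X Y f"
  using assms unfolding ucont_def by blast

lemma ucontD: "ucont X Y f \<Longrightarrow> x \<in> points X \<Longrightarrow> f x \<in> points Y"
  by (auto simp: ucont_def)

lemma ucont_entD:
  "ucont X Y f \<Longrightarrow> F \<in> entourages Y \<Longrightarrow> \<exists>E\<in>entourages X. \<forall>x y. (x, y) \<in> E \<longrightarrow> (f x, f y) \<in> F"
  by (auto simp: ucont_def)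

lemma ucont_comp:
  assumes "ucont X Y f" "ucont Y Z g"
  shows "ucont X Z (\<lambda>x. g (f x))"
proof (rule ucontI)
  fix F assume "F \<in> entourages Z"
  then obtain E where E: "E \<in> entourages Y" "\<forall>x y. (x, y) \<in> E \<longrightarrow> (g x, g y) \<in> F"
    using ucont_entD[OF assms(2)] by blast
  then show "\<exists>E\<in>entourages X. \<forall>x y. (x, y) \<in> E \<longrightarrow> (g (f x), g (f y)) \<in> F"
    using ucont_entD[OF assms(1) E(1)] by blast
qed (meson assms ucontD)

lemma ucont_id: "ucont X X (\<lambda>x. x)"
  by (rule ucontI) auto

section \<open>Entourage calculus and the induced topology\<close>

context
  fixes X :: "'a uspace"
  assumes X: "is_uspace X"
begin

lemma ent_top: "points X \<times> points X \<in> entourages X"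
  by (rule X[unfolded is_uspace_def, THEN conjunct1])

lemma ent_sub: "E \<in> entourages X \<Longrightarrow> E \<subseteq> points X \<times> points X"
  by (rule X[unfolded is_uspace_def, THEN conjunct2, THEN conjunct1, THEN bspec, THEN conjunct2])

lemma ent_refl:
  assumes "E \<in> entourages X" "x \<in> points X"
  shows "(x, x) \<in> E"
proof -
  have "Id_on (points X) \<subseteq> E"
    by (rule X[unfolded is_uspace_def, THEN conjunct2, THEN conjunct1, THEN bspec, OF assms(1), THEN conjunct1])
  then show ?thesis
    using assms(2) by auto
qed

lemma ent_mono:
  "E \<in> entourages X \<Longrightarrow> E \<subseteq> F \<Longrightarrow> F \<subseteq> points X \<times> points X \<Longrightarrow> F \<in> entourages X"
  by (rule X[unfolded is_uspace_def, THEN conjunct2, THEN conjunct2, THEN conjunct1, rule_format, OF _ conjI])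

lemma ent_Int: "E \<in> entourages X \<Longrightarrow> F \<in> entourages X \<Longrightarrow> E \<inter> F \<in> entourages X"
  by (rule X[unfolded is_uspace_def, THEN conjunct2, THEN conjunct2, THEN conjunct2, THEN conjunct1, rule_format])

lemma ent_converse: "E \<in> entourages X \<Longrightarrow> E\<inverse> \<in> entourages X"
  by (rule X[unfolded is_uspace_def, THEN conjunct2, THEN conjunct2, THEN conjunct2, THEN conjunct2,
        THEN conjunct1, rule_format])

lemma ent_half: "E \<in> entourages X \<Longrightarrow> \<exists>D\<in>entourages X. D O D \<subseteq> E"
  by (rule X[unfolded is_uspace_def, THEN conjunct2, THEN conjunct2, THEN conjunct2, THEN conjunct2,
        THEN conjunct2, rule_format])

lemma ent_half_sym:
  assumes "E \<in> entourages X"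
  shows "\<exists>D\<in>entourages X. sym D \<and> D \<subseteq> E \<and> D O D \<subseteq> E"
proof -
  obtain D where D: "D \<in> entourages X" "D O D \<subseteq> E"
    using ent_half[OF assms] by blast
  have "D \<subseteq> D O D"
    using ent_sub[OF D(1)] ent_refl[OF D(1)] by auto
  moreover have "D \<inter> D\<inverse> \<in> entourages X"
    using D ent_Int ent_converse by blast
  moreover have "sym (D \<inter> D\<inverse>)"
    by (auto simp: sym_def)
  ultimately show ?thesis
    using D(2) by (intro bexI[of _ "D \<inter> D\<inverse>"]) blast+
qed

lemma ent_sym: "E \<in> entourages X \<Longrightarrow> \<exists>D\<in>entourages X. sym D \<and> D \<subseteq> E"
  using ent_half_sym by blast

lemma ent_quarter_sym:
  assumes "E \<in> entourages X"
  shows "\<exists>D\<in>entourages X. sym D \<and> D \<subseteq> E \<and> D O D \<subseteq> E \<and> D O D O D \<subseteq> E \<and> D O D O D O D \<subseteq> E"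
proof -
  obtain F where F: "F \<in> entourages X" "sym F" "F \<subseteq> E" "F O F \<subseteq> E"
    using ent_half_sym[OF assms] by blast
  obtain D where D: "D \<in> entourages X" "sym D" "D \<subseteq> F" "D O D \<subseteq> F"
    using ent_half_sym[OF F(1)] by blast
  have "D O D O D \<subseteq> E"
    using D F by (meson order_trans relcomp_mono)
  moreover have "D O D O D O D \<subseteq> E"
    using relcomp_mono[OF D(4) D(4)] F(4) by (metis O_assoc order_trans)
  ultimately show ?thesis
    using D F by (intro bexI[of _ D]) auto
qed

lemma ent_INT:
  assumes "finite J" "\<And>j. j \<in> J \<Longrightarrow> E j \<in> entourages X"
  shows "\<exists>D\<in>entourages X. \<forall>j\<in>J. D \<subseteq> E j"
  using assms
proof (induction J)
  case empty
  then show ?case using ent_top by blast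
next
  case (insert i J)
  then obtain D where "D \<in> entourages X" "\<forall>j\<in>J. D \<subseteq> E j"
    by blast
  with insert.prems ent_Int[of D "E i"] show ?case
    by (intro bexI[of _ "D \<inter> E i"]) auto
qed

lemma ent_vimage:
  assumes "ucont X Y f" "F \<in> entourages Y"
  shows "{(x, y). x \<in> points X \<and> y \<in> points X \<and> (f x, f y) \<in> F} \<in> entourages X"
proof -
  obtain E where E: "E \<in> entourages X" "\<forall>x y. (x, y) \<in> E \<longrightarrow> (f x, f y) \<in> F"
    using ucont_entD[OF assms] by blast
  show ?thesis
    by (rule ent_mono[OF E(1)]) (use ent_sub[OF E(1)] E(2) in auto)
qed

lemma in_utopology_closure_of:
  "x \<in> utopology X closure_of S \<longleftrightarrow>
     x \<in> points X \<and> (\<forall>E\<in>entourages X. \<exists>s\<in>S. (x, s) \<in> E)"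
proof safe
  assume x: "x \<in> utopology X closure_of S"
  then show "x \<in> points X"
    using topspace_utopology[OF X] by (simp add: in_closure_of)
  fix E assume E: "E \<in> entourages X"
  \<comment> \<open>\<open>U\<close> is the interior of the ball of E around x; halving an entourage
    shows that it is open.\<close>
  define U where "U = {y \<in> points X. \<exists>F\<in>entourages X. F `` {y} \<subseteq> E `` {x}}"
  have "openin (utopology X) U"
    unfolding openin_utopology[OF X]
  proof safe
    fix y assume "y \<in> U"
    then obtain F where F: "F \<in> entourages X" "F `` {y} \<subseteq> E `` {x}" "y \<in> points X"
      by (auto simp: U_def)
    obtain D where D: "D \<in> entourages X" "D O D \<subseteq> F"
      using ent_half F by blast
    then have "D `` {y} \<subseteq> U"
      using F ent_sub[OF D(1)] unfolding U_def
      by (intro subsetI CollectI conjI bexI[of _ D]) auto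
    then show "\<exists>E\<in>entourages X. E `` {y} \<subseteq> U"
      using D by blast
  qed (simp add: U_def)
  moreover have "x \<in> U"
    using E \<open>x \<in> points X\<close> by (auto simp: U_def)
  ultimately obtain s where "s \<in> S" "s \<in> U"
    using x by (auto simp: in_closure_of)
  then show "\<exists>s\<in>S. (x, s) \<in> E"
    using ent_refl by (auto simp: U_def)
next
  assume x: "x \<in> points X" "\<forall>E\<in>entourages X. \<exists>s\<in>S. (x, s) \<in> E"
  show "x \<in> utopology X closure_of S"
    unfolding in_closure_of topspace_utopology[OF X] openin_utopology[OF X]
    using x by blast
qed

lemma closedin_utopology:
  "closedin (utopology X) S \<longleftrightarrow> S \<subseteq> points X \<and>
     (\<forall>x\<in>points X. (\<forall>E\<in>entourages X. \<exists>s\<in>S. (x, s) \<in> E) \<longrightarrow> x \<in> S)"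
proof -
  have "closedin (utopology X) S \<longleftrightarrow> S \<subseteq> points X \<and> utopology X closure_of S \<subseteq> S"
    using closure_of_subset_eq topspace_utopology[OF X] by (metis)
  then show ?thesis
    using in_utopology_closure_of by auto
qed

lemma Hausdorff_utopology:
  "Hausdorff_space (utopology X) \<longleftrightarrow>
     (\<forall>x\<in>points X. \<forall>y\<in>points X. x \<noteq> y \<longrightarrow> (\<exists>E\<in>entourages X. (x, y) \<notin> E))"
proof
  assume H: "Hausdorff_space (utopology X)"
  show "\<forall>x\<in>points X. \<forall>y\<in>points X. x \<noteq> y \<longrightarrow> (\<exists>E\<in>entourages X. (x, y) \<notin> E)"
  proof safe
    fix x y assume xy: "x \<in> points X" "y \<in> points X" "x \<noteq> y"
    then obtain U V where UV: "openin (utopology X) U" "openin (utopology X) V"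
      "x \<in> U" "y \<in> V" "disjnt U V"
      using H[unfolded Hausdorff_space_def topspace_utopology[OF X], rule_format, of x y] by blast
    then obtain E where "E \<in> entourages X" "E `` {x} \<subseteq> U"
      unfolding openin_utopology[OF X] by blast
    then show "\<exists>E\<in>entourages X. (x, y) \<notin> E"
      using UV by (auto simp: disjnt_iff)
  qed
next
  assume sep: "\<forall>x\<in>points X. \<forall>y\<in>points X. x \<noteq> y \<longrightarrow> (\<exists>E\<in>entourages X. (x, y) \<notin> E)"
  show "Hausdorff_space (utopology X)"
    unfolding Hausdorff_space_def topspace_utopology[OF X]
  proof safe
    fix x y assume xy: "x \<in> points X" "y \<in> points X" "x \<noteq> y"
    then obtain E where E: "E \<in> entourages X" "(x, y) \<notin> E"
      using sep by blast
    obtain D where D: "D \<in> entourages X" "sym D" "D O D O D O D \<subseteq> E"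
      using ent_quarter_sym[OF E(1)] by blast
    \<comment> \<open>The interior of the D-ball around z, written as the complement of a closure so
      that it is open at once. If two of these sets meet, then x and y are two D-steps apart; the
      reflexive steps below only pad this to the fourfold composite.\<close>
    define U where "U z = - (utopology X closure_of (points X - D `` {z})) \<inter> points X" for z
    have U: "openin (utopology X) (U z)" for z
    proof -
      have "U z = topspace (utopology X) - utopology X closure_of (points X - D `` {z})"
        by (auto simp: U_def topspace_utopology[OF X])
      then show ?thesis
        by (simp add: openin_diff)
    qed
    have UD: "U z \<subseteq> D `` {z}" for z
      using closure_of_subset[of "points X - D `` {z}" "utopology X"]
      by (auto simp: U_def topspace_utopology[OF X])
    have "z \<in> U z" if "z \<in> points X" for z
      using that D(1) by (auto simp: U_def in_utopology_closure_of)
    moreover have "disjnt (U x) (U y)"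
    proof -
      { fix z assume "z \<in> U x" "z \<in> U y"
        then have "(x, z) \<in> D" "(y, z) \<in> D"
          using UD by auto
        then have "(x, y) \<in> D O D O D O D"
          using D(2) ent_refl[OF D(1) xy(1)] ent_refl[OF D(1) xy(2)] by (auto dest: symD)
        then have False
          using D(3) E(2) by blast }
      then show ?thesis
        by (auto simp: disjnt_iff)
    qed
    ultimately show "\<exists>U V. openin (utopology X) U \<and> openin (utopology X) V \<and> x \<in> U \<and> y \<in> V \<and> disjnt U V"
      using U xy by blast
  qed
qed

end

lemma t2space_uspace: "t2space X \<Longrightarrow> is_uspace X"
  by (simp add: t2space_def)

lemma T2Unif_iff: "X \<in> T2Unif \<longleftrightarrow> t2space X \<and> small (points X)"
  unfolding T2Unif_def t2space_def using Hausdorff_utopology by blast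

lemma T2Unif_t2space: "X \<in> T2Unif \<Longrightarrow> t2space X"
  by (simp add: T2Unif_iff)

lemma T2Unif_uspace: "X \<in> T2Unif \<Longrightarrow> is_uspace X"
  by (simp add: T2Unif_iff t2space_def)

lemma t2spaceD:
  "t2space X \<Longrightarrow> x \<in> points X \<Longrightarrow> y \<in> points X \<Longrightarrow>
     (\<And>E. E \<in> entourages X \<Longrightarrow> (x, y) \<in> E) \<Longrightarrow> x = y"
  unfolding t2space_def by blast

lemma ucont_continuous_map:
  assumes "is_uspace X" "is_uspace Y" "ucont X Y f"
  shows "continuous_map (utopology X) (utopology Y) f"
proof -
  have "f ` (utopology X closure_of S) \<subseteq> utopology Y closure_of f ` S" for S
  proof safe
    fix x assume x: "x \<in> utopology X closure_of S"
    have "\<exists>s\<in>S. (f x, f s) \<in> F" if "F \<in> entourages Y" for F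
      using ucont_entD[OF assms(3) that] x by (meson assms(1) in_utopology_closure_of)
    moreover have "f x \<in> points Y"
      using x ucontD[OF assms(3)] in_utopology_closure_of[OF assms(1)] by blast
    ultimately show "f x \<in> utopology Y closure_of f ` S"
      by (auto simp: in_utopology_closure_of[OF assms(2)])
  qed
  moreover have "f \<in> topspace (utopology X) \<rightarrow> topspace (utopology Y)"
    using assms by (auto simp: topspace_utopology ucontD)
  ultimately show ?thesis
    by (auto simp: continuous_map_eq_image_closure_subset)
qed

lemma ucont_eq_on_dense:
  assumes "is_uspace X" "t2space Y" "ucont X Y f" "ucont X Y g"
    and eq: "\<And>s. s \<in> S \<Longrightarrow> f s = g s" and x: "x \<in> utopology X closure_of S"
  shows "f x = g x"
proof (rule t2spaceD[OF assms(2)])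
  have uY: "is_uspace Y"
    by (rule t2space_uspace[OF assms(2)])
  have x': "x \<in> points X"
    using x in_utopology_closure_of[OF assms(1)] by blast
  then show "f x \<in> points Y" "g x \<in> points Y"
    using assms ucontD by metis+
  fix E assume "E \<in> entourages Y"
  then obtain D where D: "D \<in> entourages Y" "sym D" "D O D \<subseteq> E"
    using ent_half_sym[OF uY] by blast
  obtain F where F: "F \<in> entourages X" "\<forall>x y. (x, y) \<in> F \<longrightarrow> (f x, f y) \<in> D"
    using ucont_entD[OF assms(3) D(1)] by blast
  obtain G where G: "G \<in> entourages X" "\<forall>x y. (x, y) \<in> G \<longrightarrow> (g x, g y) \<in> D"
    using ucont_entD[OF assms(4) D(1)] by blast
  obtain s where s: "s \<in> S" "(x, s) \<in> F \<inter> G"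
    using x ent_Int[OF assms(1) F(1) G(1)] in_utopology_closure_of[OF assms(1)] by blast
  then have "(f x, f s) \<in> D" "(g x, g s) \<in> D"
    using F G by auto
  then have "(f x, f s) \<in> D" "(f s, g x) \<in> D"
    using D(2) eq[OF s(1)] by (auto dest: symD)
  then show "(f x, g x) \<in> E"
    using D by blast
qed


subsection \<open>Initial uniformities, subspaces and products\<close>

definition ugen :: "'a set \<Rightarrow> ('a \<times> 'a) set set \<Rightarrow> 'a uspace" where
  "ugen S B = \<lparr>points = S, entourages = {E. E \<subseteq> S \<times> S \<and> (\<exists>D\<in>B. D \<subseteq> E)}\<rparr>"

lemma points_ugen [simp]: "points (ugen S B) = S"
  by (simp add: ugen_def)

lemma entourages_ugen: "E \<in> entourages (ugen S B) \<longleftrightarrow> E \<subseteq> S \<times> S \<and> (\<exists>D\<in>B. D \<subseteq> E)"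
  by (simp add: ugen_def)

lemma is_uspace_ugen:
  assumes ne: "B \<noteq> {}" and refl: "\<And>D. D \<in> B \<Longrightarrow> Id_on S \<subseteq> D"
    and sub: "\<And>D. D \<in> B \<Longrightarrow> D \<subseteq> S \<times> S"
    and int: "\<And>D D'. D \<in> B \<Longrightarrow> D' \<in> B \<Longrightarrow> \<exists>D''\<in>B. D'' \<subseteq> D \<inter> D'"
    and conv: "\<And>D. D \<in> B \<Longrightarrow> \<exists>D'\<in>B. D' \<subseteq> D\<inverse>"
    and half: "\<And>D. D \<in> B \<Longrightarrow> \<exists>D'\<in>B. D' O D' \<subseteq> D"
  shows "is_uspace (ugen S B)"
proof -
  let ?X = "ugen S B"
  have ent: "E \<in> entourages ?X" if "D \<in> B" "D \<subseteq> E" "E \<subseteq> S \<times> S" for D E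
    unfolding entourages_ugen using that by blast
  have entE: "\<exists>D\<in>B. D \<subseteq> E" "E \<subseteq> S \<times> S" if "E \<in> entourages ?X" for E
    using that unfolding entourages_ugen by simp_all
  show ?thesis
    unfolding is_uspace_def points_ugen
  proof (intro conjI ballI allI impI)
    show "S \<times> S \<in> entourages ?X"
      using ne sub ent by blast
  next
    fix E F assume E: "E \<in> entourages ?X" and F: "F \<in> entourages ?X"
    obtain D where D: "D \<in> B" "D \<subseteq> E"
      using entE(1)[OF E] by blast
    obtain D' where D': "D' \<in> B" "D' \<subseteq> F"
      using entE(1)[OF F] by blast
    obtain D'' where D'': "D'' \<in> B" "D'' \<subseteq> D \<inter> D'"
      using int[OF D(1) D'(1)] by blast
    have "D'' \<subseteq> E \<inter> F"
      using D(2) D'(2) D''(2) by blast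
    then show "E \<inter> F \<in> entourages ?X"
      using entE(2)[OF E] by (intro ent[OF D''(1)]) blast+
  next
    fix E assume E: "E \<in> entourages ?X"
    obtain D where D: "D \<in> B" "D \<subseteq> E"
      using entE(1)[OF E] by blast
    show "Id_on S \<subseteq> E"
      using refl[OF D(1)] D(2) by (rule order_trans)
    show "E \<subseteq> S \<times> S"
      by (rule entE(2)[OF E])
    show "F \<in> entourages ?X" if F: "E \<subseteq> F \<and> F \<subseteq> S \<times> S" for F
      using D F by (intro ent[OF D(1)]) (blast intro: order_trans)+
    obtain D1 where D1: "D1 \<in> B" "D1 \<subseteq> D\<inverse>"
      using conv[OF D(1)] by blast
    show "E\<inverse> \<in> entourages ?X"
    proof (rule ent[OF D1(1)])
      show "D1 \<subseteq> E\<inverse>"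
        using D1(2) D(2) by blast
      show "E\<inverse> \<subseteq> S \<times> S"
        using entE(2)[OF E] by blast
    qed
    obtain D2 where D2: "D2 \<in> B" "D2 O D2 \<subseteq> D"
      using half[OF D(1)] by blast
    show "\<exists>D\<in>entourages ?X. D O D \<subseteq> E"
    proof (rule bexI)
      show "D2 O D2 \<subseteq> E"
        using D2(2) D(2) by (rule order_trans)
      show "D2 \<in> entourages ?X"
        by (rule ent[OF D2(1) order_refl sub[OF D2(1)]])
    qed
  qed
qed

definition init_ent :: "'a set \<Rightarrow> 'i set \<Rightarrow> ('i \<Rightarrow> 'a \<Rightarrow> 'b) \<Rightarrow> ('i \<Rightarrow> ('b \<times> 'b) set) \<Rightarrow> ('a \<times> 'a) set" where
  "init_ent S J f F = {(x, y). x \<in> S \<and> y \<in> S \<and> (\<forall>i\<in>J. (f i x, f i y) \<in> F i)}"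

definition uinit :: "'a set \<Rightarrow> 'i set \<Rightarrow> ('i \<Rightarrow> 'a \<Rightarrow> 'b) \<Rightarrow> ('i \<Rightarrow> 'b uspace) \<Rightarrow> 'a uspace" where
  "uinit S I f Y = ugen S {init_ent S J f F | J F. finite J \<and> J \<subseteq> I \<and> (\<forall>i\<in>J. F i \<in> entourages (Y i))}"

definition uproduct :: "'i set \<Rightarrow> ('i \<Rightarrow> 'b uspace) \<Rightarrow> ('i \<Rightarrow> 'b) uspace" where
  "uproduct I Y = uinit (PiE I (\<lambda>i. points (Y i))) I (\<lambda>i x. x i) Y"

definition usub :: "'a uspace \<Rightarrow> 'a set \<Rightarrow> 'a uspace" where
  "usub X S = \<lparr>points = S, entourages = (\<lambda>E. E \<inter> S \<times> S) ` entourages X\<rparr>"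

definition udisc :: "'a set \<Rightarrow> 'a uspace" where
  "udisc A = \<lparr>points = A, entourages = {E. Id_on A \<subseteq> E \<and> E \<subseteq> A \<times> A}\<rparr>"

definition ucopy :: "('a \<Rightarrow> 'b) \<Rightarrow> 'a uspace \<Rightarrow> 'b uspace" where
  "ucopy j X = \<lparr>points = j ` points X, entourages = (\<lambda>E. map_prod j j ` E) ` entourages X\<rparr>"

text \<open>A property instead of the construction \<open>uinit\<close>: subspaces, products and
  graphs carry the initial uniformity of a family however they were built. The mapping property
  \<open>ucont_initial\<close> and the membership criterion \<open>realized_initial\<close> then
  apply to all of them.\<close>

definition initial_for :: "'a uspace \<Rightarrow> 'i set \<Rightarrow> ('i \<Rightarrow> 'a \<Rightarrow> 'b) \<Rightarrow> ('i \<Rightarrow> 'b uspace) \<Rightarrow> bool" where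
  "initial_for X I f Y \<longleftrightarrow> (\<forall>i\<in>I. ucont X (Y i) (f i)) \<and>
     (\<forall>E\<in>entourages X. \<exists>J F. finite J \<and> J \<subseteq> I \<and> (\<forall>i\<in>J. F i \<in> entourages (Y i)) \<and>
        init_ent (points X) J f F \<subseteq> E)"

lemma points_uinit [simp]: "points (uinit S I f Y) = S"
  by (simp add: uinit_def)

lemma points_uproduct [simp]: "points (uproduct I Y) = PiE I (\<lambda>i. points (Y i))"
  by (simp add: uproduct_def)

lemma points_usub [simp]: "points (usub X S) = S"
  by (simp add: usub_def)

lemma points_udisc [simp]: "points (udisc A) = A"
  by (simp add: udisc_def)

lemma points_ucopy [simp]: "points (ucopy j X) = j ` points X"
  by (simp add: ucopy_def)

lemma entourages_uinit:
  "E \<in> entourages (uinit S I f Y) \<longleftrightarrow> E \<subseteq> S \<times> S \<and>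
     (\<exists>J F. finite J \<and> J \<subseteq> I \<and> (\<forall>i\<in>J. F i \<in> entourages (Y i)) \<and> init_ent S J f F \<subseteq> E)"
  unfolding uinit_def entourages_ugen by blast

lemma init_ent_entourage:
  "finite J \<Longrightarrow> J \<subseteq> I \<Longrightarrow> (\<And>i. i \<in> J \<Longrightarrow> F i \<in> entourages (Y i)) \<Longrightarrow>
     init_ent S J f F \<in> entourages (uinit S I f Y)"
  unfolding entourages_uinit by (auto simp: init_ent_def)

lemma is_uspace_uinit:
  assumes Y: "\<And>i. i \<in> I \<Longrightarrow> is_uspace (Y i)" and f: "\<And>i x. i \<in> I \<Longrightarrow> x \<in> S \<Longrightarrow> f i x \<in> points (Y i)"
  shows "is_uspace (uinit S I f Y)"
  unfolding uinit_def
proof (rule is_uspace_ugen)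
  let ?B = "{init_ent S J f F | J F. finite J \<and> J \<subseteq> I \<and> (\<forall>i\<in>J. F i \<in> entourages (Y i))}"
  show "?B \<noteq> {}"
    by auto
  show "D \<subseteq> S \<times> S" if "D \<in> ?B" for D
    using that by (auto simp: init_ent_def)
  show "Id_on S \<subseteq> D" if "D \<in> ?B" for D
    using that f ent_refl[OF Y] by (fastforce simp: init_ent_def)
  show "\<exists>D''\<in>?B. D'' \<subseteq> D \<inter> D'" if DD: "D \<in> ?B" "D' \<in> ?B" for D D'
  proof -
    obtain J F where D: "D = init_ent S J f F" "finite J" "J \<subseteq> I" "\<forall>i\<in>J. F i \<in> entourages (Y i)"
      using DD by blast
    obtain J' F' where D': "D' = init_ent S J' f F'" "finite J'" "J' \<subseteq> I" "\<forall>i\<in>J'. F' i \<in> entourages (Y i)"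
      using DD by blast
    \<comment> \<open>Indices outside \<open>J\<close> or \<open>J'\<close> are padded with the full
      square, which imposes no condition, so that one family serves on the union.\<close>
    define G where "G i = (if i \<in> J then F i else points (Y i) \<times> points (Y i)) \<inter>
      (if i \<in> J' then F' i else points (Y i) \<times> points (Y i))" for i
    have "\<forall>i\<in>J \<union> J'. G i \<in> entourages (Y i)"
      using D D' ent_Int[OF Y] ent_top[OF Y] by (auto simp: G_def)
    then have "init_ent S (J \<union> J') f G \<in> ?B"
      using D D' by blast
    moreover have "init_ent S (J \<union> J') f G \<subseteq> D \<inter> D'"
      unfolding D D' by (auto simp: init_ent_def G_def)
    ultimately show ?thesis
      by blast
  qed
  fix D assume "D \<in> ?B"
  then obtain J F where D: "D = init_ent S J f F" "finite J" "J \<subseteq> I" "\<And>i. i \<in> J \<Longrightarrow> F i \<in> entourages (Y i)"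
    by blast
  have "init_ent S J f (\<lambda>i. (F i)\<inverse>) \<in> ?B"
    using D ent_converse[OF Y] by blast
  then show "\<exists>D'\<in>?B. D' \<subseteq> D\<inverse>"
    by (rule bexI[rotated]) (auto simp: init_ent_def D)
  have "\<forall>i\<in>J. \<exists>G\<in>entourages (Y i). G O G \<subseteq> F i"
    using D ent_half[OF Y] by blast
  then obtain G where G: "\<And>i. i \<in> J \<Longrightarrow> G i \<in> entourages (Y i)" "\<And>i. i \<in> J \<Longrightarrow> G i O G i \<subseteq> F i"
    by metis
  then have "init_ent S J f G \<in> ?B"
    using D by blast
  then show "\<exists>D'\<in>?B. D' O D' \<subseteq> D"
  proof (rule bexI[rotated])
    show "init_ent S J f G O init_ent S J f G \<subseteq> D"
    proof
      fix p assume "p \<in> init_ent S J f G O init_ent S J f G"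
      then obtain x y z where p: "p = (x, z)" "(x, y) \<in> init_ent S J f G" "(y, z) \<in> init_ent S J f G"
        by auto
      have "(f i x, f i z) \<in> F i" if "i \<in> J" for i
        using G(2)[OF that] p that by (auto simp: init_ent_def)
      then show "p \<in> D"
        using p by (simp add: D init_ent_def)
    qed
  qed
qed

lemma t2space_uinit:
  assumes Y: "\<And>i. i \<in> I \<Longrightarrow> t2space (Y i)" and f: "\<And>i x. i \<in> I \<Longrightarrow> x \<in> S \<Longrightarrow> f i x \<in> points (Y i)"
    and sep: "\<And>x y. x \<in> S \<Longrightarrow> y \<in> S \<Longrightarrow> (\<And>i. i \<in> I \<Longrightarrow> f i x = f i y) \<Longrightarrow> x = y"
  shows "t2space (uinit S I f Y)"
  unfolding t2space_def
proof (intro conjI ballI impI)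
  show "is_uspace (uinit S I f Y)"
    using assms by (intro is_uspace_uinit) (auto intro: t2space_uspace)
  fix x y assume xy: "x \<in> points (uinit S I f Y)" "y \<in> points (uinit S I f Y)" "x \<noteq> y"
  then obtain i where i: "i \<in> I" "f i x \<noteq> f i y"
    using sep by auto
  then obtain F where F: "F \<in> entourages (Y i)" "(f i x, f i y) \<notin> F"
    using t2spaceD[OF Y] f xy by (metis points_uinit)
  then have "init_ent S {i} f (\<lambda>_. F) \<in> entourages (uinit S I f Y)"
    using i by (intro init_ent_entourage) auto
  then show "\<exists>E\<in>entourages (uinit S I f Y). (x, y) \<notin> E"
    using F by (auto simp: init_ent_def intro: bexI[rotated])
qed

lemma initial_for_uinit:
  assumes f: "\<And>i x. i \<in> I \<Longrightarrow> x \<in> S \<Longrightarrow> f i x \<in> points (Y i)"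
  shows "initial_for (uinit S I f Y) I f Y"
  unfolding initial_for_def
proof (intro conjI ballI)
  fix i assume i: "i \<in> I"
  show "ucont (uinit S I f Y) (Y i) (f i)"
  proof (rule ucontI)
    fix F assume "F \<in> entourages (Y i)"
    then have "init_ent S {i} f (\<lambda>_. F) \<in> entourages (uinit S I f Y)"
      using i by (intro init_ent_entourage) auto
    then show "\<exists>E\<in>entourages (uinit S I f Y). \<forall>x y. (x, y) \<in> E \<longrightarrow> (f i x, f i y) \<in> F"
      by (rule bexI[rotated]) (auto simp: init_ent_def)
  qed (use f i in auto)
qed (auto simp: entourages_uinit)

lemma ucont_initial:
  assumes X: "initial_for X I f Y" and Z: "is_uspace Z" and g: "\<And>z. z \<in> points Z \<Longrightarrow> g z \<in> points X"
    and fg: "\<And>i. i \<in> I \<Longrightarrow> ucont Z (Y i) (\<lambda>z. f i (g z))"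
  shows "ucont Z X g"
proof (rule ucontI)
  fix E assume "E \<in> entourages X"
  then obtain J F where J: "finite J" "J \<subseteq> I" "\<And>i. i \<in> J \<Longrightarrow> F i \<in> entourages (Y i)"
    "init_ent (points X) J f F \<subseteq> E"
    using X[unfolded initial_for_def, THEN conjunct2, rule_format, OF \<open>E \<in> entourages X\<close>] by blast
  have "{(x, y). x \<in> points Z \<and> y \<in> points Z \<and> (f i (g x), f i (g y)) \<in> F i} \<in> entourages Z"
    if "i \<in> J" for i
  proof (rule ent_vimage[OF Z])
    show "ucont Z (Y i) (\<lambda>x. f i (g x))"
      using fg that J(2) by blast
  qed (rule J(3)[OF that])
  then have "\<exists>D\<in>entourages Z. \<forall>i\<in>J. D \<subseteq> {(x, y). x \<in> points Z \<and> y \<in> points Z \<and> (f i (g x), f i (g y)) \<in> F i}"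
    using ent_INT[OF Z J(1),
        of "\<lambda>i. {(x, y). x \<in> points Z \<and> y \<in> points Z \<and> (f i (g x), f i (g y)) \<in> F i}"] by blast
  then obtain D where D: "D \<in> entourages Z"
    "\<And>i. i \<in> J \<Longrightarrow> D \<subseteq> {(x, y). x \<in> points Z \<and> y \<in> points Z \<and> (f i (g x), f i (g y)) \<in> F i}"
    by blast
  have "(g x, g y) \<in> E" if xy: "(x, y) \<in> D" for x y
  proof -
    have "(f i (g x), f i (g y)) \<in> F i" if "i \<in> J" for i
      using D(2)[OF that] xy by blast
    then have "(g x, g y) \<in> init_ent (points X) J f F"
      using g ent_sub[OF Z D(1)] xy by (auto simp: init_ent_def)
    then show ?thesis
      using J(4) by blast
  qed
  then show "\<exists>D\<in>entourages Z. \<forall>x y. (x, y) \<in> D \<longrightarrow> (g x, g y) \<in> E"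
    using D(1) by blast
qed (rule g)

lemma initial_for_ucont: "initial_for X I f Y \<Longrightarrow> i \<in> I \<Longrightarrow> ucont X (Y i) (f i)"
  by (simp add: initial_for_def)

lemma t2space_uproduct: "(\<And>i. i \<in> I \<Longrightarrow> t2space (Y i)) \<Longrightarrow> t2space (uproduct I Y)"
  unfolding uproduct_def by (rule t2space_uinit) (simp, fastforce, rule PiE_ext)

lemma is_uspace_uproduct: "(\<And>i. i \<in> I \<Longrightarrow> is_uspace (Y i)) \<Longrightarrow> is_uspace (uproduct I Y)"
  unfolding uproduct_def by (rule is_uspace_uinit) auto

lemma initial_for_uproduct: "initial_for (uproduct I Y) I (\<lambda>i x. x i) Y"
  unfolding uproduct_def by (rule initial_for_uinit) auto

lemma ucont_proj: "i \<in> I \<Longrightarrow> ucont (uproduct I Y) (Y i) (\<lambda>x. x i)"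
  using initial_for_uproduct initial_for_ucont by fastforce

lemma ucont_into_uproduct:
  assumes "is_uspace Z" "\<And>i. i \<in> I \<Longrightarrow> ucont Z (Y i) (\<lambda>z. g z i)"
    "\<And>z. z \<in> points Z \<Longrightarrow> g z \<in> extensional I"
  shows "ucont Z (uproduct I Y) g"
  using assms by (intro ucont_initial[OF initial_for_uproduct]) (auto simp: PiE_def dest: ucontD)

lemma is_uspace_usub:
  assumes X: "is_uspace X" and S: "S \<subseteq> points X"
  shows "is_uspace (usub X S)"
  unfolding is_uspace_def
proof (intro conjI ballI)
  show "points (usub X S) \<times> points (usub X S) \<in> entourages (usub X S)"
    using ent_top[OF X] S by (auto simp: usub_def image_iff intro!: bexI[of _ "points X \<times> points X"])
next
  fix E F assume "E \<in> entourages (usub X S)" "F \<in> entourages (usub X S)"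
  then obtain D D' where D: "D \<in> entourages X" "D' \<in> entourages X" "E = D \<inter> S \<times> S" "F = D' \<inter> S \<times> S"
    by (auto simp: usub_def)
  have "E \<inter> F = (D \<inter> D') \<inter> S \<times> S"
    using D by blast
  then show "E \<inter> F \<in> entourages (usub X S)"
    using ent_Int[OF X D(1,2)] by (auto simp: usub_def)
next
  fix E assume "E \<in> entourages (usub X S)"
  then obtain D where D: "D \<in> entourages X" "E = D \<inter> S \<times> S"
    by (auto simp: usub_def)
  show "Id_on (points (usub X S)) \<subseteq> E" "E \<subseteq> points (usub X S) \<times> points (usub X S)"
    using D S ent_refl[OF X] by auto
  show "\<forall>F. E \<subseteq> F \<and> F \<subseteq> points (usub X S) \<times> points (usub X S) \<longrightarrow> F \<in> entourages (usub X S)"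
  proof safe
    fix F assume F: "E \<subseteq> F" "F \<subseteq> points (usub X S) \<times> points (usub X S)"
    \<comment> \<open>A superset F of the trace of D is itself a trace, namely of D enlarged by F;
      the superset axiom is thus applied in X.\<close>
    have "D \<union> F \<in> entourages X"
      using F S ent_sub[OF X D(1)] by (intro ent_mono[OF X D(1)]) auto
    moreover have "F = (D \<union> F) \<inter> S \<times> S"
      using D F by auto
    ultimately show "F \<in> entourages (usub X S)"
      by (auto simp: usub_def)
  qed
  have "E\<inverse> = D\<inverse> \<inter> S \<times> S"
    using D by auto
  then show "E\<inverse> \<in> entourages (usub X S)"
    using ent_converse[OF X D(1)] by (auto simp: usub_def)
  obtain G where "G \<in> entourages X" "G O G \<subseteq> D"
    using ent_half[OF X D(1)] by blast
  then show "\<exists>D\<in>entourages (usub X S). D O D \<subseteq> E"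
    using D by (intro bexI[of _ "G \<inter> S \<times> S"]) (auto simp: usub_def)
qed

lemma entourages_usub: "E \<in> entourages (usub X S) \<longleftrightarrow> (\<exists>D\<in>entourages X. E = D \<inter> S \<times> S)"
  by (auto simp: usub_def)

lemma t2space_usub:
  assumes "t2space X" "S \<subseteq> points X"
  shows "t2space (usub X S)"
  unfolding t2space_def
proof (intro conjI ballI impI)
  show "is_uspace (usub X S)"
    using assms by (simp add: t2space_uspace is_uspace_usub)
  fix x y assume "x \<in> points (usub X S)" "y \<in> points (usub X S)" "x \<noteq> y"
  then have "x \<in> points X" "y \<in> points X" "x \<noteq> y"
    using assms(2) by auto
  then obtain E where "E \<in> entourages X" "(x, y) \<notin> E"
    using t2spaceD[OF assms(1)] by metis
  then show "\<exists>E\<in>entourages (usub X S). (x, y) \<notin> E"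
    by (intro bexI[of _ "E \<inter> S \<times> S"]) (auto simp: entourages_usub)
qed

lemma ucont_usub_incl: "S \<subseteq> points X \<Longrightarrow> ucont (usub X S) X (\<lambda>x. x)"
proof (rule ucontI)
  fix F assume "F \<in> entourages X"
  then show "\<exists>E\<in>entourages (usub X S). \<forall>x y. (x, y) \<in> E \<longrightarrow> (x, y) \<in> F"
    by (intro bexI[of _ "F \<inter> S \<times> S"]) (auto simp: entourages_usub)
qed auto

lemma ucont_usub_restrict: "ucont X Y f \<Longrightarrow> S \<subseteq> points X \<Longrightarrow> ucont (usub X S) Y f"
  using ucont_comp[OF ucont_usub_incl, of S X Y f] by simp

lemma ucont_into_usub:
  assumes "is_uspace X" "ucont X Y f" "f ` points X \<subseteq> S"
  shows "ucont X (usub Y S) f"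
proof (rule ucontI)
  fix F assume "F \<in> entourages (usub Y S)"
  then obtain D where D: "D \<in> entourages Y" "F = D \<inter> S \<times> S"
    by (auto simp: entourages_usub)
  then show "\<exists>E\<in>entourages X. \<forall>x y. (x, y) \<in> E \<longrightarrow> (f x, f y) \<in> F"
    using ent_vimage[OF assms(1,2) D(1)] assms(3) by (intro bexI) auto
qed (use assms in auto)

text \<open>The two topologies are compared through their closure operators, which entourages
  describe directly; open sets of the subspace would have to be extended to X.\<close>

lemma utopology_usub:
  assumes X: "is_uspace X" and S: "S \<subseteq> points X"
  shows "utopology (usub X S) = subtopology (utopology X) S"
proof -
  have "utopology (usub X S) closure_of T = subtopology (utopology X) S closure_of T" for T
  proof -
    have *: "(\<forall>E\<in>entourages (usub X S). \<exists>s\<in>T. (x, s) \<in> E) \<longleftrightarrow>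
        (\<forall>E\<in>entourages X. \<exists>s\<in>S \<inter> T. (x, s) \<in> E)" if "x \<in> S" for x
      using that unfolding usub_def by simp blast
    have "x \<in> utopology (usub X S) closure_of T \<longleftrightarrow> x \<in> S \<inter> utopology X closure_of (S \<inter> T)" for x
      using * S in_utopology_closure_of[OF X, of x "S \<inter> T"]
        in_utopology_closure_of[OF is_uspace_usub[OF X S], of x T] by auto
    then show ?thesis
      by (auto simp: closure_of_subtopology)
  qed
  then have "closedin (utopology (usub X S)) T \<longleftrightarrow> closedin (subtopology (utopology X) S) T" for T
    using closure_of_subset_eq[of T "utopology (usub X S)"] closure_of_subset_eq[of T "subtopology (utopology X) S"]
    by (simp add: topspace_utopology[OF is_uspace_usub[OF X S]] topspace_utopology[OF X] S inf.absorb2)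
  moreover have "topspace (utopology (usub X S)) = topspace (subtopology (utopology X) S)"
    using S by (auto simp: topspace_utopology[OF is_uspace_usub[OF X S]] topspace_utopology[OF X])
  ultimately show ?thesis
    by (metis topology_eq openin_closedin_eq)
qed

lemma t2space_udisc: "t2space (udisc A)"
  unfolding t2space_def is_uspace_def udisc_def
  by (auto simp: Id_on_def intro!: bexI[of _ "Id_on A"])

lemma is_uspace_udisc: "is_uspace (udisc A)"
  using t2space_udisc t2space_uspace by blast

lemma Id_on_entourage: "Id_on A \<in> entourages (udisc A)"
  by (auto simp: udisc_def)

lemma ucont_udisc: "is_uspace Y \<Longrightarrow> f ` A \<subseteq> points Y \<Longrightarrow> ucont (udisc A) Y f"
  by (rule ucontI) (auto intro!: bexI[OF _ Id_on_entourage] ent_refl)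

subsection \<open>Isomorphic copies\<close>

lemma uiso_ucopy:
  assumes X: "is_uspace X" and j: "inj_on j (points X)"
  shows "uiso X (ucopy j X) j (inv_into (points X) j)"
  unfolding uiso_def
proof (intro conjI ballI)
  show "ucont X (ucopy j X) j"
    by (rule ucontI) (auto simp: ucopy_def)
  show "ucont (ucopy j X) X (inv_into (points X) j)"
  proof (rule ucontI)
    fix F assume F: "F \<in> entourages X"
    show "\<exists>E\<in>entourages (ucopy j X). \<forall>x y. (x, y) \<in> E \<longrightarrow>
        (inv_into (points X) j x, inv_into (points X) j y) \<in> F"
    proof (rule bexI)
      show "map_prod j j ` F \<in> entourages (ucopy j X)"
        using F by (simp add: ucopy_def)
      show "\<forall>x y. (x, y) \<in> map_prod j j ` F \<longrightarrow> (inv_into (points X) j x, inv_into (points X) j y) \<in> F"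
        using j ent_sub[OF X F] by (auto simp: inv_into_f_f subset_eq)
    qed
  qed (auto simp: inv_into_into)
qed (use j in \<open>auto simp: f_inv_into_f\<close>)

text \<open>The transported entourages are exactly those of the initial uniformity along the inverse
  of \<open>j\<close>, so the axioms come from \<open>is_uspace_uinit\<close>.\<close>

lemma is_uspace_ucopy:
  assumes X: "is_uspace X" and j: "inj_on j (points X)"
  shows "is_uspace (ucopy j X)"
proof -
  let ?k = "inv_into (points X) j"
  have "entourages (ucopy j X) = entourages (uinit (j ` points X) {()} (\<lambda>_. ?k) (\<lambda>_. X))" (is "_ = entourages ?Z")
  proof (intro subset_antisym subsetI)
    fix E assume "E \<in> entourages (ucopy j X)"
    then obtain D where D: "D \<in> entourages X" "E = map_prod j j ` D"
      by (auto simp: ucopy_def)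
    have "init_ent (j ` points X) {()} (\<lambda>_. ?k) (\<lambda>_. D) \<subseteq> E"
      using j unfolding D(2) by (force simp: init_ent_def inv_into_f_f)
    moreover have "E \<subseteq> j ` points X \<times> j ` points X"
      using ent_sub[OF X D(1)] D(2) by auto
    ultimately show "E \<in> entourages ?Z"
      unfolding entourages_uinit using D(1) by (intro conjI exI[of _ "{()}"] exI[of _ "\<lambda>_. D"]) auto
  next
    fix E assume E: "E \<in> entourages ?Z"
    then obtain J :: "unit set" and F where J: "\<forall>i\<in>J. F i \<in> entourages X"
      "init_ent (j ` points X) J (\<lambda>_. ?k) F \<subseteq> E" "E \<subseteq> j ` points X \<times> j ` points X"
      unfolding entourages_uinit by blast
    define D where "D = {(x, y). x \<in> points X \<and> y \<in> points X \<and> (j x, j y) \<in> E}"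
    \<comment> \<open>A set of units is empty or a singleton; in the empty case there is no
      constraint, and the full square stands in for the missing entourage.\<close>
    define G where "G = (if J = {} then points X \<times> points X else F ())"
    have GX: "G \<in> entourages X"
      using J ent_top[OF X] by (auto simp: G_def)
    moreover have "G \<subseteq> D"
      unfolding D_def
    proof clarsimp
      fix x y assume xy: "(x, y) \<in> G"
      have X': "x \<in> points X" "y \<in> points X"
        using ent_sub[OF X GX] xy by auto
      have "(j x, j y) \<in> init_ent (j ` points X) J (\<lambda>_. ?k) F"
        using xy X' j by (auto simp: G_def init_ent_def inv_into_f_f split: if_splits)
      then show "x \<in> points X \<and> y \<in> points X \<and> (j x, j y) \<in> E"
        using J(2) X' by blast
    qed
    ultimately have "D \<in> entourages X"
      using ent_mono[OF X, of G D] by (auto simp: D_def)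
    moreover have "E = map_prod j j ` D"
      using J(3) by (force simp: D_def)
    ultimately show "E \<in> entourages (ucopy j X)"
      by (auto simp: ucopy_def)
  qed
  then have "ucopy j X = ?Z"
    by (simp add: ucopy_def uinit_def ugen_def)
  then show ?thesis
    using X by (auto intro!: is_uspace_uinit inv_into_into)
qed

lemma uiso_sym: "uiso X Y j k \<Longrightarrow> uiso Y X k j"
  by (auto simp: uiso_def)

lemma uiso_ucont: "uiso X Y j k \<Longrightarrow> ucont X Y j"
  and uiso_ucont': "uiso X Y j k \<Longrightarrow> ucont Y X k"
  and uiso_left: "uiso X Y j k \<Longrightarrow> x \<in> points X \<Longrightarrow> k (j x) = x"
  and uiso_right: "uiso X Y j k \<Longrightarrow> y \<in> points Y \<Longrightarrow> j (k y) = y"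
  by (simp_all add: uiso_def)

lemma uiso_trans:
  assumes jk: "uiso X Y j k" and jk': "uiso Y Z j' k'"
  shows "uiso X Z (\<lambda>x. j' (j x)) (\<lambda>z. k (k' z))"
  unfolding uiso_def
proof (intro conjI ballI)
  show "ucont X Z (\<lambda>x. j' (j x))" "ucont Z X (\<lambda>z. k (k' z))"
    using ucont_comp uiso_ucont[OF jk] uiso_ucont[OF jk'] uiso_ucont'[OF jk] uiso_ucont'[OF jk'] by blast+
  show "k (k' (j' (j x))) = x" if "x \<in> points X" for x
    using that ucontD[OF uiso_ucont[OF jk]] by (simp add: uiso_left[OF jk] uiso_left[OF jk'])
  show "j' (j (k (k' z))) = z" if "z \<in> points Z" for z
    using that ucontD[OF uiso_ucont'[OF jk']] by (simp add: uiso_right[OF jk] uiso_right[OF jk'])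
qed

lemma uiso_refl: "uiso X X (\<lambda>x. x) (\<lambda>x. x)"
  by (simp add: uiso_def ucont_id)

lemma uiso_inj_on: "uiso X Y j k \<Longrightarrow> inj_on j (points X)"
  by (rule inj_on_inverseI[of _ k]) (rule uiso_left)

lemma uiso_image:
  assumes "uiso X Y j k"
  shows "j ` points X = points Y"
proof (intro subset_antisym subsetI)
  fix y assume "y \<in> points Y"
  then have "y = j (k y)" "k y \<in> points X"
    using uiso_right[OF assms] ucontD[OF uiso_ucont'[OF assms]] by simp_all
  then show "y \<in> j ` points X"
    by (rule image_eqI)
qed (use ucontD[OF uiso_ucont[OF assms]] in auto)

lemma uiso_t2space:
  assumes jk: "uiso X Y j k" and X: "t2space X" and Y: "is_uspace Y"
  shows "t2space Y"
  unfolding t2space_def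
proof (intro conjI ballI impI)
  fix x y assume xy: "x \<in> points Y" "y \<in> points Y" "x \<noteq> y"
  have "k x \<noteq> k y"
    using xy uiso_right[OF jk] by metis
  then obtain E where E: "E \<in> entourages X" "(k x, k y) \<notin> E"
    using t2spaceD[OF X] xy ucontD[OF uiso_ucont'[OF jk]] by metis
  then show "\<exists>E\<in>entourages Y. (x, y) \<notin> E"
    using ucont_entD[OF uiso_ucont'[OF jk] E(1)] by blast
qed (rule Y)

lemma t2space_ucopy: "t2space X \<Longrightarrow> inj_on j (points X) \<Longrightarrow> t2space (ucopy j X)"
  by (rule uiso_t2space[OF uiso_ucopy _ is_uspace_ucopy]) (simp_all add: t2space_uspace)


section \<open>Small sets\<close>

lemma finite_ordLess_Cinfinite: "Cinfinite r \<Longrightarrow> finite A \<Longrightarrow> |A| <o r"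
  by (rule Cfinite_ordLess_Cinfinite) (simp_all add: cfinite_def Field_card_of card_of_card_order_on)

lemma Times_ordLess_Cinfinite:
  assumes r: "Cinfinite r" and A: "|A| <o r" and B: "|B| <o r"
  shows "|A \<times> B| <o r"
proof (cases "finite (A \<times> B)")
  case False
  then have ne: "A \<noteq> {}" "B \<noteq> {}"
    by auto
  have "|A \<times> B| =o |A|" if "|B| \<le>o |A|"
  proof (rule card_of_Times_infinite_simps(1)[OF _ ne(2) that])
    show "infinite A"
      using False card_of_ordLeq_finite[OF that] finite_cartesian_product by blast
  qed
  moreover have "|A \<times> B| =o |B|" if "|A| \<le>o |B|"
  proof (rule card_of_Times_infinite_simps(3)[OF _ ne(1) that])
    show "infinite B"
      using False card_of_ordLeq_finite[OF that] finite_cartesian_product by blast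
  qed
  ultimately have "|A \<times> B| =o |A| \<or> |A \<times> B| =o |B|"
    using ordLeq_total[OF card_of_Well_order[of A] card_of_Well_order[of B]] by blast
  then show ?thesis
    using ordIso_ordLess_trans[OF _ A] ordIso_ordLess_trans[OF _ B] by (rule disjE)
qed (rule finite_ordLess_Cinfinite[OF r])

text \<open>\<open>U\<close> is a term so that abbreviations can refer to the universe.\<close>

locale inaccessible =
  fixes U :: "'u set"
  assumes U: "U = UNIV" and inaccessible: "strongly_inaccessible |U|"
begin

text \<open>Smallness for sets of any type, measured against the universe: sets of entourages, of
  functions and of pairs are not sets of elements of \<open>'u\<close>, yet have to be shown
  small.\<close>

abbreviation sm :: "'a set \<Rightarrow> bool" where
  "sm A \<equiv> |A| <o |U|"

lemma small_sm: "small (A :: 'u set) \<longleftrightarrow> sm A"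
  by (simp add: small_def U)

lemma sm_ordLeq: "sm B \<Longrightarrow> |A| \<le>o |B| \<Longrightarrow> sm A"
  by (rule ordLeq_ordLess_trans)

lemma sm_subset: "sm B \<Longrightarrow> A \<subseteq> B \<Longrightarrow> sm A"
  using sm_ordLeq card_of_mono1 by blast

lemma sm_image: "sm A \<Longrightarrow> sm (f ` A)"
  using sm_ordLeq card_of_image by blast

lemma sm_inj_on: "sm B \<Longrightarrow> inj_on f A \<Longrightarrow> f ` A \<subseteq> B \<Longrightarrow> sm A"
  by (rule sm_ordLeq[of B A]) (auto simp: card_of_ordLeq[symmetric])

lemma natLeq_less: "natLeq <o |U|"
  using inaccessible by (simp add: strongly_inaccessible_def)

lemma infinite_univ: "infinite U"
proof -
  have "natLeq \<le>o |U|"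
    by (rule ordLess_imp_ordLeq[OF natLeq_less])
  then show ?thesis
    using infinite_iff_natLeq_ordLeq by blast
qed

lemma Cinfinite_univ: "Cinfinite |U|"
  using infinite_univ by (simp add: cinfinite_def Field_card_of card_of_card_order_on)

lemma sm_finite: "finite A \<Longrightarrow> sm A"
  by (rule finite_ordLess_Cinfinite[OF Cinfinite_univ])

lemma sm_ex_inj: "sm A \<Longrightarrow> \<exists>j :: 'a \<Rightarrow> 'u. inj_on j A"
  using card_of_ordLeq[of A U] ordLess_imp_ordLeq by auto

text \<open>The strong limit property is only assumed for subsets of \<open>'u\<close>, so the set
  is first copied there.\<close>

lemma sm_Pow:
  assumes "sm A"
  shows "sm (Pow A)"
proof -
  obtain j :: "'a \<Rightarrow> 'u" where j: "inj_on j A"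
    using sm_ex_inj[OF assms] by blast
  have "sm (Pow (j ` A))"
    using inaccessible[unfolded strongly_inaccessible_def, THEN conjunct2, THEN conjunct2, THEN conjunct2,
        rule_format, of "j ` A"] sm_image[OF assms, of j] by (simp add: U Field_card_of)
  then show ?thesis
    using inj_on_image_Pow[OF j] by (rule sm_inj_on) auto
qed

lemma sm_Times: "sm A \<Longrightarrow> sm B \<Longrightarrow> sm (A \<times> B)"
  by (rule Times_ordLess_Cinfinite[OF Cinfinite_univ])

lemma sm_Un: "sm A \<Longrightarrow> sm B \<Longrightarrow> sm (A \<union> B)"
  by (rule card_of_Un_ordLess_infinite[OF infinite_univ])

lemma sm_UN:
  assumes "sm I" "\<And>i. i \<in> I \<Longrightarrow> sm (A i)"
  shows "sm (\<Union>i\<in>I. A i)"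
proof -
  have "regularCard |U|"
    using inaccessible by (simp add: strongly_inaccessible_def)
  then show ?thesis
    using regularCard_UNION_bound[OF Cinfinite_univ _ assms(1)] assms(2) by blast
qed

text \<open>A function is determined by its graph, a subset of the index set times the union of the
  factors. The union is small by regularity, and the power set of the product by the strong limit
  property.\<close>

lemma sm_PiE:
  assumes "sm I" "\<And>i. i \<in> I \<Longrightarrow> sm (A i)"
  shows "sm (PiE I A)"
proof -
  let ?g = "\<lambda>x. (\<lambda>i. (i, x i)) ` I"
  have "sm (Pow (I \<times> (\<Union>i\<in>I. A i)))"
    using assms sm_UN by (intro sm_Pow sm_Times) auto
  moreover have "inj_on ?g (PiE I A)"
  proof (rule inj_onI)
    fix x y assume xy: "x \<in> PiE I A" "y \<in> PiE I A" "?g x = ?g y"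
    show "x = y"
    proof (rule PiE_ext[OF xy(1,2)])
      fix i assume "i \<in> I"
      then have "(i, x i) \<in> ?g y"
        unfolding xy(3)[symmetric] by (rule imageI)
      then show "x i = y i"
        by auto
    qed
  qed
  moreover have "?g ` PiE I A \<subseteq> Pow (I \<times> (\<Union>i\<in>I. A i))"
    by (auto dest: PiE_mem)
  ultimately show ?thesis
    by (rule sm_inj_on)
qed

lemma sm_nat: "sm (UNIV :: nat set)"
  using ordIso_ordLess_trans[OF card_of_nat natLeq_less] .

lemma sm_entourages:
  assumes X: "is_uspace X" and "sm (points X)"
  shows "sm (entourages X)"
proof -
  have "entourages X \<subseteq> Pow (points X \<times> points X)"
    using ent_sub[OF X] by blast
  then show ?thesis
    using assms(2) by (elim sm_subset[rotated]) (intro sm_Pow sm_Times)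
qed

lemma T2Unif_sm: "X \<in> T2Unif \<longleftrightarrow> t2space X \<and> sm (points X)" for X :: "'u uspace"
  by (simp add: T2Unif_iff small_sm)

text \<open>Transport along an injection into \<open>'u\<close>. This is what permits auxiliary
  spaces on arbitrary types, since the categorical notions only quantify over spaces on
  \<open>'u\<close>.\<close>

lemma ex_copy:
  assumes X: "t2space X" and sm: "sm (points X)"
  shows "\<exists>(Y :: 'u uspace) j k. Y \<in> T2Unif \<and> uiso X Y j k"
proof -
  obtain j :: "'a \<Rightarrow> 'u" where j: "inj_on j (points X)"
    using sm_ex_inj[OF sm] by blast
  have "ucopy j X \<in> T2Unif"
    unfolding T2Unif_sm using t2space_ucopy[OF X j] sm_image[OF sm] by simp
  then show ?thesis
    using uiso_ucopy[OF t2space_uspace[OF X] j] by blast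
qed

end


section \<open>Morphisms\<close>

lemma ucont_cong:
  assumes X: "is_uspace X" and f: "ucont X Y f" and eq: "\<And>x. x \<in> points X \<Longrightarrow> f x = g x"
  shows "ucont X Y g"
proof (rule ucontI)
  show "g x \<in> points Y" if "x \<in> points X" for x
    using ucontD[OF f that] eq[OF that] by simp
  fix F assume "F \<in> entourages Y"
  then obtain E where E: "E \<in> entourages X" "\<forall>x y. (x, y) \<in> E \<longrightarrow> (f x, f y) \<in> F"
    using ucont_entD[OF f] by blast
  have "(g x, g y) \<in> F" if "(x, y) \<in> E" for x y
    using E(2) that ent_sub[OF X E(1)] eq by (metis mem_Sigma_iff subsetD)
  then show "\<exists>E\<in>entourages X. \<forall>x y. (x, y) \<in> E \<longrightarrow> (g x, g y) \<in> F"
    using E(1) by blast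
qed

lemma restrict_hom: "is_uspace X \<Longrightarrow> ucont X Y f \<Longrightarrow> restrict f (points X) \<in> hom X Y"
  unfolding hom_iff by (auto elim: ucont_cong)

lemma hom_eqI:
  "f \<in> hom X Y \<Longrightarrow> g \<in> hom X Y \<Longrightarrow> (\<And>x. x \<in> points X \<Longrightarrow> f x = g x) \<Longrightarrow> f = g"
  unfolding hom_iff by (auto intro: extensionalityI)

lemma hom_point: "f \<in> hom X Y \<Longrightarrow> x \<in> points X \<Longrightarrow> f x \<in> points Y"
  by (rule ucontD[OF hom_ucont])

lemma compose_eq_iff: "compose A g f = compose A g' f' \<longleftrightarrow> (\<forall>x\<in>A. g (f x) = g' (f' x))"
proof
  assume eq: "compose A g f = compose A g' f'"
  show "\<forall>x\<in>A. g (f x) = g' (f' x)"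
  proof
    fix x assume "x \<in> A"
    then show "g (f x) = g' (f' x)"
      using fun_cong[OF eq, of x] by (simp add: compose_def)
  qed
next
  assume "\<forall>x\<in>A. g (f x) = g' (f' x)"
  then show "compose A g f = compose A g' f'"
    by (auto simp: compose_def restrict_def)
qed

lemma compose_eq_restrict: "f \<in> extensional A \<Longrightarrow> compose A g h = f \<longleftrightarrow> (\<forall>x\<in>A. g (h x) = f x)"
proof
  assume "f \<in> extensional A" "\<forall>x\<in>A. g (h x) = f x"
  then show "compose A g h = f"
    by (intro extensionalityI[of _ A]) (auto simp: compose_def)
qed (auto simp: compose_def)

lemma comp_from_hom:
  assumes "is_uspace X" "f \<in> hom X Y" "g \<in> hom Y Z"
  shows "comp_from X g f \<in> hom X Z"
  unfolding compose_def by (rule restrict_hom[OF assms(1) ucont_comp]) (use assms hom_ucont in auto)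

lemma ident_hom: "is_uspace X \<Longrightarrow> ident X \<in> hom X X"
  unfolding ident_def using restrict_hom[of X X id] ucont_id[of X] by (simp add: id_def)

lemma isomorphism_uiso:
  assumes "isomorphism X Y f"
  shows "\<exists>k. uiso X Y f k"
proof -
  obtain g where g: "f \<in> hom X Y" "g \<in> hom Y X" "comp_from X g f = ident X" "comp_from Y f g = ident Y"
    using assms unfolding isomorphism_def by blast
  have "\<forall>x\<in>points X. g (f x) = x" "\<forall>y\<in>points Y. f (g y) = y"
    using g(3,4) by (auto simp: ident_def compose_eq_restrict)
  then show ?thesis
    using g(1,2) by (intro exI[of _ g]) (simp add: uiso_def hom_ucont)
qed

lemma uiso_isomorphism:
  assumes "is_uspace X" "is_uspace Y" "uiso X Y j k"
  shows "isomorphism X Y (restrict j (points X))"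
  unfolding isomorphism_def
proof (intro conjI bexI)
  show "restrict j (points X) \<in> hom X Y" "restrict k (points Y) \<in> hom Y X"
    using assms restrict_hom uiso_ucont uiso_ucont' by blast+
  show "comp_from X (restrict k (points Y)) (restrict j (points X)) = ident X"
    using ucontD[OF uiso_ucont[OF assms(3)]] uiso_left[OF assms(3)] by (auto simp: ident_def compose_eq_restrict)
  show "comp_from Y (restrict j (points X)) (restrict k (points Y)) = ident Y"
    using ucontD[OF uiso_ucont'[OF assms(3)]] uiso_right[OF assms(3)] by (auto simp: ident_def compose_eq_restrict)
qed

lemma closedin_utopologyD:
  assumes "is_uspace X" "closedin (utopology X) S" "x \<in> points X" "x \<notin> S"
  shows "\<exists>E\<in>entourages X. \<forall>s\<in>S. (x, s) \<notin> E"
  using assms(2)[unfolded closedin_utopology[OF assms(1)], THEN conjunct2, rule_format, OF assms(3)] assms(4)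
  by blast

section \<open>Density, epimorphisms and monomorphisms\<close>

definition dense_in :: "'a uspace \<Rightarrow> 'a set \<Rightarrow> bool" where
  "dense_in Y S \<longleftrightarrow> (\<forall>y\<in>points Y. \<forall>E\<in>entourages Y. \<exists>s\<in>S. (y, s) \<in> E)"

lemma dense_in_closure_of:
  "is_uspace Y \<Longrightarrow> dense_in Y S \<longleftrightarrow> points Y \<subseteq> utopology Y closure_of S"
  unfolding dense_in_def by (auto simp: in_utopology_closure_of)

lemma surj_dense_in: "is_uspace Y \<Longrightarrow> points Y \<subseteq> S \<Longrightarrow> dense_in Y S"
  unfolding dense_in_def by (intro ballI, rule bexI, erule (2) ent_refl) auto

lemma dense_epimorphism:
  assumes Y: "Y \<in> T2Unif" and e: "e \<in> hom X Y" and dense: "dense_in Y (e ` points X)"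
  shows "epimorphism X Y e"
  unfolding epimorphism_def
proof (intro conjI ballI impI e)
  fix Z g h assume Z: "Z \<in> T2Unif" and gh: "g \<in> hom Y Z" "h \<in> hom Y Z"
    and eq: "comp_from X g e = comp_from X h e"
  show "g = h"
  proof (rule hom_eqI[OF gh])
    fix y assume "y \<in> points Y"
    then have "y \<in> utopology Y closure_of e ` points X"
      using dense dense_in_closure_of[OF T2Unif_uspace[OF Y]] by blast
    moreover have "g s = h s" if "s \<in> e ` points X" for s
      using eq that by (auto simp: compose_eq_iff)
    ultimately show "g y = h y"
      by (rule ucont_eq_on_dense[OF T2Unif_uspace[OF Y] T2Unif_t2space[OF Z] gh[THEN hom_ucont], rotated])
  qed
qed

lemma epimorphism_hom: "epimorphism X Y e \<Longrightarrow> e \<in> hom X Y"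
  by (simp add: epimorphism_def)

text \<open>Two copies of \<open>Y\<close> glued along \<open>A\<close>: a closed subspace is the equalizer of the two inclusions.\<close>

definition glue_ent :: "'a set \<Rightarrow> ('a \<times> 'a) set \<Rightarrow> 'a \<times> bool \<Rightarrow> 'a \<times> bool \<Rightarrow> bool" where
  "glue_ent A E p q \<longleftrightarrow> (if snd p = snd q then (fst p, fst q) \<in> E
     else \<exists>a\<in>A. (fst p, a) \<in> E \<and> (a, fst q) \<in> E)"

definition glue :: "'a uspace \<Rightarrow> 'a set \<Rightarrow> ('a \<times> bool) uspace" where
  "glue Y A = (let S = {p. fst p \<in> points Y \<and> (snd p \<longrightarrow> fst p \<notin> A)} in
     ugen S {{(p, q). p \<in> S \<and> q \<in> S \<and> glue_ent A E p q} | E. E \<in> entourages Y})"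

lemma glue_ent_mono: "glue_ent A E p q \<Longrightarrow> E \<subseteq> F \<Longrightarrow> glue_ent A F p q"
  unfolding glue_ent_def by (auto split: if_splits)

text \<open>A passage from one copy to the other goes through a point of A. The worst case is two
  passages: p and r then lie in the same copy, and the path p, a, q, b, r has four D-steps, which is
  where the fourfold composite comes from.\<close>

lemma glue_ent_trans:
  assumes pq: "glue_ent A D p q" and qr: "glue_ent A D q r"
    and D: "D \<subseteq> E" "D O D \<subseteq> E" "D O D O D O D \<subseteq> E"
  shows "glue_ent A E p r"
proof (cases "snd p = snd q")
  case True
  then have p: "(fst p, fst q) \<in> D"
    using pq by (simp add: glue_ent_def)
  show ?thesis
  proof (cases "snd q = snd r")
    case True
    then have "(fst q, fst r) \<in> D"
      using qr by (simp add: glue_ent_def)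
    then show ?thesis
      using p True \<open>snd p = snd q\<close> D(2) by (auto simp: glue_ent_def)
  next
    case False
    then obtain a where "a \<in> A" "(fst q, a) \<in> D" "(a, fst r) \<in> D"
      using qr by (auto simp: glue_ent_def)
    then show ?thesis
      using p False \<open>snd p = snd q\<close> D(1,2) by (auto simp: glue_ent_def)
  qed
next
  case False
  then obtain a where a: "a \<in> A" "(fst p, a) \<in> D" "(a, fst q) \<in> D"
    using pq by (auto simp: glue_ent_def)
  show ?thesis
  proof (cases "snd q = snd r")
    case True
    then have "(fst q, fst r) \<in> D"
      using qr by (simp add: glue_ent_def)
    then show ?thesis
      using a True False D(1,2) by (auto simp: glue_ent_def)
  next
    case F: False
    then obtain b where "b \<in> A" "(fst q, b) \<in> D" "(b, fst r) \<in> D"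
      using qr by (auto simp: glue_ent_def)
    moreover have "snd p = snd r"
      using F False by auto
    ultimately show ?thesis
      using a D(3) by (auto simp: glue_ent_def)
  qed
qed

text \<open>Closedness of A makes the glued space Hausdorff: the two copies of a point outside A are
  separated by an entourage that relates this point to no point of A.\<close>

lemma closed_equalizer:
  assumes Y: "t2space Y" and A: "closedin (utopology Y) A"
  shows "\<exists>h0 h1. t2space (glue Y A) \<and> ucont Y (glue Y A) h0 \<and> ucont Y (glue Y A) h1 \<and>
     (\<forall>y\<in>points Y. h0 y = h1 y \<longleftrightarrow> y \<in> A)"
proof -
  have uY: "is_uspace Y"
    by (rule t2space_uspace[OF Y])
  define S where "S = {p. fst p \<in> points Y \<and> (snd p \<longrightarrow> fst p \<notin> A)}"
  define R where "R E = {(p, q). p \<in> S \<and> q \<in> S \<and> glue_ent A E p q}" for E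
  define B where "B = R ` entourages Y"
  have G: "glue Y A = ugen S B"
    unfolding glue_def S_def[symmetric] Let_def B_def R_def by (rule arg_cong[of _ _ "ugen S"]) blast
  have "is_uspace (ugen S B)"
  proof (rule is_uspace_ugen)
    show "B \<noteq> {}"
      using ent_top[OF uY] by (auto simp: B_def)
    fix D assume "D \<in> B"
    then obtain E where E: "E \<in> entourages Y" "D = R E"
      by (auto simp: B_def)
    show "Id_on S \<subseteq> D"
      using ent_refl[OF uY E(1)] by (auto simp: E(2) R_def S_def glue_ent_def)
    show "D \<subseteq> S \<times> S"
      by (auto simp: E(2) R_def)
    have "R (E\<inverse>) \<subseteq> D\<inverse>"
      by (auto simp: E(2) R_def glue_ent_def split: if_splits)
    then show "\<exists>D'\<in>B. D' \<subseteq> D\<inverse>"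
      using ent_converse[OF uY E(1)] by (auto simp: B_def)
    obtain F where F: "F \<in> entourages Y" "F \<subseteq> E" "F O F \<subseteq> E" "F O F O F O F \<subseteq> E"
      using ent_quarter_sym[OF uY E(1)] by blast
    have "R F O R F \<subseteq> D"
      using glue_ent_trans[OF _ _ F(2-4)] by (auto simp: E(2) R_def)
    then show "\<exists>D'\<in>B. D' O D' \<subseteq> D"
      using F(1) by (auto simp: B_def)
    fix D' assume "D' \<in> B"
    then obtain E' where E': "E' \<in> entourages Y" "D' = R E'"
      by (auto simp: B_def)
    have "R (E \<inter> E') \<subseteq> D \<inter> D'"
      unfolding E(2) E'(2) R_def by (auto elim: glue_ent_mono)
    then show "\<exists>D''\<in>B. D'' \<subseteq> D \<inter> D'"
      using ent_Int[OF uY E(1) E'(1)] by (auto simp: B_def)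
  qed
  moreover have "\<exists>D\<in>entourages (ugen S B). (p, q) \<notin> D" if pq: "p \<in> S" "q \<in> S" "p \<noteq> q" for p q
  proof -
    have RE: "R E \<in> entourages (ugen S B)" if "E \<in> entourages Y" for E
      using that by (auto simp: entourages_ugen B_def R_def)
    have "\<exists>E\<in>entourages Y. \<not> glue_ent A E p q"
    proof (cases "fst p = fst q")
      case True
      then have ne: "snd p \<noteq> snd q"
        using pq by (simp add: prod_eq_iff)
      then have "fst p \<notin> A" "fst p \<in> points Y"
        using pq True by (auto simp: S_def)
      then obtain E where E: "E \<in> entourages Y" "\<forall>a\<in>A. (fst p, a) \<notin> E"
        using closedin_utopologyD[OF uY A] by blast
      then show ?thesis
        using ne by (auto simp: glue_ent_def)
    next
      case False
      then obtain E where E: "E \<in> entourages Y" "(fst p, fst q) \<notin> E"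
        using pq t2spaceD[OF Y] unfolding S_def by blast
      then obtain F where "F \<in> entourages Y" "F \<subseteq> E" "F O F \<subseteq> E"
        using ent_half_sym[OF uY E(1)] by blast
      then show ?thesis
        using E(2) by (intro bexI[of _ F]) (auto simp: glue_ent_def)
    qed
    then obtain E where E: "E \<in> entourages Y" "\<not> glue_ent A E p q"
      by blast
    then show ?thesis
      by (intro bexI[OF _ RE[OF E(1)]]) (simp add: R_def)
  qed
  ultimately have t2: "t2space (ugen S B)"
    by (simp add: t2space_def)
  \<comment> \<open>Points of A occur in the glued space only with the tag \<open>False\<close>, so
    \<open>h1\<close> takes this tag on A and agrees with the first inclusion exactly there.\<close>
  define h1 where "h1 y = (y, y \<notin> A)" for y
  have h0: "ucont Y (ugen S B) (\<lambda>y. (y, False))" and h1: "ucont Y (ugen S B) h1"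
  proof -
    have ex: "\<exists>E\<in>entourages Y. R E \<subseteq> F" if "F \<in> entourages (ugen S B)" for F
      using that by (auto simp: entourages_ugen B_def)
    show "ucont Y (ugen S B) (\<lambda>y. (y, False))"
    proof (rule ucontI)
      fix F assume "F \<in> entourages (ugen S B)"
      then obtain E where E: "E \<in> entourages Y" "R E \<subseteq> F"
        using ex by blast
      have "((x, False), (y, False)) \<in> R E" if "(x, y) \<in> E" for x y
        using that ent_sub[OF uY E(1)] by (auto simp: R_def S_def glue_ent_def)
      then show "\<exists>E\<in>entourages Y. \<forall>x y. (x, y) \<in> E \<longrightarrow> ((x, False), (y, False)) \<in> F"
        using E by blast
    qed (auto simp: S_def)
    show "ucont Y (ugen S B) h1"
    proof (rule ucontI)
      fix F assume "F \<in> entourages (ugen S B)"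
      then obtain E where E: "E \<in> entourages Y" "R E \<subseteq> F"
        using ex by blast
      have "(h1 x, h1 y) \<in> R E" if "(x, y) \<in> E" for x y
      proof -
        have "x \<in> points Y" "y \<in> points Y"
          using that ent_sub[OF uY E(1)] by auto
        then show ?thesis
          using that ent_refl[OF uY E(1)] by (auto simp: R_def S_def glue_ent_def h1_def)
      qed
      then show "\<exists>E\<in>entourages Y. \<forall>x y. (x, y) \<in> E \<longrightarrow> (h1 x, h1 y) \<in> F"
        using E by blast
    qed (auto simp: S_def h1_def)
  qed
  show ?thesis
    unfolding G using t2 h0 h1 by (intro exI[of _ "\<lambda>y. (y, False)"] exI[of _ h1]) (auto simp: h1_def)
qed

lemma points_glue: "points (glue Y A) \<subseteq> points Y \<times> UNIV"
  by (auto simp: glue_def Let_def)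

context inaccessible
begin

text \<open>Glue two copies of Y along the closure of the image. The two inclusions agree on the
  image, so an epimorphism makes them equal and the closure is all of Y. The glued space is copied
  into \<open>'u\<close> because epimorphisms are tested only against spaces there.\<close>

lemma epimorphism_dense:
  fixes X Y :: "'u uspace"
  assumes X: "X \<in> T2Unif" and Y: "Y \<in> T2Unif" and e: "epimorphism X Y e"
  shows "dense_in Y (e ` points X)"
proof -
  have uY: "is_uspace Y"
    by (rule T2Unif_uspace[OF Y])
  have eh: "e \<in> hom X Y"
    using e by (simp add: epimorphism_def)
  define A where "A = utopology Y closure_of (e ` points X)"
  have "closedin (utopology Y) A"
    by (simp add: A_def)
  then obtain h0 h1 where h: "t2space (glue Y A)" "ucont Y (glue Y A) h0" "ucont Y (glue Y A) h1"
    "\<forall>y\<in>points Y. h0 y = h1 y \<longleftrightarrow> y \<in> A"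
    using closed_equalizer[OF T2Unif_t2space[OF Y]] by blast
  have "sm (points Y \<times> (UNIV :: bool set))"
    using Y by (intro sm_Times sm_finite[of "UNIV :: bool set"]) (simp_all add: T2Unif_sm)
  then have "sm (points (glue Y A))"
    using points_glue by (rule sm_subset)
  then obtain W :: "'u uspace" and j k where W: "W \<in> T2Unif" "uiso (glue Y A) W j k"
    using ex_copy[OF h(1)] by blast
  let ?g = "restrict (\<lambda>y. j (h0 y)) (points Y)" and ?h = "restrict (\<lambda>y. j (h1 y)) (points Y)"
  have gh: "?g \<in> hom Y W" "?h \<in> hom Y W"
    using ucont_comp[OF h(2) uiso_ucont[OF W(2)]] ucont_comp[OF h(3) uiso_ucont[OF W(2)]] restrict_hom[OF uY]
    by auto
  have "e ` points X \<subseteq> A"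
    unfolding A_def using hom_point[OF eh] topspace_utopology[OF uY] by (intro closure_of_subset) auto
  then have "h0 (e x) = h1 (e x)" if "x \<in> points X" for x
    using hom_point[OF eh that] h(4) that by blast
  then have "comp_from X ?g e = comp_from X ?h e"
    using hom_point[OF eh] by (simp add: compose_eq_iff)
  then have eq: "?g = ?h"
    using e W(1) gh unfolding epimorphism_def by blast
  have "y \<in> A" if y: "y \<in> points Y" for y
  proof -
    have "j (h0 y) = j (h1 y)"
      using fun_cong[OF eq, of y] y by simp
    then have "h0 y = h1 y"
      using inj_onD[OF uiso_inj_on[OF W(2)]] ucontD[OF h(2) y] ucontD[OF h(3) y] by blast
    then show ?thesis
      using h(4) y by blast
  qed
  then show ?thesis
    unfolding dense_in_closure_of[OF uY] A_def by blast
qed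

lemma udisc_T2Unif: "udisc A \<in> T2Unif \<longleftrightarrow> sm A" for A :: "'u set"
  by (simp add: T2Unif_sm t2space_udisc)

lemma monomorphism_iff:
  fixes X Y :: "'u uspace"
  assumes X: "is_uspace X"
  shows "monomorphism X Y m \<longleftrightarrow> m \<in> hom X Y \<and> inj_on m (points X)"
proof (intro iffI conjI)
  assume m: "monomorphism X Y m"
  then show mh: "m \<in> hom X Y"
    by (simp add: monomorphism_def)
  show "inj_on m (points X)"
  proof (rule inj_onI)
    fix x y assume xy: "x \<in> points X" "y \<in> points X" "m x = m y"
    \<comment> \<open>A one-point space is the test object: morphisms from it to X are the points of
      X.\<close>
    have Z: "udisc {x} \<in> T2Unif"
      by (simp add: udisc_T2Unif sm_finite)
    have const: "(\<lambda>z\<in>{x}. p) \<in> hom (udisc {x}) X" if "p \<in> points X" for p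
      using restrict_hom[OF is_uspace_udisc ucont_udisc[OF X, of "\<lambda>_. p" "{x}"]] that by simp
    have "comp_from (udisc {x}) m (\<lambda>z\<in>{x}. x) = comp_from (udisc {x}) m (\<lambda>z\<in>{x}. y)"
      using xy(3) by (simp add: compose_eq_iff)
    then have "(\<lambda>z\<in>{x}. x) = (\<lambda>z\<in>{x}. y)"
      using m Z const[OF xy(1)] const[OF xy(2)] unfolding monomorphism_def by blast
    from fun_cong[OF this, of x] show "x = y"
      by simp
  qed
next
  assume m: "m \<in> hom X Y \<and> inj_on m (points X)"
  show "monomorphism X Y m"
    unfolding monomorphism_def
  proof (intro conjI ballI impI)
    fix Z g h assume Z: "Z \<in> T2Unif" and gh: "g \<in> hom Z X" "h \<in> hom Z X"
      and eq: "comp_from Z m g = comp_from Z m h"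
    show "g = h"
    proof (rule hom_eqI[OF gh])
      fix z assume z: "z \<in> points Z"
      then have "m (g z) = m (h z)"
        using eq by (simp add: compose_eq_iff)
      then show "g z = h z"
        using m inj_onD hom_point[OF gh(1) z] hom_point[OF gh(2) z] by metis
    qed
  qed (use m in simp)
qed

end


section \<open>Extremal morphisms and products\<close>

lemma dense_in_range_closed:
  assumes uZ: "is_uspace Z" and uY: "is_uspace Y" and S: "closedin (utopology Y) S"
    and g: "ucont Z Y g" and D: "dense_in Z D" and gD: "g ` D \<subseteq> S" and z: "z \<in> points Z"
  shows "g z \<in> S"
proof (rule ccontr)
  assume "g z \<notin> S"
  then obtain E where E: "E \<in> entourages Y" "\<forall>s\<in>S. (g z, s) \<notin> E"
    using closedin_utopologyD[OF uY S ucontD[OF g z]] by blast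
  obtain F where F: "F \<in> entourages Z" "\<forall>x y. (x, y) \<in> F \<longrightarrow> (g x, g y) \<in> E"
    using ucont_entD[OF g E(1)] by blast
  obtain d where "d \<in> D" "(z, d) \<in> F"
    using D F(1) z unfolding dense_in_def by blast
  then show False
    using E(2) F(2) gD by blast
qed

lemma closedin_points: "is_uspace Y \<Longrightarrow> closedin (utopology Y) S \<Longrightarrow> S \<subseteq> points Y"
  using closedin_subset topspace_utopology by blast

text \<open>Upgrades a one-sided inverse to a two-sided one: if g undoes a dense map e, then g
  followed by e fixes the image of e and is therefore the identity.\<close>

lemma ucont_dense_id:
  assumes Z: "t2space Z" and f: "ucont Z Z f" and D: "dense_in Z D"
    and eq: "\<And>d. d \<in> D \<Longrightarrow> f d = d" and z: "z \<in> points Z"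
  shows "f z = z"
proof -
  have uZ: "is_uspace Z"
    by (rule t2space_uspace[OF Z])
  have "z \<in> utopology Z closure_of D"
    using D z unfolding dense_in_closure_of[OF uZ] by blast
  then show ?thesis
    using ucont_eq_on_dense[OF uZ Z f ucont_id, of D z] eq by blast
qed

lemma isomorphism_hom_uiso:
  assumes "is_uspace X" "is_uspace Y" "f \<in> hom X Y" "uiso X Y f k"
  shows "isomorphism X Y f"
proof -
  have "restrict f (points X) = f"
    using assms(3) by (simp add: hom_iff extensional_restrict)
  then show ?thesis
    using uiso_isomorphism[OF assms(1,2,4)] by simp
qed

lemma incl_hom: "is_uspace Y \<Longrightarrow> S \<subseteq> points Y \<Longrightarrow> restrict (\<lambda>x. x) S \<in> hom (usub Y S) Y"
  using restrict_hom[OF is_uspace_usub ucont_usub_incl, of Y S] by simp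

context inaccessible
begin

lemma usub_T2Unif:
  fixes Y :: "'u uspace"
  assumes "Y \<in> T2Unif" "S \<subseteq> points Y"
  shows "usub Y S \<in> T2Unif"
  using assms sm_subset[of "points Y" S] by (simp add: T2Unif_sm t2space_usub)

text \<open>When the inclusion factors as an epimorphism e followed by g, the map g sends the dense
  image of e into S, hence everything into the closed set S. Corestricted to S it is the inverse of
  e.\<close>

lemma usub_extremal_mono:
  fixes Y :: "'u uspace"
  assumes Y: "Y \<in> T2Unif" and S: "closedin (utopology Y) S"
  shows "extremal_mono (usub Y S) Y (restrict (\<lambda>x. x) S)"
  unfolding extremal_mono_def
proof (intro conjI ballI allI impI)
  let ?X = "usub Y S" and ?m = "restrict (\<lambda>x. x) S"
  have uY: "is_uspace Y"
    by (rule T2Unif_uspace[OF Y])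
  have SY: "S \<subseteq> points Y"
    by (rule closedin_points[OF uY S])
  have uX: "is_uspace ?X"
    by (rule is_uspace_usub[OF uY SY])
  have "inj_on ?m (points ?X)"
    by (simp add: inj_on_def)
  then show "monomorphism ?X Y ?m"
    unfolding monomorphism_iff[OF uX] using incl_hom[OF uY SY] by blast
  fix Z e g assume Z: "Z \<in> T2Unif" and eg: "epimorphism ?X Z e \<and> g \<in> hom Z Y \<and> ?m = comp_from ?X g e"
  have e: "e \<in> hom ?X Z" and g: "ucont Z Y g"
    using eg by (auto simp: epimorphism_def intro: hom_ucont)
  have uZ: "is_uspace Z"
    by (rule T2Unif_uspace[OF Z])
  have dense: "dense_in Z (e ` S)"
    using epimorphism_dense[OF usub_T2Unif[OF Y SY] Z] eg by simp
  have ge: "g (e x) = x" if "x \<in> S" for x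
  proof -
    have "?m = comp_from ?X g e"
      using eg by blast
    from fun_cong[OF this, of x] show ?thesis
      using that by (simp add: compose_eq)
  qed
  have "g z \<in> S" if "z \<in> points Z" for z
    by (rule dense_in_range_closed[OF uZ uY S g dense _ that]) (use ge in auto)
  then have g': "ucont Z ?X g"
    by (intro ucont_into_usub[OF uZ g]) auto
  have "uiso ?X Z e g"
    unfolding uiso_def
  proof (intro conjI ballI)
    show "g (e x) = x" if "x \<in> points ?X" for x
      using ge that by simp
    have "e (g d) = d" if "d \<in> e ` S" for d
      using that ge by auto
    then show "e (g z) = z" if "z \<in> points Z" for z
      using ucont_dense_id[OF T2Unif_t2space[OF Z] ucont_comp[OF g' hom_ucont[OF e]] dense _ that] by blast
  qed (use g' hom_ucont[OF e] in auto)
  then show "isomorphism ?X Z e"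
    by (rule isomorphism_hom_uiso[OF uX uZ e])
qed

text \<open>Through the closure of its image, m factors as a dense map followed by an inclusion.
  Dense maps are epimorphisms, so extremality makes the first factor an isomorphism.\<close>

lemma extremal_mono_closed:
  fixes X Y :: "'u uspace"
  assumes X: "X \<in> T2Unif" and Y: "Y \<in> T2Unif" and m: "extremal_mono X Y m"
  shows "\<exists>S k. closedin (utopology Y) S \<and> uiso X (usub Y S) m k"
proof -
  have uX: "is_uspace X" and uY: "is_uspace Y"
    using X Y T2Unif_uspace by blast+
  have mh: "m \<in> hom X Y"
    using m by (simp add: extremal_mono_def monomorphism_def)
  define S where "S = utopology Y closure_of (m ` points X)"
  have S: "closedin (utopology Y) S"
    by (simp add: S_def)
  then have SY: "S \<subseteq> points Y"
    by (rule closedin_points[OF uY])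
  have mS: "m ` points X \<subseteq> S"
    unfolding S_def using hom_point[OF mh] topspace_utopology[OF uY] by (intro closure_of_subset) auto
  let ?Z = "usub Y S"
  have uZ: "is_uspace ?Z"
    by (rule is_uspace_usub[OF uY SY])
  have e: "m \<in> hom X ?Z"
    using ucont_into_usub[OF uX hom_ucont[OF mh] mS] mh by (simp add: hom_iff)
  have "dense_in ?Z (m ` points X)"
    unfolding dense_in_closure_of[OF uZ] utopology_usub[OF uY SY] closure_of_subtopology
    using mS by (simp add: S_def Int_absorb1)
  then have "epimorphism X ?Z m"
    by (rule dense_epimorphism[OF usub_T2Unif[OF Y SY] e])
  moreover have "m = comp_from X (restrict (\<lambda>x. x) S) m"
    using mS mh compose_eq_restrict[of m "points X" "restrict (\<lambda>x. x) S" m] by (auto simp: hom_iff)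
  ultimately have "isomorphism X ?Z m"
    using m[unfolded extremal_mono_def, THEN conjunct2, rule_format, OF usub_T2Unif[OF Y SY]]
      incl_hom[OF uY SY] by blast
  then show ?thesis
    using isomorphism_uiso S by blast
qed

text \<open>The inclusion of the image, with the subspace uniformity, is a monomorphism through
  which e factors; extremality makes it an isomorphism and hence onto.\<close>

lemma extremal_epi_surj:
  fixes X Y :: "'u uspace"
  assumes X: "X \<in> T2Unif" and Y: "Y \<in> T2Unif" and e: "extremal_epi X Y e"
  shows "e ` points X = points Y"
proof -
  have uX: "is_uspace X" and uY: "is_uspace Y"
    using X Y T2Unif_uspace by blast+
  have eh: "e \<in> hom X Y"
    using e by (simp add: extremal_epi_def epimorphism_def)
  define S where "S = e ` points X"
  have SY: "S \<subseteq> points Y"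
    unfolding S_def using hom_point[OF eh] by auto
  let ?Z = "usub Y S" and ?m = "restrict (\<lambda>x. x) S"
  have g: "e \<in> hom X ?Z"
    using ucont_into_usub[OF uX hom_ucont[OF eh]] eh by (simp add: hom_iff S_def)
  have "inj_on ?m (points ?Z)"
    by (simp add: inj_on_def)
  then have "monomorphism ?Z Y ?m"
    unfolding monomorphism_iff[OF is_uspace_usub[OF uY SY]] using incl_hom[OF uY SY] by blast
  moreover have "e = comp_from X ?m e"
    using eh compose_eq_restrict[of e "points X" ?m e] by (auto simp: hom_iff S_def)
  ultimately have "isomorphism ?Z Y ?m"
    using e[unfolded extremal_epi_def, THEN conjunct2, rule_format, OF usub_T2Unif[OF Y SY]] g by blast
  then obtain k where "uiso ?Z Y ?m k"
    using isomorphism_uiso by blast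
  then have "?m ` S = points Y"
    using uiso_image by fastforce
  then show ?thesis
    by (simp add: S_def)
qed

end


text \<open>
  The finest uniformity on the image of a map that keeps the map uniformly continuous: its entourages
  are those that start a sequence of successive halves, all of whose preimages are entourages.
\<close>

definition fine_seq :: "'a uspace \<Rightarrow> ('a \<Rightarrow> 'b) \<Rightarrow> (nat \<Rightarrow> ('b \<times> 'b) set) \<Rightarrow> bool" where
  "fine_seq X q F \<longleftrightarrow> (\<forall>n. F n \<subseteq> q ` points X \<times> q ` points X \<and> Id_on (q ` points X) \<subseteq> F n \<and> sym (F n) \<and>
     F (Suc n) O F (Suc n) \<subseteq> F n \<and>
     {(x, y). x \<in> points X \<and> y \<in> points X \<and> (q x, q y) \<in> F n} \<in> entourages X)"

definition ufine :: "'a uspace \<Rightarrow> ('a \<Rightarrow> 'b) \<Rightarrow> 'b uspace" where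
  "ufine X q = ugen (q ` points X) {F 0 | F. fine_seq X q F}"

lemma points_ufine [simp]: "points (ufine X q) = q ` points X"
  by (simp add: ufine_def)

text \<open>Working with sequences makes the halving axiom immediate: the tail of an admissible
  sequence is admissible, and it starts with a half of the original first entourage. Termwise
  intersection handles finite intersections.\<close>

lemma is_uspace_fine:
  assumes X: "is_uspace X"
  shows "is_uspace (ufine X q)"
  unfolding ufine_def
proof (rule is_uspace_ugen)
  let ?S = "q ` points X" and ?B = "{F 0 | F. fine_seq X q F}"
  have "fine_seq X q (\<lambda>_. ?S \<times> ?S)"
    unfolding fine_seq_def
  proof (intro allI conjI)
    have "{(x, y). x \<in> points X \<and> y \<in> points X \<and> (q x, q y) \<in> ?S \<times> ?S} = points X \<times> points X"
      by auto
    then show "{(x, y). x \<in> points X \<and> y \<in> points X \<and> (q x, q y) \<in> ?S \<times> ?S} \<in> entourages X"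
      using ent_top[OF X] by simp
  qed (auto simp: sym_def)
  then show "?B \<noteq> {}"
    by blast
  fix D assume "D \<in> ?B"
  then obtain F where D: "D = F 0" and F: "fine_seq X q F"
    by blast
  note F' = F[unfolded fine_seq_def, rule_format]
  show "Id_on ?S \<subseteq> D" "D \<subseteq> ?S \<times> ?S"
    unfolding D using F'[of 0] by blast+
  have "D\<inverse> = D"
    unfolding D using F'[of 0] sym_conv_converse_eq by blast
  then show "\<exists>D'\<in>?B. D' \<subseteq> D\<inverse>"
    using \<open>D \<in> ?B\<close> by blast
  have "fine_seq X q (\<lambda>n. F (Suc n))"
    using F unfolding fine_seq_def by blast
  then have "F (Suc 0) \<in> ?B"
    by (intro CollectI exI[of _ "\<lambda>n. F (Suc n)"]) simp
  moreover have "F (Suc 0) O F (Suc 0) \<subseteq> D"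
    unfolding D using F'[of 0] by blast
  ultimately show "\<exists>D'\<in>?B. D' O D' \<subseteq> D"
    by (rule bexI[rotated])
  fix D' assume "D' \<in> ?B"
  then obtain G where D': "D' = G 0" and G: "fine_seq X q G"
    by blast
  note G' = G[unfolded fine_seq_def, rule_format]
  have "fine_seq X q (\<lambda>n. F n \<inter> G n)"
    unfolding fine_seq_def
  proof (intro allI conjI)
    fix n
    show "F n \<inter> G n \<subseteq> ?S \<times> ?S" "Id_on ?S \<subseteq> F n \<inter> G n" "sym (F n \<inter> G n)"
      using F'[of n] G'[of n] by (blast, blast, blast intro: sym_Int)
    have "(F (Suc n) \<inter> G (Suc n)) O (F (Suc n) \<inter> G (Suc n)) \<subseteq> F (Suc n) O F (Suc n)"
      "(F (Suc n) \<inter> G (Suc n)) O (F (Suc n) \<inter> G (Suc n)) \<subseteq> G (Suc n) O G (Suc n)"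
      by auto
    then show "(F (Suc n) \<inter> G (Suc n)) O (F (Suc n) \<inter> G (Suc n)) \<subseteq> F n \<inter> G n"
      using F'[of n] G'[of n] by (meson Int_greatest order_trans)
    have "{(x, y). x \<in> points X \<and> y \<in> points X \<and> (q x, q y) \<in> F n \<inter> G n} =
        {(x, y). x \<in> points X \<and> y \<in> points X \<and> (q x, q y) \<in> F n} \<inter>
        {(x, y). x \<in> points X \<and> y \<in> points X \<and> (q x, q y) \<in> G n}"
      by auto
    then show "{(x, y). x \<in> points X \<and> y \<in> points X \<and> (q x, q y) \<in> F n \<inter> G n} \<in> entourages X"
      using F'[of n] G'[of n] ent_Int[OF X] by simp
  qed
  then have "F 0 \<inter> G 0 \<in> ?B"
    by (intro CollectI exI[of _ "\<lambda>n. F n \<inter> G n"]) simp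
  then show "\<exists>D''\<in>?B. D'' \<subseteq> D \<inter> D'"
    unfolding D D' by (rule bexI[rotated]) (rule order_refl)
qed

lemma ucont_fine:
  assumes X: "is_uspace X"
  shows "ucont X (ufine X q) q"
proof (rule ucontI)
  fix E assume "E \<in> entourages (ufine X q)"
  then obtain F where F: "fine_seq X q F" "F 0 \<subseteq> E"
    unfolding ufine_def entourages_ugen by blast
  have "{(x, y). x \<in> points X \<and> y \<in> points X \<and> (q x, q y) \<in> F 0} \<in> entourages X"
    using F(1) unfolding fine_seq_def by blast
  then show "\<exists>D\<in>entourages X. \<forall>x y. (x, y) \<in> D \<longrightarrow> (q x, q y) \<in> E"
    using F(2) by (intro bexI[of _ "{(x, y). x \<in> points X \<and> y \<in> points X \<and> (q x, q y) \<in> F 0}"]) blast+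
qed simp

text \<open>Iterating a choice of symmetric halves in V produces an admissible sequence; the
  preimages of its terms are entourages because q is uniformly continuous into V.\<close>

lemma fine_finest:
  assumes V: "is_uspace V" and X: "is_uspace X" and q: "ucont X V q" and S: "points V = q ` points X"
    and E: "E \<in> entourages V"
  shows "E \<in> entourages (ufine X q)"
proof -
  obtain D where D: "D \<in> entourages V" "sym D" "D \<subseteq> E"
    using ent_sym[OF V E] by blast
  have "\<forall>E\<in>entourages V. \<exists>D. D \<in> entourages V \<and> sym D \<and> D O D \<subseteq> E"
    using ent_half_sym[OF V] by blast
  then obtain h where h: "\<And>E. E \<in> entourages V \<Longrightarrow> h E \<in> entourages V \<and> sym (h E) \<and> h E O h E \<subseteq> E"
    unfolding bchoice_iff by blast
  define F where "F n = (h ^^ n) D" for n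
  have F: "F n \<in> entourages V \<and> sym (F n)" for n
    by (induction n) (use D h in \<open>auto simp: F_def\<close>)
  have "fine_seq X q F"
    unfolding fine_seq_def
  proof (intro allI conjI)
    fix n
    have Fn: "F n \<in> entourages V"
      using F by blast
    show "F n \<subseteq> q ` points X \<times> q ` points X"
      using ent_sub[OF V Fn] by (simp add: S)
    show "Id_on (q ` points X) \<subseteq> F n"
      using ent_refl[OF V Fn] S by auto
    show "sym (F n)"
      using F by blast
    show "F (Suc n) O F (Suc n) \<subseteq> F n"
      using h[OF Fn] by (simp add: F_def)
    show "{(x, y). x \<in> points X \<and> y \<in> points X \<and> (q x, q y) \<in> F n} \<in> entourages X"
      by (rule ent_vimage[OF X q Fn])
  qed
  moreover have "F 0 \<subseteq> E"
    using D by (simp add: F_def)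
  ultimately show ?thesis
    unfolding ufine_def entourages_ugen using ent_sub[OF V E] S by auto
qed

lemma ucont_finer:
  assumes f: "ucont V Z f" and p: "points V = points Q"
    and finer: "\<And>E. E \<in> entourages V \<Longrightarrow> E \<in> entourages Q"
  shows "ucont Q Z f"
proof (rule ucontI)
  show "f x \<in> points Z" if "x \<in> points Q" for x
    using ucontD[OF f] p that by simp
  fix F assume "F \<in> entourages Z"
  then show "\<exists>E\<in>entourages Q. \<forall>x y. (x, y) \<in> E \<longrightarrow> (f x, f y) \<in> F"
    using ucont_entD[OF f] finer by blast
qed

context inaccessible
begin

text \<open>The middle object is the image of e with the finest uniformity that keeps e uniformly
  continuous. It is Hausdorff because it is finer than the subspace of Y. This factorisation is what
  splits closedness under epi images into the bimorphic and the extremal part.\<close>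

lemma epimorphism_factor:
  fixes X Y :: "'u uspace"
  assumes X: "X \<in> T2Unif" and Y: "Y \<in> T2Unif" and e: "epimorphism X Y e"
  shows "\<exists>Q\<in>T2Unif. \<exists>q m. extremal_epi X Q q \<and> bimorphism Q Y m"
proof -
  have uX: "is_uspace X" and uY: "is_uspace Y"
    using X Y T2Unif_uspace by blast+
  have eh: "e \<in> hom X Y"
    by (rule epimorphism_hom[OF e])
  let ?S = "e ` points X"
  let ?Q = "ufine X e"
  let ?m = "restrict (\<lambda>x. x) ?S"
  have SY: "?S \<subseteq> points Y"
    using hom_point[OF eh] by auto
  have uV: "is_uspace (usub Y ?S)"
    by (rule is_uspace_usub[OF uY SY])
  have uQ: "is_uspace ?Q"
    by (rule is_uspace_fine[OF uX])
  have sub_fine: "E \<in> entourages ?Q" if "E \<in> entourages (usub Y ?S)" for E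
    by (rule fine_finest[OF uV uX ucont_into_usub[OF uX hom_ucont[OF eh]]]) (use that in auto)
  have "t2space ?Q"
    unfolding t2space_def
  proof (intro conjI uQ ballI impI)
    fix x y assume "x \<in> points ?Q" "y \<in> points ?Q" "x \<noteq> y"
    then obtain E where "E \<in> entourages (usub Y ?S)" "(x, y) \<notin> E"
      using t2spaceD[OF t2space_usub[OF T2Unif_t2space[OF Y] SY]] unfolding points_ufine points_usub by metis
    then show "\<exists>E\<in>entourages ?Q. (x, y) \<notin> E"
      using sub_fine by blast
  qed
  then have Q: "?Q \<in> T2Unif"
    using X sm_image[of "points X"] by (simp add: T2Unif_sm)
  have eQ: "e \<in> hom X ?Q"
    using eh ucont_fine[OF uX, of e] by (simp add: hom_iff)
  have "extremal_epi X ?Q e"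
    unfolding extremal_epi_def
  proof (intro conjI ballI allI impI)
    show "epimorphism X ?Q e"
      by (rule dense_epimorphism[OF Q eQ surj_dense_in[OF uQ]]) simp
    fix Z g m assume Z: "Z \<in> T2Unif" and gm: "g \<in> hom X Z \<and> monomorphism Z ?Q m \<and> e = comp_from X m g"
    have uZ: "is_uspace Z"
      by (rule T2Unif_uspace[OF Z])
    have m: "m \<in> hom Z ?Q" "inj_on m (points Z)" and g: "g \<in> hom X Z"
      using gm monomorphism_iff[OF uZ] by blast+
    have eg: "e x = m (g x)" if "x \<in> points X" for x
      using gm that by (metis compose_eq)
    \<comment> \<open>Z transported along m gives a uniformity on the image of e that keeps e
      uniformly continuous. It is therefore coarser than the finest one, and this is uniform
      continuity of the inverse of m.\<close>
    let ?V = "ucopy m Z" and ?k = "inv_into (points Z) m"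
    have V: "is_uspace ?V"
      by (rule is_uspace_ucopy[OF uZ m(2)])
    have iso: "uiso Z ?V m ?k"
      by (rule uiso_ucopy[OF uZ m(2)])
    have "m z \<in> ?S" if "z \<in> points Z" for z
      using hom_point[OF m(1) that] by simp
    moreover have "e x \<in> m ` points Z" if "x \<in> points X" for x
      using eg[OF that] hom_point[OF g that] by simp
    ultimately have pV: "points ?V = ?S"
      by auto
    have "ucont X ?V e"
      by (rule ucont_cong[OF uX ucont_comp[OF hom_ucont[OF g] uiso_ucont[OF iso]]]) (simp add: eg)
    then have finer: "E \<in> entourages ?Q" if "E \<in> entourages ?V" for E
      by (rule fine_finest[OF V uX _ pV that])
    have "points ?V = points ?Q"
      unfolding points_ufine by (rule pV)
    then have "ucont ?Q Z ?k"
      by (rule ucont_finer[OF uiso_ucont'[OF iso] _ finer])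
    moreover have "m (?k y) = y" if "y \<in> points ?Q" for y
      using uiso_right[OF iso] that \<open>points ?V = points ?Q\<close> by blast
    ultimately have "uiso Z ?Q m ?k"
      using uiso_left[OF iso] hom_ucont[OF m(1)] by (simp add: uiso_def)
    then show "isomorphism Z ?Q m"
      by (rule isomorphism_hom_uiso[OF uZ uQ m(1)])
  qed
  moreover have "bimorphism ?Q Y ?m"
    unfolding bimorphism_def
  proof
    have "ucont ?Q Y (\<lambda>x. x)"
      by (rule ucont_finer[OF ucont_usub_incl[OF SY] _ sub_fine]) simp_all
    then have m: "?m \<in> hom ?Q Y"
      using restrict_hom[OF uQ] by fastforce
    have "inj_on ?m (points ?Q)"
      by (simp add: inj_on_def)
    then show "monomorphism ?Q Y ?m"
      unfolding monomorphism_iff[OF uQ] using m by blast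
    have "dense_in Y (?m ` points ?Q)"
      using epimorphism_dense[OF X Y e] by simp
    then show "epimorphism ?Q Y ?m"
      by (rule dense_epimorphism[OF Y m])
  qed
  ultimately show ?thesis
    using Q by blast
qed

section \<open>Categorical products and their description by coordinates\<close>

lemma is_product_copy:
  fixes X :: "'u \<Rightarrow> 'u uspace"
  assumes X: "\<And>i. i \<in> I \<Longrightarrow> X i \<in> T2Unif" and P: "P \<in> T2Unif" and iso: "uiso P (uproduct I X) j k"
  shows "is_product I X P (\<lambda>i. restrict (\<lambda>u. j u i) (points P))"
proof -
  let ?p = "\<lambda>i. restrict (\<lambda>u. j u i) (points P)"
  have uP: "is_uspace P"
    by (rule T2Unif_uspace[OF P])
  have p: "?p i \<in> hom P (X i)" if "i \<in> I" for i
    by (rule restrict_hom[OF uP ucont_comp[OF uiso_ucont[OF iso] ucont_proj[OF that]]])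
  show ?thesis
    unfolding is_product_def
  proof (intro conjI ballI allI impI P p)
    fix Z f assume Z: "Z \<in> T2Unif" and f: "\<forall>i\<in>I. f i \<in> hom Z (X i)"
    have uZ: "is_uspace Z"
      by (rule T2Unif_uspace[OF Z])
    let ?h = "\<lambda>z. restrict (\<lambda>i. f i z) I"
    let ?g = "restrict (\<lambda>z. k (?h z)) (points Z)"
    have h: "ucont Z (uproduct I X) ?h"
    proof (rule ucont_into_uproduct[OF uZ])
      show "ucont Z (X i) (\<lambda>z. ?h z i)" if "i \<in> I" for i
        using that f hom_ucont[of "f i" Z "X i"] by simp
    qed auto
    have g: "?g \<in> hom Z P"
      by (rule restrict_hom[OF uZ ucont_comp[OF h uiso_ucont'[OF iso]]])
    have jg: "j (?g z) = ?h z" if "z \<in> points Z" for z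
      using that uiso_right[OF iso ucontD[OF h that]] by simp
    show "\<exists>!g. g \<in> hom Z P \<and> (\<forall>i\<in>I. comp_from Z (?p i) g = f i)"
    proof (rule ex1I[of _ ?g], intro conjI ballI g)
      fix i assume i: "i \<in> I"
      have "?p i (?g z) = f i z" if z: "z \<in> points Z" for z
      proof -
        have "?p i (?g z) = j (?g z) i"
          using hom_point[OF g z] by simp
        then show ?thesis
          using jg[OF z] i by simp
      qed
      moreover have "f i \<in> extensional (points Z)"
        using f i by (simp add: hom_iff)
      ultimately show "comp_from Z (?p i) ?g = f i"
        by (simp only: compose_eq_restrict) simp
    next
      fix g' assume g': "g' \<in> hom Z P \<and> (\<forall>i\<in>I. comp_from Z (?p i) g' = f i)"
      have jeq: "j (g' z) = ?h z" if z: "z \<in> points Z" for z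
      proof (rule extensionalityI)
        have "g' z \<in> points P"
          using hom_point[OF conjunct1[OF g'] z] .
        then show "j (g' z) \<in> extensional I"
          using ucontD[OF uiso_ucont[OF iso]] by (auto simp: PiE_def)
        show "j (g' z) i = ?h z i" if i: "i \<in> I" for i
        proof -
          have "?p i (g' z) = f i z"
            using g' i z by (metis compose_eq)
          then show ?thesis
            using \<open>g' z \<in> points P\<close> i by simp
        qed
      qed simp
      show "g' = ?g"
      proof (rule hom_eqI[of _ Z P])
        fix z assume z: "z \<in> points Z"
        have "g' z = k (j (g' z))"
          using uiso_left[OF iso hom_point[OF conjunct1[OF g'] z]] by simp
        then show "g' z = ?g z"
          using jeq[OF z] z by simp
      qed (use g' g in auto)
    qed
  qed
qed

lemma ex_uproduct_copy:
  fixes X :: "'i \<Rightarrow> 'b uspace"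
  assumes "sm I" "\<And>i. i \<in> I \<Longrightarrow> t2space (X i)" "\<And>i. i \<in> I \<Longrightarrow> sm (points (X i))"
  shows "\<exists>(P :: 'u uspace) j k. P \<in> T2Unif \<and> uiso P (uproduct I X) j k"
proof -
  have "sm (points (uproduct I X))"
    using sm_PiE[OF assms(1), of "\<lambda>i. points (X i)"] assms(3) by simp
  moreover have "t2space (uproduct I X)"
    by (rule t2space_uproduct) (rule assms(2))
  ultimately obtain P :: "'u uspace" and j k where "P \<in> T2Unif" "uiso (uproduct I X) P j k"
    using ex_copy by blast
  then show ?thesis
    using uiso_sym by blast
qed

text \<open>Uniqueness of products, applied to P and a copy of the concrete product. It turns the
  categorical hypothesis, which says nothing about the carrier of P, into coordinates.\<close>

lemma is_product_uiso:
  fixes X :: "'u \<Rightarrow> 'u uspace"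
  assumes I: "small I" and X: "\<And>i. i \<in> I \<Longrightarrow> X i \<in> T2Unif" and P: "is_product I X P p"
  shows "\<exists>j k. uiso P (uproduct I X) j k \<and> (\<forall>i\<in>I. \<forall>x\<in>points P. j x i = p i x)"
proof -
  obtain P' :: "'u uspace" and j k where P': "P' \<in> T2Unif" and iso: "uiso P' (uproduct I X) j k"
    using ex_uproduct_copy[of I X] I X by (auto simp: T2Unif_sm small_sm)
  define p' where "p' i = restrict (\<lambda>u. j u i) (points P')" for i
  have prod': "is_product I X P' p'"
    unfolding p'_def by (rule is_product_copy[OF X P' iso])
  have PT: "P \<in> T2Unif" and p: "\<And>i. i \<in> I \<Longrightarrow> p i \<in> hom P (X i)" and p': "\<And>i. i \<in> I \<Longrightarrow> p' i \<in> hom P' (X i)"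
    using P prod' by (auto simp: is_product_def)
  have uP: "is_uspace P" and uP': "is_uspace P'"
    using PT P' T2Unif_uspace by blast+
  obtain g where g: "g \<in> hom P P'" "\<And>i. i \<in> I \<Longrightarrow> comp_from P (p' i) g = p i"
    using prod'[unfolded is_product_def, THEN conjunct2, THEN conjunct2, rule_format, OF PT, of p] p by blast
  obtain g' where g': "g' \<in> hom P' P" "\<And>i. i \<in> I \<Longrightarrow> comp_from P' (p i) g' = p' i"
    using P[unfolded is_product_def, THEN conjunct2, THEN conjunct2, rule_format, OF P', of p'] p' by blast
  have gi: "p' i (g x) = p i x" if "i \<in> I" "x \<in> points P" for i x
    using g(2) that by (metis compose_eq)
  have gi': "p i (g' x) = p' i x" if "i \<in> I" "x \<in> points P'" for i x
    using g'(2) that by (metis compose_eq)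
  have ext: "f \<in> extensional (points A)" if "f \<in> hom A B" for f A B
    using that by (simp add: hom_iff)
  have "comp_from P g' g = ident P"
  proof -
    have "\<exists>!h. h \<in> hom P P \<and> (\<forall>i\<in>I. comp_from P (p i) h = p i)"
      using P[unfolded is_product_def, THEN conjunct2, THEN conjunct2, rule_format, OF PT, of p] p by blast
    moreover have "comp_from P g' g \<in> hom P P" "ident P \<in> hom P P"
      using comp_from_hom[OF uP g(1) g'(1)] ident_hom[OF uP] by blast+
    moreover have "comp_from P (p i) (comp_from P g' g) = p i" if "i \<in> I" for i
      by (rule iffD2[OF compose_eq_restrict[OF ext[OF p[OF that]]]])
        (simp add: compose_eq gi[OF that] gi'[OF that] hom_point[OF g(1)])
    moreover have "comp_from P (p i) (ident P) = p i" if "i \<in> I" for i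
      by (rule iffD2[OF compose_eq_restrict[OF ext[OF p[OF that]]]]) (simp add: ident_def)
    ultimately show ?thesis
      by blast
  qed
  moreover have "comp_from P' g g' = ident P'"
  proof -
    have "\<exists>!h. h \<in> hom P' P' \<and> (\<forall>i\<in>I. comp_from P' (p' i) h = p' i)"
      using prod'[unfolded is_product_def, THEN conjunct2, THEN conjunct2, rule_format, OF P', of p'] p' by blast
    moreover have "comp_from P' g g' \<in> hom P' P'" "ident P' \<in> hom P' P'"
      using comp_from_hom[OF uP' g'(1) g(1)] ident_hom[OF uP'] by blast+
    moreover have "comp_from P' (p' i) (comp_from P' g g') = p' i" if "i \<in> I" for i
      by (rule iffD2[OF compose_eq_restrict[OF ext[OF p'[OF that]]]])
        (simp add: compose_eq gi[OF that] gi'[OF that] hom_point[OF g'(1)])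
    moreover have "comp_from P' (p' i) (ident P') = p' i" if "i \<in> I" for i
      by (rule iffD2[OF compose_eq_restrict[OF ext[OF p'[OF that]]]]) (simp add: ident_def)
    ultimately show ?thesis
      by blast
  qed
  ultimately have "uiso P P' g g'"
    using g(1) g'(1) ext[OF ident_hom[OF uP]] ext[OF ident_hom[OF uP']] hom_ucont
    by (auto simp: uiso_def compose_eq_restrict ident_def)
  then have "uiso P (uproduct I X) (\<lambda>x. j (g x)) (\<lambda>z. g' (k z))"
    by (rule uiso_trans[OF _ iso])
  moreover have "j (g x) i = p i x" if "i \<in> I" "x \<in> points P" for i x
    using gi[OF that] hom_point[OF g(1) that(2)] by (simp add: p'_def)
  ultimately show ?thesis
    by blast
qed

end


section \<open>Classes closed under products and closed subspaces\<close>

text \<open>Membership in C up to isomorphism, for spaces on any type. C only contains spaces on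
  \<open>'u\<close>, so for cubes and spaces of codes membership can be stated only in this
  form.\<close>

definition realized :: "'u uspace set \<Rightarrow> 'a uspace \<Rightarrow> bool" where
  "realized C X \<longleftrightarrow> (\<exists>Y\<in>C. \<exists>j k. uiso X Y j k)"

lemma realized_uiso: "realized C X \<Longrightarrow> uiso X Y j k \<Longrightarrow> realized C Y"
  unfolding realized_def using uiso_trans[OF uiso_sym] by blast

lemma initial_forE:
  assumes init: "initial_for X I f Y" and E: "E \<in> entourages X"
  obtains J F where "finite J" "J \<subseteq> I" "\<forall>i\<in>J. F i \<in> entourages (Y i)"
    "init_ent (points X) J f F \<subseteq> E"
proof -
  have "\<exists>J F. finite J \<and> J \<subseteq> I \<and> (\<forall>i\<in>J. F i \<in> entourages (Y i)) \<and> init_ent (points X) J f F \<subseteq> E"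
    by (rule init[unfolded initial_for_def, THEN conjunct2, THEN bspec, OF E])
  then show thesis
    by (elim exE conjE) (rule that)
qed

lemma initial_inj:
  assumes X: "t2space X" and init: "initial_for X I f Y" and Y: "\<And>i. i \<in> I \<Longrightarrow> is_uspace (Y i)"
    and x: "x \<in> points X" and y: "y \<in> points X" and eq: "\<And>i. i \<in> I \<Longrightarrow> f i x = f i y"
  shows "x = y"
proof (rule t2spaceD[OF X x y])
  fix E assume E: "E \<in> entourages X"
  obtain J F where J: "finite J" "J \<subseteq> I" "\<forall>i\<in>J. F i \<in> entourages (Y i)"
    "init_ent (points X) J f F \<subseteq> E"
    by (rule initial_forE[OF init E])
  have "(f i x, f i y) \<in> F i" if "i \<in> J" for i
  proof -
    have i: "i \<in> I"
      using that J(2) by blast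
    then have "f i y \<in> points (Y i)"
      using ucontD[OF initial_for_ucont[OF init i] y] by blast
    then show ?thesis
      using ent_refl[OF Y[OF i] bspec[OF J(3) that]] eq[OF i] by simp
  qed
  then have "(x, y) \<in> init_ent (points X) J f F"
    using x y by (simp add: init_ent_def)
  then show "(x, y) \<in> E"
    using J(4) by blast
qed

locale prod_closed = inaccessible U for U :: "'u set" +
  fixes C :: "'u uspace set"
  assumes subcat: "subcategory C" and prod: "closed_under_products C"
    and ext: "closed_under_extremal_subobjects C"
begin

lemma C_T2Unif: "X \<in> C \<Longrightarrow> X \<in> T2Unif"
  using subcat by (auto simp: subcategory_def)

lemma C_uspace: "X \<in> C \<Longrightarrow> is_uspace X"
  using C_T2Unif T2Unif_uspace by blast

lemma C_uiso:
  assumes "X \<in> C" "Y \<in> T2Unif" "uiso X Y j k"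
  shows "Y \<in> C"
  using subcat[unfolded subcategory_def, THEN conjunct2, rule_format, OF assms(1,2)]
    uiso_isomorphism[OF C_uspace[OF assms(1)] T2Unif_uspace[OF assms(2)] assms(3)] by blast

lemma C_realized: "X \<in> C \<Longrightarrow> realized C X"
  unfolding realized_def using uiso_refl by blast

lemma realized_C: "realized C X \<Longrightarrow> X \<in> T2Unif \<Longrightarrow> X \<in> C"
  unfolding realized_def using C_uiso[OF _ _ uiso_sym] by blast

lemma realized_sm:
  assumes "realized C X"
  shows "sm (points X)"
proof -
  obtain Y j k where Y: "Y \<in> C" "uiso X Y j k"
    using assms by (auto simp: realized_def)
  have "sm (points Y)"
    using C_T2Unif[OF Y(1)] by (simp add: T2Unif_sm)
  then show ?thesis
    by (rule sm_inj_on[OF _ uiso_inj_on[OF Y(2)]]) (use uiso_image[OF Y(2)] in blast)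
qed

lemma realized_t2space:
  assumes "realized C X" "is_uspace X"
  shows "t2space X"
  using assms uiso_t2space[OF uiso_sym] C_T2Unif T2Unif_t2space unfolding realized_def by blast

lemma usub_C:
  assumes Y: "Y \<in> C" and S: "closedin (utopology Y) S"
  shows "usub Y S \<in> C"
  using ext[unfolded closed_under_extremal_subobjects_def, rule_format, OF Y
      usub_T2Unif[OF C_T2Unif[OF Y] closedin_points[OF C_uspace[OF Y] S]]
      usub_extremal_mono[OF C_T2Unif[OF Y] S]] .

lemma realized_closed_embedding:
  assumes X: "t2space X" and Y: "Y \<in> C" and init: "initial_for X {()} (\<lambda>_. m) (\<lambda>_. Y)"
    and closed: "closedin (utopology Y) (m ` points X)"
  shows "realized C X"
proof -
  let ?S = "m ` points X" and ?k = "inv_into (points X) m"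
  have uX: "is_uspace X" and uY: "is_uspace Y"
    using X Y t2space_uspace C_uspace by blast+
  have m: "ucont X Y m"
    using initial_for_ucont[OF init] by simp
  have SY: "?S \<subseteq> points Y"
    by (rule closedin_points[OF uY closed])
  have inj: "inj_on m (points X)"
    using initial_inj[OF X init] uY by (intro inj_onI) simp
  have uS: "is_uspace (usub Y ?S)"
    by (rule is_uspace_usub[OF uY SY])
  have "ucont (usub Y ?S) X ?k"
  proof (rule ucont_initial[OF init uS])
    show "?k z \<in> points X" if "z \<in> points (usub Y ?S)" for z
      using that by (simp add: inv_into_into)
    show "ucont (usub Y ?S) Y (\<lambda>z. m (?k z))"
      by (rule ucont_cong[OF uS ucont_usub_incl[OF SY]]) (simp add: f_inv_into_f)
  qed
  then have "uiso X (usub Y ?S) m ?k"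
    using ucont_into_usub[OF uX m order_refl] inj by (simp add: uiso_def f_inv_into_f)
  then show ?thesis
    unfolding realized_def using usub_C[OF Y closed] by blast
qed

text \<open>Closedness under products concerns index sets in \<open>'u\<close> only, so the index
  set is renamed along an injection \<open>h\<close>, and \<open>r\<close> undoes the
  renaming.\<close>

lemma realized_uproduct_C:
  fixes X :: "'i \<Rightarrow> 'u uspace"
  assumes I: "sm I" and X: "\<And>i. i \<in> I \<Longrightarrow> X i \<in> C"
  shows "realized C (uproduct I X)"
proof -
  obtain h :: "'i \<Rightarrow> 'u" where h: "inj_on h I"
    using sm_ex_inj[OF I] by blast
  define r where "r = inv_into I h"
  have r: "r (h i) = i" if "i \<in> I" for i
    using that h by (simp add: r_def)
  have rI: "r u \<in> I" if "u \<in> h ` I" for u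
    using that r by auto
  have hr: "h (r u) = u" if "u \<in> h ` I" for u
    using that r by auto
  define X' where "X' u = X (r u)" for u
  have X'C: "X' u \<in> C" if "u \<in> h ` I" for u
    using X rI[OF that] by (simp add: X'_def)
  have X'T: "X' u \<in> T2Unif" if "u \<in> h ` I" for u
    by (rule C_T2Unif[OF X'C[OF that]])
  have I': "sm (h ` I)"
    by (rule sm_image[OF I])
  obtain P :: "'u uspace" and j k where P: "P \<in> T2Unif" "uiso P (uproduct (h ` I) X') j k"
    using ex_uproduct_copy[OF I', of X'] X'T by (auto simp: T2Unif_sm)
  have "is_product (h ` I) X' P (\<lambda>i. restrict (\<lambda>u. j u i) (points P))"
    by (rule is_product_copy[OF X'T P])
  then have PC: "P \<in> C"
    using prod[unfolded closed_under_products_def, rule_format, of "h ` I" X' P] I' X'C small_sm by blast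
  have u1: "is_uspace (uproduct I X)"
    using X C_uspace by (intro is_uspace_uproduct) blast
  have u2: "is_uspace (uproduct (h ` I) X')"
    using X'C C_uspace by (intro is_uspace_uproduct) blast
  have "uiso (uproduct (h ` I) X') (uproduct I X) (\<lambda>y. \<lambda>i\<in>I. y (h i)) (\<lambda>x. \<lambda>u\<in>h ` I. x (r u))"
    unfolding uiso_def
  proof (intro conjI ballI)
    show "ucont (uproduct (h ` I) X') (uproduct I X) (\<lambda>y. \<lambda>i\<in>I. y (h i))"
    proof (rule ucont_into_uproduct[OF u2])
      fix i assume i: "i \<in> I"
      have "ucont (uproduct (h ` I) X') (X' (h i)) (\<lambda>y. y (h i))"
        using i by (intro ucont_proj) simp
      then show "ucont (uproduct (h ` I) X') (X i) (\<lambda>y. (\<lambda>i\<in>I. y (h i)) i)"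
        using i r by (simp add: X'_def)
    qed simp
    show "ucont (uproduct I X) (uproduct (h ` I) X') (\<lambda>x. \<lambda>u\<in>h ` I. x (r u))"
    proof (rule ucont_into_uproduct[OF u1])
      fix u assume u: "u \<in> h ` I"
      have "ucont (uproduct I X) (X (r u)) (\<lambda>x. x (r u))"
        using rI[OF u] by (rule ucont_proj)
      then show "ucont (uproduct I X) (X' u) (\<lambda>x. (\<lambda>u\<in>h ` I. x (r u)) u)"
        using u by (simp add: X'_def)
    qed simp
    show "(\<lambda>u\<in>h ` I. (\<lambda>i\<in>I. y (h i)) (r u)) = y" if "y \<in> points (uproduct (h ` I) X')" for y
      using that rI hr by (intro extensionalityI[of _ "h ` I"]) (auto simp: PiE_def)
    show "(\<lambda>i\<in>I. (\<lambda>u\<in>h ` I. x (r u)) (h i)) = x" if "x \<in> points (uproduct I X)" for x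
      using that r by (intro extensionalityI[of _ I]) (auto simp: PiE_def)
  qed
  then show ?thesis
    by (rule realized_uiso[OF realized_uiso[OF C_realized[OF PC] P(2)]])
qed

text \<open>X embeds into the product of the \<open>Y i\<close>, and the assumption
  \<open>closed\<close> says that the image is closed: a family that can be approximated at finitely
  many coordinates at a time already comes from a point. So X is a closed subspace of a product of
  members. Subspaces, products, preimages, finite discrete spaces and the graph of convergence are
  all obtained as instances.\<close>

lemma realized_initial:
  fixes X :: "'a uspace" and Y :: "'i \<Rightarrow> 'b uspace"
  assumes X: "t2space X" and I: "sm I" and Y: "\<And>i. i \<in> I \<Longrightarrow> realized C (Y i)"
    and init: "initial_for X I f Y"
    and closed: "\<And>y. \<lbrakk>\<And>i. i \<in> I \<Longrightarrow> y i \<in> points (Y i);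
       \<And>J F. \<lbrakk>finite J; J \<subseteq> I; \<And>i. i \<in> J \<Longrightarrow> F i \<in> entourages (Y i)\<rbrakk> \<Longrightarrow>
         \<exists>x\<in>points X. \<forall>i\<in>J. (y i, f i x) \<in> F i\<rbrakk> \<Longrightarrow> \<exists>x\<in>points X. \<forall>i\<in>I. f i x = y i"
  shows "realized C X"
proof -
  have "\<forall>i\<in>I. \<exists>Z. Z \<in> C \<and> (\<exists>j k. uiso (Y i) Z j k)"
    using Y unfolding realized_def by blast
  then obtain Z where Z: "\<And>i. i \<in> I \<Longrightarrow> Z i \<in> C" "\<And>i. i \<in> I \<Longrightarrow> \<exists>j k. uiso (Y i) (Z i) j k"
    unfolding bchoice_iff by blast
  have "\<forall>i\<in>I. \<exists>j. \<exists>k. uiso (Y i) (Z i) j k"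
    using Z(2) by blast
  then obtain j where j: "\<And>i. i \<in> I \<Longrightarrow> \<exists>k. uiso (Y i) (Z i) (j i) k"
    unfolding bchoice_iff by blast
  then have "\<forall>i\<in>I. \<exists>k. uiso (Y i) (Z i) (j i) k"
    by blast
  then obtain k where jk: "\<And>i. i \<in> I \<Longrightarrow> uiso (Y i) (Z i) (j i) (k i)"
    unfolding bchoice_iff by blast
  have uX: "is_uspace X"
    by (rule t2space_uspace[OF X])
  let ?P = "uproduct I Z"
  have uZ: "is_uspace (Z i)" if "i \<in> I" for i
    by (rule C_uspace[OF Z(1)[OF that]])
  have uP: "is_uspace ?P"
    using uZ by (intro is_uspace_uproduct) blast
  have "realized C ?P"
    by (rule realized_uproduct_C[OF I Z(1)])
  then obtain Q a b where Q: "Q \<in> C" "uiso ?P Q a b"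
    unfolding realized_def by blast
  have uQ: "is_uspace Q"
    by (rule C_uspace[OF Q(1)])
  define t where "t x = (\<lambda>i\<in>I. j i (f i x))" for x
  have tP: "ucont X ?P t"
  proof (rule ucont_into_uproduct[OF uX])
    fix i assume i: "i \<in> I"
    have "ucont X (Z i) (\<lambda>x. j i (f i x))"
      by (rule ucont_comp[OF initial_for_ucont[OF init i] uiso_ucont[OF jk[OF i]]])
    then show "ucont X (Z i) (\<lambda>x. t x i)"
      using i by (simp add: t_def)
  qed (simp add: t_def)
  define m where "m x = a (t x)" for x
  have m: "ucont X Q m"
    unfolding m_def by (rule ucont_comp[OF tP uiso_ucont[OF Q(2)]])
  have bm: "b (m x) = t x" if "x \<in> points X" for x
    unfolding m_def by (rule uiso_left[OF Q(2) ucontD[OF tP that]])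
  \<comment> \<open>Finitely many conditions on coordinates hold on one entourage of
    \<open>Q\<close>. This serves both for the initial uniformity and for closedness of the
    image.\<close>
  have pull: "\<exists>G\<in>entourages Q. \<forall>u v. (u, v) \<in> G \<longrightarrow> (\<forall>i\<in>J. (k i (b u i), k i (b v i)) \<in> F i)"
    if J: "finite J" "J \<subseteq> I" "\<And>i. i \<in> J \<Longrightarrow> F i \<in> entourages (Y i)" for J F
  proof -
    have "\<exists>D\<in>entourages Q. \<forall>i\<in>J. D \<subseteq> {(u, v). u \<in> points Q \<and> v \<in> points Q \<and> (k i (b u i), k i (b v i)) \<in> F i}"
    proof (rule ent_INT[OF uQ J(1)])
      fix i assume i: "i \<in> J"
      then have iI: "i \<in> I"
        using J(2) by blast
      have "ucont Q (Y i) (\<lambda>u. k i (b u i))"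
        by (rule ucont_comp[OF ucont_comp[OF uiso_ucont'[OF Q(2)] ucont_proj[OF iI]] uiso_ucont'[OF jk[OF iI]]])
      then show "{(u, v). u \<in> points Q \<and> v \<in> points Q \<and> (k i (b u i), k i (b v i)) \<in> F i} \<in> entourages Q"
        by (rule ent_vimage[OF uQ _ J(3)[OF i]])
    qed
    then obtain D where D: "D \<in> entourages Q"
      "\<forall>i\<in>J. D \<subseteq> {(u, v). u \<in> points Q \<and> v \<in> points Q \<and> (k i (b u i), k i (b v i)) \<in> F i}"
      by blast
    show ?thesis
      by (rule bexI[OF _ D(1)]) (use D(2) in blast)
  qed
  have kt: "k i (b (m x) i) = f i x" if "x \<in> points X" "i \<in> I" for x i
  proof -
    have "b (m x) i = j i (f i x)"
      using bm[OF that(1)] that(2) by (simp add: t_def)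
    then show ?thesis
      using uiso_left[OF jk[OF that(2)] ucontD[OF initial_for_ucont[OF init that(2)] that(1)]] by simp
  qed
  have initm: "initial_for X {()} (\<lambda>_. m) (\<lambda>_. Q)"
    unfolding initial_for_def
  proof (intro conjI ballI m)
    fix E assume E: "E \<in> entourages X"
    obtain J F where J: "finite J" "J \<subseteq> I" "\<forall>i\<in>J. F i \<in> entourages (Y i)"
      "init_ent (points X) J f F \<subseteq> E"
      by (rule initial_forE[OF init E])
    obtain G where G: "G \<in> entourages Q"
      "\<forall>u v. (u, v) \<in> G \<longrightarrow> (\<forall>i\<in>J. (k i (b u i), k i (b v i)) \<in> F i)"
      using pull[OF J(1,2) bspec[OF J(3)]] by blast
    have "init_ent (points X) {()} (\<lambda>_. m) (\<lambda>_. G) \<subseteq> E"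
    proof
      fix p assume "p \<in> init_ent (points X) {()} (\<lambda>_. m) (\<lambda>_. G)"
      then obtain x y where p: "p = (x, y)" "x \<in> points X" "y \<in> points X" "(m x, m y) \<in> G"
        by (auto simp: init_ent_def)
      have "(f i x, f i y) \<in> F i" if "i \<in> J" for i
      proof -
        have "(k i (b (m x) i), k i (b (m y) i)) \<in> F i"
          using G(2) p(4) that by blast
        then show ?thesis
          using kt[OF p(2)] kt[OF p(3)] J(2) that by (simp add: subset_iff)
      qed
      then have "p \<in> init_ent (points X) J f F"
        using p by (simp add: init_ent_def)
      then show "p \<in> E"
        using J(4) by blast
    qed
    then show "\<exists>J F. finite J \<and> J \<subseteq> {()} \<and> (\<forall>i\<in>J. F i \<in> entourages Q) \<and>
        init_ent (points X) J (\<lambda>_. m) F \<subseteq> E"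
      using G(1) by (intro exI[of _ "{()}"] exI[of _ "\<lambda>_. G"]) simp
  qed
  have "closedin (utopology Q) (m ` points X)"
    unfolding closedin_utopology[OF uQ]
  proof (intro conjI ballI impI)
    show "m ` points X \<subseteq> points Q"
      using ucontD[OF m] by blast
    fix y assume y: "y \<in> points Q" and near: "\<forall>E\<in>entourages Q. \<exists>s\<in>m ` points X. (y, s) \<in> E"
    have b_y: "b y \<in> points ?P"
      by (rule ucontD[OF uiso_ucont'[OF Q(2)] y])
    then have byi: "b y i \<in> points (Z i)" if "i \<in> I" for i
      using that by auto
    have "\<exists>x\<in>points X. \<forall>i\<in>I. f i x = k i (b y i)"
    proof (rule closed)
      show "k i (b y i) \<in> points (Y i)" if "i \<in> I" for i
        by (rule ucontD[OF uiso_ucont'[OF jk[OF that]] byi[OF that]])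
      fix J F assume J: "finite J" "J \<subseteq> I" "\<And>i. i \<in> J \<Longrightarrow> F i \<in> entourages (Y i)"
      obtain G where G: "G \<in> entourages Q"
        "\<forall>u v. (u, v) \<in> G \<longrightarrow> (\<forall>i\<in>J. (k i (b u i), k i (b v i)) \<in> F i)"
        using pull[OF J] by blast
      obtain x where x: "x \<in> points X" "(y, m x) \<in> G"
        using near G(1) by blast
      have "(k i (b y i), f i x) \<in> F i" if "i \<in> J" for i
      proof -
        have "(k i (b y i), k i (b (m x) i)) \<in> F i"
          using G(2) x(2) that by blast
        then show ?thesis
          using kt[OF x(1)] J(2) that by (simp add: subset_iff)
      qed
      then show "\<exists>x\<in>points X. \<forall>i\<in>J. (k i (b y i), f i x) \<in> F i"
        using x(1) by blast
    qed
    then obtain x where x: "x \<in> points X" "\<And>i. i \<in> I \<Longrightarrow> f i x = k i (b y i)"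
      by blast
    have "t x = b y"
    proof (rule extensionalityI[of _ I])
      show "t x i = b y i" if "i \<in> I" for i
        using x(2)[OF that] uiso_right[OF jk[OF that] byi[OF that]] that by (simp add: t_def)
    qed (use b_y in \<open>simp_all add: t_def PiE_def\<close>)
    then have "m x = y"
      using uiso_right[OF Q(2) y] by (simp add: m_def)
    then show "y \<in> m ` points X"
      using x(1) by blast
  qed
  then show ?thesis
    by (rule realized_closed_embedding[OF X Q(1) initm])
qed

lemma realized_usub:
  assumes X: "is_uspace X" and R: "realized C X" and S: "closedin (utopology X) S"
  shows "realized C (usub X S)"
proof -
  have SX: "S \<subseteq> points X"
    by (rule closedin_points[OF X S])
  show ?thesis
  proof (rule realized_initial[where I = "{()}" and f = "\<lambda>_ x. x" and Y = "\<lambda>_. X"])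
    show "t2space (usub X S)"
      by (rule t2space_usub[OF realized_t2space[OF R X] SX])
    show "initial_for (usub X S) {()} (\<lambda>_ x. x) (\<lambda>_. X)"
      unfolding initial_for_def
    proof (intro conjI ballI ucont_usub_incl[OF SX])
      fix E assume "E \<in> entourages (usub X S)"
      then obtain D where "D \<in> entourages X" "E = D \<inter> S \<times> S"
        by (auto simp: entourages_usub)
      then show "\<exists>J F. finite J \<and> J \<subseteq> {()} \<and> (\<forall>i\<in>J. F i \<in> entourages X) \<and>
          init_ent (points (usub X S)) J (\<lambda>_ x. x) F \<subseteq> E"
        by (intro exI[of _ "{()}"] exI[of _ "\<lambda>_. D"]) (auto simp: init_ent_def)
    qed
    fix y :: "unit \<Rightarrow> 'a"
    assume y: "\<And>i. i \<in> {()} \<Longrightarrow> y i \<in> points X"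
      and near: "\<And>J F. \<lbrakk>finite J; J \<subseteq> {()}; \<And>i. i \<in> J \<Longrightarrow> F i \<in> entourages X\<rbrakk> \<Longrightarrow>
         \<exists>x\<in>points (usub X S). \<forall>i\<in>J. (y i, x) \<in> F i"
    have "y () \<in> S"
    proof (rule ccontr)
      assume "y () \<notin> S"
      then obtain E where E: "E \<in> entourages X" "\<forall>s\<in>S. (y (), s) \<notin> E"
        using closedin_utopologyD[OF X S] y by blast
      then show False
        using near[of "{()}" "\<lambda>_. E"] by auto
    qed
    then show "\<exists>x\<in>points (usub X S). \<forall>i\<in>{()}. x = y i"
      by simp
  qed (use R sm_finite[of "{()}"] in simp_all)
qed

lemma realized_uproduct:
  fixes Y :: "'i \<Rightarrow> 'b uspace"
  assumes I: "sm I" and Y: "\<And>i. i \<in> I \<Longrightarrow> realized C (Y i)" and uY: "\<And>i. i \<in> I \<Longrightarrow> is_uspace (Y i)"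
  shows "realized C (uproduct I Y)"
proof (rule realized_initial[OF _ I Y initial_for_uproduct])
  show "t2space (uproduct I Y)"
    using realized_t2space Y uY by (intro t2space_uproduct) blast
  fix y assume "\<And>i. i \<in> I \<Longrightarrow> y i \<in> points (Y i)"
  then show "\<exists>x\<in>points (uproduct I Y). \<forall>i\<in>I. x i = y i"
    by (intro bexI[of _ "restrict y I"]) auto
qed

text \<open>T may fail to be closed. Sending x to x together with all the \<open>f i x\<close>
  embeds the preimage into X times a power of T, where the image is closed as a graph because Y is
  Hausdorff.\<close>

lemma realized_vimage:
  fixes X :: "'a uspace" and Y :: "'b uspace"
  assumes I: "sm I" and X: "is_uspace X" and RX: "realized C X"
    and Y: "t2space Y" and T: "T \<subseteq> points Y" and RT: "realized C (usub Y T)"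
    and f: "\<And>i. i \<in> I \<Longrightarrow> ucont X Y (f i)"
  shows "realized C (usub X {x \<in> points X. \<forall>i\<in>I. f i x \<in> T})"
proof -
  have uY: "is_uspace Y"
    by (rule t2space_uspace[OF Y])
  define S where "S = {x \<in> points X. \<forall>i\<in>I. f i x \<in> T}"
  have SX: "S \<subseteq> points X"
    by (auto simp: S_def)
  have uS: "is_uspace (usub X S)"
    by (rule is_uspace_usub[OF X SX])
  obtain X' j k where X': "X' \<in> C" "uiso X X' j k"
    using RX by (auto simp: realized_def)
  obtain T' a b where T': "T' \<in> C" "uiso (usub Y T) T' a b"
    using RT by (auto simp: realized_def)
  \<comment> \<open>\<open>None\<close> indexes the factor X, and each \<open>Some i\<close> a
    factor T.\<close>
  define I' where "I' = insert None (Some ` I)"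
  define Z where "Z n = (case n of None \<Rightarrow> X' | Some i \<Rightarrow> T')" for n :: "'c option"
  define g where "g n = (case n of None \<Rightarrow> j | Some i \<Rightarrow> (\<lambda>x. a (f i x)))" for n
  have "realized C (usub X S)"
  proof (rule realized_initial[where I = I' and f = g and Y = Z])
    show "t2space (usub X S)"
      by (rule t2space_usub[OF realized_t2space[OF RX X] SX])
    show "sm I'"
      unfolding I'_def using sm_Un[OF sm_finite[of "{None}"] sm_image[OF I, of Some]] by simp
    show "realized C (Z n)" if "n \<in> I'" for n
      using X'(1) T'(1) C_realized by (simp add: Z_def split: option.splits)
    show "initial_for (usub X S) I' g Z"
      unfolding initial_for_def
    proof (intro conjI ballI)
      fix n assume n: "n \<in> I'"
      show "ucont (usub X S) (Z n) (g n)"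
      proof (cases n)
        case None
        then show ?thesis
          using ucont_usub_restrict[OF uiso_ucont[OF X'(2)] SX] by (simp add: Z_def g_def)
      next
        case (Some i)
        then have i: "i \<in> I"
          using n by (auto simp: I'_def)
        have "ucont (usub X S) (usub Y T) (f i)"
          by (rule ucont_into_usub[OF uS ucont_usub_restrict[OF f[OF i] SX]]) (use i in \<open>auto simp: S_def\<close>)
        then show ?thesis
          using ucont_comp[OF _ uiso_ucont[OF T'(2)]] Some by (simp add: Z_def g_def)
      qed
    next
      fix E assume "E \<in> entourages (usub X S)"
      then obtain D where D: "D \<in> entourages X" "E = D \<inter> S \<times> S"
        by (auto simp: entourages_usub)
      obtain F where F: "F \<in> entourages X'" "\<forall>x y. (x, y) \<in> F \<longrightarrow> (k x, k y) \<in> D"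
        using ucont_entD[OF uiso_ucont'[OF X'(2)] D(1)] by blast
      have "init_ent S {None} g (\<lambda>_. F) \<subseteq> E"
      proof
        fix p assume "p \<in> init_ent S {None} g (\<lambda>_. F)"
        then obtain x y where p: "p = (x, y)" "x \<in> S" "y \<in> S" "(j x, j y) \<in> F"
          by (auto simp: init_ent_def g_def)
        then have "(k (j x), k (j y)) \<in> D"
          using F(2) by blast
        then show "p \<in> E"
          using p D(2) SX uiso_left[OF X'(2)] by (simp add: subset_iff)
      qed
      then show "\<exists>J F. finite J \<and> J \<subseteq> I' \<and> (\<forall>i\<in>J. F i \<in> entourages (Z i)) \<and>
          init_ent (points (usub X S)) J g F \<subseteq> E"
        using F(1) by (intro exI[of _ "{None}"] exI[of _ "\<lambda>_. F"]) (simp add: I'_def Z_def)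
    qed
    fix y assume y: "\<And>n. n \<in> I' \<Longrightarrow> y n \<in> points (Z n)"
      and near: "\<And>J F. \<lbrakk>finite J; J \<subseteq> I'; \<And>n. n \<in> J \<Longrightarrow> F n \<in> entourages (Z n)\<rbrakk> \<Longrightarrow>
         \<exists>x\<in>points (usub X S). \<forall>n\<in>J. (y n, g n x) \<in> F n"
    have yX': "y None \<in> points X'"
      using y[of None] by (simp add: I'_def Z_def)
    define x where "x = k (y None)"
    have x: "x \<in> points X" "j x = y None"
      unfolding x_def using ucontD[OF uiso_ucont'[OF X'(2)] yX'] uiso_right[OF X'(2) yX'] by simp_all
    have yT: "y (Some i) \<in> points T'" if "i \<in> I" for i
      using y[of "Some i"] that by (simp add: I'_def Z_def)
    have bT: "b (y (Some i)) \<in> T" if "i \<in> I" for i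
      using ucontD[OF uiso_ucont'[OF T'(2)] yT[OF that]] by simp
    \<comment> \<open>Both sides are approximated by \<open>f i s\<close> for a single point s of
      the preimage, close to x in the first factor and to the given value in the factor belonging to
      i.\<close>
    have fx: "f i x = b (y (Some i))" if i: "i \<in> I" for i
    proof (rule t2spaceD[OF Y])
      show "f i x \<in> points Y"
        by (rule ucontD[OF f[OF i] x(1)])
      show "b (y (Some i)) \<in> points Y"
        using bT[OF i] T by blast
      fix E assume "E \<in> entourages Y"
      then obtain D where D: "D \<in> entourages Y" "sym D" "D O D \<subseteq> E"
        using ent_half_sym[OF uY] by blast
      obtain F where F: "F \<in> entourages X'" "\<forall>x y. (x, y) \<in> F \<longrightarrow> (f i (k x), f i (k y)) \<in> D"
        using ucont_entD[OF ucont_comp[OF uiso_ucont'[OF X'(2)] f[OF i]] D(1)] by blast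
      have "D \<inter> T \<times> T \<in> entourages (usub Y T)"
        using D(1) by (auto simp: entourages_usub)
      then obtain G where G: "G \<in> entourages T'" "\<forall>x y. (x, y) \<in> G \<longrightarrow> (b x, b y) \<in> D"
        using ucont_entD[OF uiso_ucont'[OF T'(2)]] by blast
      have "\<exists>x\<in>points (usub X S). \<forall>n\<in>{None, Some i}. (y n, g n x) \<in> (case n of None \<Rightarrow> F | Some i \<Rightarrow> G)"
        by (rule near) (use i F(1) G(1) in \<open>auto simp: I'_def Z_def\<close>)
      then obtain s where s: "s \<in> S" "(y None, j s) \<in> F" "(y (Some i), a (f i s)) \<in> G"
        by (auto simp: g_def)
      have sX: "s \<in> points X" and fs: "f i s \<in> T"
        using s(1) i by (auto simp: S_def)
      have "(f i (k (y None)), f i (k (j s))) \<in> D" "(b (y (Some i)), b (a (f i s))) \<in> D"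
        using F(2) s(2) G(2) s(3) by blast+
      then have "(f i x, f i s) \<in> D" "(b (y (Some i)), f i s) \<in> D"
        using uiso_left[OF X'(2) sX] uiso_left[OF T'(2)] fs by (simp_all add: x_def)
      then show "(f i x, b (y (Some i))) \<in> E"
        using D(2,3) symD by fast
    qed
    have "x \<in> S"
      using x(1) fx bT by (simp add: S_def)
    moreover have "g n x = y n" if "n \<in> I'" for n
      using that x(2) fx uiso_right[OF T'(2) yT] by (auto simp: I'_def g_def)
    ultimately show "\<exists>x\<in>points (usub X S). \<forall>n\<in>I'. g n x = y n"
      by (intro bexI[of _ x]) simp_all
  qed
  then show ?thesis
    by (simp add: S_def)
qed

end

locale image_closed = prod_closed +
  assumes img: "closed_under_images epimorphism C"
begin

lemma realized_image:
  assumes X: "is_uspace X" and RX: "realized C X" and Y: "t2space Y" and sY: "sm (points Y)"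
    and f: "ucont X Y f" and dense: "dense_in Y (f ` points X)"
  shows "realized C Y"
proof -
  obtain X' j k where X': "X' \<in> C" "uiso X X' j k"
    using RX by (auto simp: realized_def)
  obtain Y' :: "'a uspace" and a b where Y': "Y' \<in> T2Unif" "uiso Y Y' a b"
    using ex_copy[OF Y sY] by blast
  let ?e = "restrict (\<lambda>x. a (f (k x))) (points X')"
  have e: "?e \<in> hom X' Y'"
    by (rule restrict_hom[OF C_uspace[OF X'(1)]
          ucont_comp[OF ucont_comp[OF uiso_ucont'[OF X'(2)] f] uiso_ucont[OF Y'(2)]]])
  have "dense_in Y' (?e ` points X')"
    unfolding dense_in_def
  proof (intro ballI)
    fix y E assume y: "y \<in> points Y'" and "E \<in> entourages Y'"
    then obtain D where D: "D \<in> entourages Y" "\<forall>x y. (x, y) \<in> D \<longrightarrow> (a x, a y) \<in> E"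
      using ucont_entD[OF uiso_ucont[OF Y'(2)]] by blast
    obtain x where x: "x \<in> points X" "(b y, f x) \<in> D"
      using dense D(1) ucontD[OF uiso_ucont'[OF Y'(2)] y] unfolding dense_in_def by blast
    have "(a (b y), a (f x)) \<in> E"
      using D(2) x(2) by blast
    then have "(y, ?e (j x)) \<in> E"
      using uiso_right[OF Y'(2) y] uiso_left[OF X'(2) x(1)] ucontD[OF uiso_ucont[OF X'(2)] x(1)] by simp
    then show "\<exists>s\<in>?e ` points X'. (y, s) \<in> E"
      using ucontD[OF uiso_ucont[OF X'(2)] x(1)] by blast
  qed
  then have "epimorphism X' Y' ?e"
    by (rule dense_epimorphism[OF Y'(1) e])
  then have "Y' \<in> C"
    using img X'(1) Y'(1) unfolding closed_under_images_def by blast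
  then show ?thesis
    unfolding realized_def using Y'(2) by blast
qed

end


section \<open>Coding points by nets\<close>

definition usym :: "'a uspace \<Rightarrow> ('a \<times> 'a) set set" where
  "usym X = {E \<in> entourages X. sym E}"

definition separated :: "('a \<times> 'a) set \<Rightarrow> 'a set \<Rightarrow> bool" where
  "separated E A \<longleftrightarrow> (\<forall>a\<in>A. \<forall>b\<in>A. a \<noteq> b \<longrightarrow> (a, b) \<notin> E)"

text \<open>
  A point \<open>z\<close> is coded by a family picking, for each symmetric entourage \<open>E\<close>, a point of a fixed
  \<open>E\<close>-net near \<open>z\<close>. With \<open>E O E\<close> in place of \<open>E\<close>, every limit of codes that has a limit point
  also satisfies the defining condition, and the condition on \<open>F\<close> makes it a closed one.
\<close>

definition ulim :: "'a uspace \<Rightarrow> (('a \<times> 'a) set \<Rightarrow> 'a) \<Rightarrow> 'a \<Rightarrow> bool" where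
  "ulim X f z \<longleftrightarrow> z \<in> points X \<and> (\<forall>E\<in>usym X. \<forall>F\<in>usym X. (f E, z) \<in> E O E O F)"

definition unet :: "'a uspace \<Rightarrow> (('a \<times> 'a) set \<Rightarrow> 'a set) \<Rightarrow> bool" where
  "unet X A \<longleftrightarrow> (\<forall>E\<in>usym X. A E \<subseteq> points X \<and> (\<forall>z\<in>points X. \<exists>a\<in>A E. (a, z) \<in> E))"

definition codes :: "'a uspace \<Rightarrow> (('a \<times> 'a) set \<Rightarrow> 'a set) \<Rightarrow> (('a \<times> 'a) set \<Rightarrow> 'a) uspace" where
  "codes X A = uproduct (usym X) (\<lambda>E. udisc (A E))"

definition conv :: "'a uspace \<Rightarrow> (('a \<times> 'a) set \<Rightarrow> 'a set) \<Rightarrow> (('a \<times> 'a) set \<Rightarrow> 'a) set" where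
  "conv X A = {f \<in> points (codes X A). \<exists>z. ulim X f z}"

lemma usym_ent: "E \<in> usym X \<Longrightarrow> E \<in> entourages X"
  by (simp add: usym_def)

lemma usym_sym: "E \<in> usym X \<Longrightarrow> (x, y) \<in> E \<Longrightarrow> (y, x) \<in> E"
  by (auto simp: usym_def dest: symD)

lemma usym_half:
  assumes "is_uspace X" "E \<in> entourages X"
  shows "\<exists>D\<in>usym X. D \<subseteq> E \<and> D O D \<subseteq> E"
  using ent_half_sym[OF assms] unfolding usym_def by blast

lemma usym_refl: "is_uspace X \<Longrightarrow> E \<in> usym X \<Longrightarrow> x \<in> points X \<Longrightarrow> (x, x) \<in> E"
  by (rule ent_refl[OF _ usym_ent])

lemma usym_sixth:
  assumes X: "is_uspace X" and G: "G \<in> entourages X"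
  shows "\<exists>E\<in>usym X. (E O E O E) O (E O E O E) \<subseteq> G"
proof -
  obtain D where D: "D \<in> usym X" "D O D \<subseteq> G"
    using usym_half[OF X G] by blast
  obtain E where E: "E \<in> entourages X" "sym E" "E O E O E \<subseteq> D"
    using ent_quarter_sym[OF X usym_ent[OF D(1)]] by blast
  have "(E O E O E) O (E O E O E) \<subseteq> D O D"
    by (rule relcomp_mono[OF E(3) E(3)])
  then have "(E O E O E) O (E O E O E) \<subseteq> G"
    using D(2) by (rule order_trans)
  then show ?thesis
    using E by (intro bexI[of _ E]) (simp_all add: usym_def)
qed

text \<open>The clause of \<open>ulim\<close> with F equal to E puts each limit within three E-steps
  of the common value \<open>f E\<close>, so limits of codes that agree in this one coordinate are
  six steps apart. Uniqueness of limits and uniform continuity of the limit map both follow from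
  this.\<close>

lemma ulim_near:
  assumes E: "E \<in> usym X" and fz: "ulim X f z" and gw: "ulim X g w" and eq: "f E = g E"
  shows "(z, w) \<in> (E O E O E) O (E O E O E)"
proof -
  have "(f E, z) \<in> E O E O E" "(f E, w) \<in> E O E O E"
    using fz gw E eq by (auto simp: ulim_def)
  then obtain a b where "(f E, a) \<in> E" "(a, b) \<in> E" "(b, z) \<in> E"
    by blast
  then have "(z, b) \<in> E" "(b, a) \<in> E" "(a, f E) \<in> E"
    using usym_sym[OF E] by blast+
  then have "(z, f E) \<in> E O E O E"
    by blast
  then show ?thesis
    using \<open>(f E, w) \<in> E O E O E\<close> by (rule relcompI)
qed

lemma ulim_unique:
  assumes X: "t2space X" and "ulim X f z" "ulim X f w"
  shows "z = w"
proof (rule t2spaceD[OF X])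
  show "z \<in> points X" "w \<in> points X"
    using assms by (simp_all add: ulim_def)
  fix G assume "G \<in> entourages X"
  then obtain E where E: "E \<in> usym X" "(E O E O E) O (E O E O E) \<subseteq> G"
    using usym_sixth[OF t2space_uspace[OF X]] by blast
  then show "(z, w) \<in> G"
    using ulim_near[OF E(1) assms(2,3) refl] by blast
qed

lemma is_uspace_codes: "is_uspace (codes X A)"
  unfolding codes_def by (rule is_uspace_uproduct) (rule is_uspace_udisc)

lemma conv_points: "conv X A \<subseteq> points (codes X A)"
  by (auto simp: conv_def)

lemma points_codes: "points (codes X A) = PiE (usym X) A"
  by (simp add: codes_def)

lemma ex_code:
  assumes X: "is_uspace X" and A: "unet X A" and z: "z \<in> points X"
  shows "\<exists>f\<in>conv X A. ulim X f z"
proof -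
  have "\<forall>E\<in>usym X. \<exists>a. a \<in> A E \<and> (a, z) \<in> E"
    using A z unfolding unet_def by blast
  then obtain a where a: "\<And>E. E \<in> usym X \<Longrightarrow> a E \<in> A E \<and> (a E, z) \<in> E"
    unfolding bchoice_iff by blast
  let ?f = "restrict a (usym X)"
  have "(?f E, z) \<in> E O E O F" if E: "E \<in> usym X" and F: "F \<in> usym X" for E F
  proof -
    have "a E \<in> points X"
      using a[OF E] A E unfolding unet_def by blast
    then have "(a E, a E) \<in> E" "(a E, z) \<in> E" "(z, z) \<in> F"
      using a[OF E] usym_refl[OF X E] usym_refl[OF X F z] by blast+
    then show ?thesis
      using E by auto
  qed
  then have "ulim X ?f z"
    using z by (simp add: ulim_def)
  moreover have "?f \<in> points (codes X A)"
    using a by (simp add: points_codes)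
  ultimately show ?thesis
    unfolding conv_def by blast
qed

text \<open>In a product of discrete spaces, closeness means agreement at finitely many coordinates;
  this lemma and the next are the two directions.\<close>

lemma agree_entourage:
  assumes "finite J" "J \<subseteq> I"
  shows "\<exists>D\<in>entourages (uproduct I (\<lambda>i. udisc (A i))). \<forall>f g. (f, g) \<in> D \<longrightarrow> (\<forall>i\<in>J. f i = g i)"
proof (rule bexI)
  let ?D = "init_ent (PiE I (\<lambda>i. points (udisc (A i)))) J (\<lambda>i x. x i) (\<lambda>i. Id_on (A i))"
  show "?D \<in> entourages (uproduct I (\<lambda>i. udisc (A i)))"
    unfolding uproduct_def using assms by (intro init_ent_entourage Id_on_entourage)
  show "\<forall>f g. (f, g) \<in> ?D \<longrightarrow> (\<forall>i\<in>J. f i = g i)"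
    by (auto simp: init_ent_def)
qed

lemma entourage_agree:
  assumes "D \<in> entourages (uproduct I (\<lambda>i. udisc (A i)))"
  shows "\<exists>J. finite J \<and> J \<subseteq> I \<and> (\<forall>f\<in>PiE I A. \<forall>g\<in>PiE I A. (\<forall>i\<in>J. f i = g i) \<longrightarrow> (f, g) \<in> D)"
proof -
  obtain J F where J: "finite J" "J \<subseteq> I" "\<forall>i\<in>J. F i \<in> entourages (udisc (A i))"
    "init_ent (points (uproduct I (\<lambda>i. udisc (A i)))) J (\<lambda>i x. x i) F \<subseteq> D"
    by (rule initial_forE[OF initial_for_uproduct assms])
  have "(f, g) \<in> D" if fg: "f \<in> PiE I A" "g \<in> PiE I A" "\<forall>i\<in>J. f i = g i" for f g
  proof -
    have "(f i, g i) \<in> F i" if i: "i \<in> J" for i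
    proof -
      have "f i \<in> A i"
        using fg(1) J(2) i by blast
      then have "(f i, f i) \<in> F i"
        using J(3) i by (auto simp: udisc_def)
      then show ?thesis
        using fg(3) i by simp
    qed
    then have "(f, g) \<in> init_ent (points (uproduct I (\<lambda>i. udisc (A i)))) J (\<lambda>i x. x i) F"
      using fg by (simp add: init_ent_def)
    then show ?thesis
      using J(4) by blast
  qed
  then show ?thesis
    using J(1,2) by (intro exI[of _ J] conjI ballI impI) simp_all
qed

definition ulimit :: "'a uspace \<Rightarrow> (('a \<times> 'a) set \<Rightarrow> 'a) \<Rightarrow> 'a" where
  "ulimit X f = (SOME z. ulim X f z)"

lemma ulim_ulimit: "f \<in> conv X A \<Longrightarrow> ulim X f (ulimit X f)"
  unfolding conv_def ulimit_def by (blast intro: someI)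

lemma ucont_ulimit:
  assumes X: "is_uspace X"
  shows "ucont (usub (codes X A) (conv X A)) X (ulimit X)"
proof (rule ucontI)
  show "ulimit X f \<in> points X" if "f \<in> points (usub (codes X A) (conv X A))" for f
    using ulim_ulimit[of f X A] that by (simp add: ulim_def)
  fix G assume "G \<in> entourages X"
  then obtain E where E: "E \<in> usym X" "(E O E O E) O (E O E O E) \<subseteq> G"
    using usym_sixth[OF X] by blast
  obtain D where D: "D \<in> entourages (codes X A)" "\<forall>f g. (f, g) \<in> D \<longrightarrow> (\<forall>i\<in>{E}. f i = g i)"
    using agree_entourage[of "{E}" "usym X" A] E(1) unfolding codes_def by blast
  have "(ulimit X f, ulimit X g) \<in> G" if fg: "(f, g) \<in> D \<inter> conv X A \<times> conv X A" for f g
  proof -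
    have "ulim X f (ulimit X f)" "ulim X g (ulimit X g)" "f E = g E"
      using fg D(2) ulim_ulimit[of f X A] ulim_ulimit[of g X A] by auto
    then show ?thesis
      using ulim_near[OF E(1)] E(2) by blast
  qed
  then show "\<exists>D\<in>entourages (usub (codes X A) (conv X A)). \<forall>f g. (f, g) \<in> D \<longrightarrow> (ulimit X f, ulimit X g) \<in> G"
    using D(1) by (intro bexI[of _ "D \<inter> conv X A \<times> conv X A"]) (auto simp: entourages_usub)
qed

lemma ulimit_surj:
  assumes X: "t2space X" and A: "unet X A"
  shows "ulimit X ` conv X A = points X"
proof (intro subset_antisym subsetI)
  fix z assume "z \<in> points X"
  then obtain f where f: "f \<in> conv X A" "ulim X f z"
    using ex_code[OF t2space_uspace[OF X] A] by blast
  have "ulimit X f = z"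
    by (rule ulim_unique[OF X ulim_ulimit[OF f(1)] f(2)])
  then show "z \<in> ulimit X ` conv X A"
    using f(1) by blast
qed (use ulim_ulimit in \<open>auto simp: ulim_def\<close>)

text \<open>With \<open>R = E O E\<close> and \<open>a = f E\<close>, the clauses of
  \<open>ulim\<close> for a fixed E say that z lies in the closure of a ball. Having a limit thus
  becomes nonemptiness of an intersection of closed sets, to which compactness applies.\<close>

lemma ulim_closure:
  assumes X: "is_uspace X"
  shows "(\<forall>F\<in>usym X. (a, z) \<in> R O F) \<and> z \<in> points X \<longleftrightarrow> z \<in> utopology X closure_of (R `` {a})"
    (is "?l \<longleftrightarrow> ?r")
proof
  assume l: ?l
  show ?r
    unfolding in_utopology_closure_of[OF X]
  proof (intro conjI ballI)
    show "z \<in> points X"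
      using l by blast
    fix E assume "E \<in> entourages X"
    then obtain F where F: "F \<in> usym X" "F \<subseteq> E"
      using usym_half[OF X] by blast
    then obtain y where "(a, y) \<in> R" "(y, z) \<in> F"
      using l by blast
    then show "\<exists>s\<in>R `` {a}. (z, s) \<in> E"
      using F usym_sym[OF F(1)] by blast
  qed
next
  assume r: ?r
  show ?l
  proof (intro conjI ballI)
    show "z \<in> points X"
      using r in_utopology_closure_of[OF X] by blast
    fix F assume F: "F \<in> usym X"
    then obtain s where "s \<in> R `` {a}" "(z, s) \<in> F"
      using r[unfolded in_utopology_closure_of[OF X], THEN conjunct2, rule_format, OF usym_ent[OF F]] by blast
    then show "(a, z) \<in> R O F"
      using usym_sym[OF F] by blast
  qed
qed

lemma usym_nonempty: "is_uspace X \<Longrightarrow> usym X \<noteq> {}"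
  using usym_half ent_top by blast

text \<open>A code f in the closure agrees at any finitely many coordinates with a convergent code,
  whose limit lies in the corresponding sets \<open>Cl E\<close>. These closed sets therefore have
  the finite intersection property, and a common point is a limit of f.\<close>

lemma closedin_conv:
  assumes X: "is_uspace X" and comp: "compact_space (utopology X)"
  shows "closedin (utopology (codes X A)) (conv X A)"
  unfolding closedin_utopology[OF is_uspace_codes]
proof (intro conjI conv_points ballI impI)
  fix f assume f: "f \<in> points (codes X A)"
    and near: "\<forall>D\<in>entourages (codes X A). \<exists>g\<in>conv X A. (f, g) \<in> D"
  define Cl where "Cl E = utopology X closure_of ((E O E) `` {f E})" for E
  have "\<Inter>\<F> \<noteq> {}" if F: "finite \<F> \<and> \<F> \<subseteq> Cl ` usym X" for \<F>
  proof -
    obtain J where J: "J \<subseteq> usym X" "finite J" "\<F> = Cl ` J"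
      using F finite_subset_image[of \<F> Cl "usym X"] by blast
    obtain D where D: "D \<in> entourages (codes X A)" "\<forall>f g. (f, g) \<in> D \<longrightarrow> (\<forall>i\<in>J. f i = g i)"
      using agree_entourage[OF J(2,1), of A] unfolding codes_def by blast
    obtain g where g: "g \<in> conv X A" "(f, g) \<in> D"
      using near D(1) by blast
    then obtain z where z: "ulim X g z"
      by (auto simp: conv_def)
    have "z \<in> Cl E" if E: "E \<in> J" for E
    proof -
      have "f E = g E"
        using D(2) g(2) E by blast
      moreover have "E \<in> usym X"
        using E J(1) by blast
      ultimately have "(\<forall>F\<in>usym X. (f E, z) \<in> (E O E) O F) \<and> z \<in> points X"
        using z by (simp add: ulim_def O_assoc)
      then show ?thesis
        unfolding Cl_def ulim_closure[OF X] .
    qed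
    then show ?thesis
      unfolding J(3) by blast
  qed
  moreover have "\<forall>S\<in>Cl ` usym X. closedin (utopology X) S"
    by (simp add: Cl_def)
  ultimately have "\<Inter>(Cl ` usym X) \<noteq> {}"
    using comp[unfolded compact_space_fip, rule_format, of "Cl ` usym X"] by blast
  then obtain z where z: "\<And>E. E \<in> usym X \<Longrightarrow> z \<in> Cl E"
    by blast
  have lim: "(\<forall>F\<in>usym X. (f E, z) \<in> (E O E) O F) \<and> z \<in> points X" if "E \<in> usym X" for E
    using z[OF that] unfolding Cl_def ulim_closure[OF X] .
  have "ulim X f z"
    unfolding ulim_def using lim usym_nonempty[OF X] by (auto simp: O_assoc)
  then show "f \<in> conv X A"
    using f by (auto simp: conv_def)
qed

section \<open>Compactness of products and of code spaces\<close>

lemma ex_open_nbhd: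
  assumes X: "is_uspace X" and E: "E \<in> entourages X" and x: "x \<in> points X"
  shows "\<exists>V. openin (utopology X) V \<and> x \<in> V \<and> V \<subseteq> E `` {x}"
proof -
  define V where "V = topspace (utopology X) - utopology X closure_of (points X - E `` {x})"
  have "openin (utopology X) V"
    by (simp add: V_def openin_diff)
  moreover have "x \<in> V"
    using E x by (auto simp: V_def in_utopology_closure_of[OF X] topspace_utopology[OF X])
  moreover have "V \<subseteq> E `` {x}"
    using closure_of_subset[of "points X - E `` {x}" "utopology X"]
    by (auto simp: V_def topspace_utopology[OF X])
  ultimately show ?thesis
    by blast
qed

text \<open>This is the half of the comparison that transfers compactness: the identity is
  continuous from the product topology, so the theorem of Tychonoff carries over to the uniform
  product.\<close>

lemma uproduct_topology:
  assumes Y: "\<And>i. i \<in> I \<Longrightarrow> is_uspace (Y i)"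
  shows "continuous_map (product_topology (\<lambda>i. utopology (Y i)) I) (utopology (uproduct I Y)) (\<lambda>x. x)"
    and "topspace (product_topology (\<lambda>i. utopology (Y i)) I) = topspace (utopology (uproduct I Y))"
proof -
  let ?T = "product_topology (\<lambda>i. utopology (Y i)) I" and ?P = "uproduct I Y"
  have uP: "is_uspace ?P"
    using Y by (rule is_uspace_uproduct)
  show top: "topspace ?T = topspace (utopology ?P)"
    using Y by (auto simp: topspace_utopology[OF uP] topspace_product_topology topspace_utopology intro!: PiE_cong)
  have "openin ?T S" if S: "openin (utopology ?P) S" for S
    unfolding openin_product_topology_alt
  proof
    fix x assume x: "x \<in> S"
    obtain E where E: "E \<in> entourages ?P" "E `` {x} \<subseteq> S"
      using S x unfolding openin_utopology[OF uP] by blast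
    have xP: "x \<in> points ?P"
      using S x unfolding openin_utopology[OF uP] by blast
    obtain J F where J: "finite J" "J \<subseteq> I" "\<forall>i\<in>J. F i \<in> entourages (Y i)"
      "init_ent (points ?P) J (\<lambda>i x. x i) F \<subseteq> E"
      by (rule initial_forE[OF initial_for_uproduct E(1)])
    have "\<forall>i\<in>J. \<exists>V. openin (utopology (Y i)) V \<and> x i \<in> V \<and> V \<subseteq> F i `` {x i}"
      using J(2,3) Y xP by (intro ballI ex_open_nbhd) auto
    then obtain V where V: "\<And>i. i \<in> J \<Longrightarrow> openin (utopology (Y i)) (V i) \<and> x i \<in> V i \<and> V i \<subseteq> F i `` {x i}"
      unfolding bchoice_iff by blast
    define W where "W i = (if i \<in> J then V i else topspace (utopology (Y i)))" for i
    have "finite {i \<in> I. W i \<noteq> topspace (utopology (Y i))}"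
      by (rule finite_subset[OF _ J(1)]) (auto simp: W_def)
    moreover have "\<forall>i\<in>I. openin (utopology (Y i)) (W i)"
      using V by (simp add: W_def)
    moreover have "x \<in> PiE I W"
      using xP V Y by (auto simp: W_def PiE_def topspace_utopology)
    moreover have "PiE I W \<subseteq> S"
    proof
      fix y assume y: "y \<in> PiE I W"
      have "y i \<in> points (Y i)" if "i \<in> I" for i
      proof -
        have "y i \<in> W i"
          using y that by blast
        moreover have "W i \<subseteq> points (Y i)"
          using openin_subset[of "utopology (Y i)" "W i"] V[of i] topspace_utopology[OF Y[OF that]]
          by (auto simp: W_def)
        ultimately show ?thesis
          by blast
      qed
      then have yP: "y \<in> points ?P"
        using y by (auto simp: PiE_def)
      have "(x i, y i) \<in> F i" if "i \<in> J" for i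
      proof -
        have "y i \<in> W i"
          using y J(2) that by blast
        then show ?thesis
          using V[OF that] that by (auto simp: W_def)
      qed
      then have "(x, y) \<in> init_ent (points ?P) J (\<lambda>i x. x i) F"
        using xP yP by (simp add: init_ent_def)
      then show "y \<in> S"
        using J(4) E(2) by blast
    qed
    ultimately show "\<exists>U. finite {i \<in> I. U i \<noteq> topspace (utopology (Y i))} \<and>
        (\<forall>i\<in>I. openin (utopology (Y i)) (U i)) \<and> x \<in> PiE I U \<and> PiE I U \<subseteq> S"
      by blast
  qed
  moreover have "{x \<in> topspace ?T. x \<in> S} = S" if "openin (utopology ?P) S" for S
    using openin_subset[OF that] top by blast
  ultimately show "continuous_map ?T (utopology ?P) (\<lambda>x. x)"
    unfolding continuous_map_def using top by simp
qed

lemma compact_uproduct: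
  assumes Y: "\<And>i. i \<in> I \<Longrightarrow> is_uspace (Y i)" and comp: "\<And>i. i \<in> I \<Longrightarrow> compact_space (utopology (Y i))"
  shows "compact_space (utopology (uproduct I Y))"
proof -
  let ?T = "product_topology (\<lambda>i. utopology (Y i)) I" and ?P = "uproduct I Y"
  have cont: "continuous_map ?T (utopology ?P) (\<lambda>x. x)" and top: "topspace ?T = topspace (utopology ?P)"
    using uproduct_topology[of I Y] Y by simp_all
  have "compact_space ?T"
    using comp by (simp add: compact_space_product_topology)
  then have "compactin (utopology ?P) ((\<lambda>x. x) ` topspace ?T)"
    using image_compactin[OF _ cont] unfolding compact_space_def by blast
  then show "compact_space (utopology ?P)"
    unfolding compact_space_def top[symmetric] by simp
qed

lemma finite_compact: "is_uspace X \<Longrightarrow> finite (points X) \<Longrightarrow> compact_space (utopology X)"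
  by (simp add: compact_space_def finite_imp_compactin topspace_utopology)

lemma ucont_compact_image:
  assumes "is_uspace X" "is_uspace Y" "ucont X Y f" "f ` points X = points Y" "compact_space (utopology X)"
  shows "compact_space (utopology Y)"
proof -
  have "compactin (utopology Y) (f ` topspace (utopology X))"
    using image_compactin[OF _ ucont_continuous_map[OF assms(1-3)]] assms(5) unfolding compact_space_def by blast
  then show ?thesis
    using assms by (simp add: compact_space_def topspace_utopology)
qed

lemma compact_usub:
  assumes "is_uspace X" "compact_space (utopology X)" "closedin (utopology X) S"
  shows "compact_space (utopology (usub X S))"
  using closedin_compact_space[OF assms(2,3)] closedin_points[OF assms(1,3)]
  by (simp add: utopology_usub[OF assms(1)] compact_space_subtopology)

text \<open>The space of codes is compact as a product of finite spaces, hence so is its closed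
  subset \<open>conv X A\<close>, which the limit map carries onto X. It is applied in
  contrapositive form, to find a limitless code in the closure of the convergent ones.\<close>

lemma compact_of_closed_conv:
  assumes X: "t2space X" and A: "unet X A" and fin: "\<And>E. E \<in> usym X \<Longrightarrow> finite (A E)"
    and closed: "closedin (utopology (codes X A)) (conv X A)"
  shows "compact_space (utopology X)"
proof -
  have "compact_space (utopology (codes X A))"
    unfolding codes_def using fin is_uspace_udisc
    by (intro compact_uproduct finite_compact) auto
  then have "compact_space (utopology (usub (codes X A) (conv X A)))"
    by (rule compact_usub[OF is_uspace_codes _ closed])
  then show ?thesis
    by (rule ucont_compact_image[OF is_uspace_usub[OF is_uspace_codes conv_points] t2space_uspace[OF X]
          ucont_ulimit[OF t2space_uspace[OF X]], rotated]) (simp add: ulimit_surj[OF X A])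
qed

text \<open>A maximal E-separated set is a net: a point E-related to none of its members could be
  added, by symmetry of E.\<close>

lemma ex_net:
  assumes X: "is_uspace X" and E: "E \<in> usym X"
  shows "\<exists>A. A \<subseteq> points X \<and> separated E A \<and> (\<forall>z\<in>points X. \<exists>a\<in>A. (a, z) \<in> E)"
proof -
  let ?A = "{A. A \<subseteq> points X \<and> separated E A}"
  have "\<exists>M\<in>?A. \<forall>B\<in>?A. M \<subseteq> B \<longrightarrow> B = M"
  proof (rule subset_Zorn)
    fix K assume K: "subset.chain ?A K"
    have "\<Union>K \<in> ?A"
      unfolding mem_Collect_eq separated_def
    proof (intro conjI ballI impI)
      show "\<Union>K \<subseteq> points X"
        using K by (auto simp: subset.chain_def)
      fix a b assume ab: "a \<in> \<Union>K" "b \<in> \<Union>K" "a \<noteq> b"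
      then obtain S T where ST: "S \<in> K" "a \<in> S" "T \<in> K" "b \<in> T"
        by blast
      then have "S \<subseteq> T \<or> T \<subseteq> S"
        using K unfolding subset.chain_def by blast
      then obtain R where "R \<in> K" "a \<in> R" "b \<in> R"
        using ST by blast
      moreover have "separated E R"
        using K \<open>R \<in> K\<close> by (auto simp: subset.chain_def)
      ultimately show "(a, b) \<notin> E"
        using ab(3) by (simp add: separated_def)
    qed
    then show "\<exists>S\<in>?A. \<forall>B\<in>K. B \<subseteq> S"
      by (rule bexI[rotated]) (simp add: Union_upper)
  qed
  then obtain M where M: "M \<subseteq> points X" "separated E M"
    and max: "\<And>B. B \<subseteq> points X \<Longrightarrow> separated E B \<Longrightarrow> M \<subseteq> B \<Longrightarrow> B = M"
    by auto
  have "\<exists>a\<in>M. (a, z) \<in> E" if z: "z \<in> points X" for z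
  proof (rule ccontr)
    assume no: "\<not> (\<exists>a\<in>M. (a, z) \<in> E)"
    then have "separated E (insert z M)"
      using M(2) usym_sym[OF E] by (auto simp: separated_def)
    then have "insert z M = M"
      using max[of "insert z M"] M(1) z by blast
    then show False
      using no usym_refl[OF X E z] by blast
  qed
  then show ?thesis
    using M by blast
qed

lemma ex_unet:
  assumes X: "is_uspace X"
  shows "\<exists>A. unet X A \<and> (\<forall>E\<in>usym X. separated E (A E))"
proof -
  have "\<forall>E\<in>usym X. \<exists>A. A \<subseteq> points X \<and> separated E A \<and> (\<forall>z\<in>points X. \<exists>a\<in>A. (a, z) \<in> E)"
    using ex_net[OF X] by blast
  then obtain A where "\<forall>E\<in>usym X. A E \<subseteq> points X \<and> separated E (A E) \<and> (\<forall>z\<in>points X. \<exists>a\<in>A E. (a, z) \<in> E)"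
    unfolding bchoice_iff by blast
  then show ?thesis
    unfolding unet_def by blast
qed

text \<open>If \<open>D O D\<close> lies in E, points of A that are D-close to the same x coincide,
  so A cannot accumulate at a point outside A.\<close>

lemma separated_closedin:
  assumes X: "t2space X" and E: "E \<in> entourages X" and A: "A \<subseteq> points X" "separated E A"
  shows "closedin (utopology X) A"
  unfolding closedin_utopology[OF t2space_uspace[OF X]]
proof (intro conjI A(1) ballI impI)
  have uX: "is_uspace X"
    by (rule t2space_uspace[OF X])
  fix x assume x: "x \<in> points X" and near: "\<forall>E\<in>entourages X. \<exists>s\<in>A. (x, s) \<in> E"
  obtain D where D: "D \<in> usym X" "D O D \<subseteq> E"
    using usym_half[OF uX E] by blast
  obtain a where a: "a \<in> A" "(x, a) \<in> D"
    using near usym_ent[OF D(1)] by blast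
  have "x = a"
  proof (rule t2spaceD[OF X x])
    show "a \<in> points X"
      using a A by blast
    fix G assume G: "G \<in> entourages X"
    obtain b where b: "b \<in> A" "(x, b) \<in> G \<inter> D"
      using near ent_Int[OF uX G usym_ent[OF D(1)]] by blast
    then have "(a, b) \<in> E"
      using usym_sym[OF D(1) a(2)] D(2) by blast
    then have "a = b"
      using A(2) a(1) b(1) by (auto simp: separated_def)
    then show "(x, a) \<in> G"
      using b by blast
  qed
  then show "x \<in> A"
    using a by simp
qed

lemma separated_uiso_udisc:
  assumes X: "is_uspace X" and E: "E \<in> entourages X" and A: "A \<subseteq> points X" "separated E A"
  shows "uiso (usub X A) (udisc A) (\<lambda>x. x) (\<lambda>x. x)"
  unfolding uiso_def
proof (intro conjI ballI)
  show "ucont (udisc A) (usub X A) (\<lambda>x. x)"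
    by (rule ucont_udisc[OF is_uspace_usub[OF X A(1)]]) simp
  show "ucont (usub X A) (udisc A) (\<lambda>x. x)"
  proof (rule ucontI)
    fix F assume F: "F \<in> entourages (udisc A)"
    have "(x, y) \<in> F" if "(x, y) \<in> E \<inter> A \<times> A" for x y
    proof -
      have "x = y" "x \<in> A"
        using that A(2) by (auto simp: separated_def)
      then show ?thesis
        using F by (auto simp: udisc_def)
    qed
    then show "\<exists>E\<in>entourages (usub X A). \<forall>x y. (x, y) \<in> E \<longrightarrow> (x, y) \<in> F"
      using E by (intro bexI[of _ "E \<inter> A \<times> A"]) (auto simp: entourages_usub)
  qed simp
qed simp_all

lemma ucont_udisc_iff:
  assumes Z: "is_uspace Z"
  shows "ucont Z (udisc A) f \<longleftrightarrow> f ` points Z \<subseteq> A \<and> (\<exists>E\<in>entourages Z. \<forall>x y. (x, y) \<in> E \<longrightarrow> f x = f y)"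
proof
  assume f: "ucont Z (udisc A) f"
  obtain E where E: "E \<in> entourages Z" "\<forall>x y. (x, y) \<in> E \<longrightarrow> (f x, f y) \<in> Id_on A"
    using ucont_entD[OF f Id_on_entourage] by blast
  have "f x = f y" if "(x, y) \<in> E" for x y
    using E(2)[rule_format, OF that] by (simp add: Id_on_iff)
  with E(1) show "f ` points Z \<subseteq> A \<and> (\<exists>E\<in>entourages Z. \<forall>x y. (x, y) \<in> E \<longrightarrow> f x = f y)"
    using ucontD[OF f] by (intro conjI bexI[of _ E]) auto
next
  assume r: "f ` points Z \<subseteq> A \<and> (\<exists>E\<in>entourages Z. \<forall>x y. (x, y) \<in> E \<longrightarrow> f x = f y)"
  then obtain E where E: "E \<in> entourages Z" "\<forall>x y. (x, y) \<in> E \<longrightarrow> f x = f y"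
    by blast
  show "ucont Z (udisc A) f"
  proof (rule ucontI)
    fix F assume F: "F \<in> entourages (udisc A)"
    have "(f x, f y) \<in> F" if "(x, y) \<in> E" for x y
    proof -
      have "f x = f y" "x \<in> points Z"
        using E(2) that ent_sub[OF Z E(1)] by auto
      then have "f x \<in> A"
        using r by blast
      then show ?thesis
        using F \<open>f x = f y\<close> by (auto simp: udisc_def)
    qed
    then show "\<exists>E\<in>entourages Z. \<forall>x y. (x, y) \<in> E \<longrightarrow> (f x, f y) \<in> F"
      using E(1) by blast
  qed (use r in auto)
qed

lemma ucont_udisc_comp:
  assumes Z: "is_uspace Z" and f: "ucont Z (udisc A) f" and g: "g ` A \<subseteq> B"
  shows "ucont Z (udisc B) (\<lambda>z. g (f z))"
  by (rule ucont_comp[OF f ucont_udisc]) (use g is_uspace_udisc in auto)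

lemma ucont_disj:
  assumes Z: "is_uspace Z" and f: "ucont Z (udisc UNIV) f" and g: "ucont Z (udisc UNIV) g"
  shows "ucont Z (udisc UNIV) (\<lambda>z. f z \<or> g z)"
proof -
  obtain E where E: "E \<in> entourages Z" "\<forall>x y. (x, y) \<in> E \<longrightarrow> f x = f y"
    using f unfolding ucont_udisc_iff[OF Z] by blast
  obtain F where F: "F \<in> entourages Z" "\<forall>x y. (x, y) \<in> F \<longrightarrow> g x = g y"
    using g unfolding ucont_udisc_iff[OF Z] by blast
  have "(f x \<or> g x) = (f y \<or> g y)" if "(x, y) \<in> E \<inter> F" for x y
    using that E(2) F(2) by blast
  then show ?thesis
    unfolding ucont_udisc_iff[OF Z] using ent_Int[OF Z E(1) F(1)] by (intro conjI bexI[of _ "E \<inter> F"]) auto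
qed


section \<open>Classification\<close>

definition cube :: "'k set \<Rightarrow> ('k \<Rightarrow> bool) uspace" where
  "cube K = uproduct K (\<lambda>_. udisc UNIV)"

definition nonzero :: "'k set \<Rightarrow> ('k \<Rightarrow> bool) set" where
  "nonzero K = {x \<in> points (cube K). \<exists>k\<in>K. x k}"

lemma points_cube: "points (cube K) = extensional K"
  by (simp add: cube_def PiE_def)

lemma t2space_cube: "t2space (cube K)"
  unfolding cube_def by (rule t2space_uproduct) (rule t2space_udisc)

lemma is_uspace_cube: "is_uspace (cube K)"
  by (rule t2space_uspace[OF t2space_cube])

lemma nonzero_points: "nonzero K \<subseteq> points (cube K)"
  by (auto simp: nonzero_def)

lemma ucont_into_cube:
  assumes "is_uspace Z" "\<And>k. k \<in> K \<Longrightarrow> ucont Z (udisc UNIV) (\<lambda>z. g z k)"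
    "\<And>z. z \<in> points Z \<Longrightarrow> g z \<in> extensional K"
  shows "ucont Z (cube K) g"
  unfolding cube_def using assms by (rule ucont_into_uproduct)

lemma uiso_udisc: "bij_betw j A B \<Longrightarrow> uiso (udisc A) (udisc B) j (inv_into A j)"
  unfolding uiso_def
  by (auto simp: bij_betw_def inv_into_into f_inv_into_f intro!: ucont_udisc is_uspace_udisc)

text \<open>Compactness yields a finite cover by open sets inside D-balls, and with
  \<open>D O D\<close> inside E each of them contains at most one point of A.\<close>

lemma compact_separated_finite:
  assumes X: "is_uspace X" and comp: "compact_space (utopology X)" and E: "E \<in> entourages X"
    and A: "A \<subseteq> points X" "separated E A"
  shows "finite A"
proof -
  obtain D where D: "D \<in> usym X" "D O D \<subseteq> E"
    using usym_half[OF X E] by blast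
  define \<V> where "\<V> = {V. openin (utopology X) V \<and> (\<exists>x\<in>points X. V \<subseteq> D `` {x})}"
  have "topspace (utopology X) \<subseteq> \<Union>\<V>"
  proof
    fix x assume "x \<in> topspace (utopology X)"
    then have x: "x \<in> points X"
      by (simp add: topspace_utopology[OF X])
    obtain V where "openin (utopology X) V" "x \<in> V" "V \<subseteq> D `` {x}"
      using ex_open_nbhd[OF X usym_ent[OF D(1)] x] by blast
    then show "x \<in> \<Union>\<V>"
      using x by (auto simp: \<V>_def)
  qed
  then obtain \<F> where F: "finite \<F>" "\<F> \<subseteq> \<V>" "topspace (utopology X) \<subseteq> \<Union>\<F>"
    using comp[unfolded compact_space_alt, rule_format, of \<V>] by (auto simp: \<V>_def)
  have "finite (A \<inter> V)" if "V \<in> \<F>" for V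
  proof -
    have "V \<in> \<V>"
      using that F(2) by blast
    then obtain x where x: "V \<subseteq> D `` {x}"
      unfolding \<V>_def by blast
    have "a = b" if ab: "a \<in> A \<inter> V" "b \<in> A \<inter> V" for a b
    proof (rule ccontr)
      assume "a \<noteq> b"
      have "(x, a) \<in> D" "(x, b) \<in> D"
        using ab x by auto
      then have "(a, b) \<in> E"
        using usym_sym[OF D(1)] D(2) by blast
      then show False
        using ab \<open>a \<noteq> b\<close> A(2) by (simp add: separated_def)
    qed
    then have "A \<inter> V = {} \<or> (\<exists>a. A \<inter> V = {a})"
      by blast
    then show ?thesis
      by auto
  qed
  then have "finite (\<Union>V\<in>\<F>. A \<inter> V)"
    using F(1) by blast
  moreover have "A \<subseteq> (\<Union>V\<in>\<F>. A \<inter> V)"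
    using A(1) F(3) topspace_utopology[OF X] by blast
  ultimately show ?thesis
    by (rule finite_subset[rotated])
qed

text \<open>For infinite \<open>l\<close> this expresses covering character at most
  \<open>l\<close>, through separated sets instead of covers. It is the form that matches the
  discrete subspaces and the nets of the classification.\<close>

definition separated_below :: "'a uspace \<Rightarrow> 'u rel \<Rightarrow> bool" where
  "separated_below X l \<longleftrightarrow> (\<forall>E\<in>entourages X. \<forall>A. A \<subseteq> points X \<and> separated E A \<longrightarrow> |A| <o l)"

context prod_closed
begin

lemma realized_separated:
  assumes Z: "Z \<in> C" and E: "E \<in> entourages Z" and A: "A \<subseteq> points Z" "separated E A"
  shows "realized C (udisc A)"
  using realized_uiso[OF C_realized[OF usub_C[OF Z separated_closedin[OF T2Unif_t2space[OF C_T2Unif[OF Z]] E A]]]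
      separated_uiso_udisc[OF C_uspace[OF Z] E A]] .

lemma realized_udisc_ordLeq:
  assumes A: "realized C (udisc A)" and B: "|B| \<le>o |A|"
  shows "realized C (udisc B)"
proof -
  obtain j where j: "inj_on j B" "j ` B \<subseteq> A"
    using B card_of_ordLeq[of B A] by blast
  have sep: "separated (Id_on A) (j ` B)"
    by (auto simp: separated_def Id_on_iff)
  have "realized C (usub (udisc A) (j ` B))"
    using realized_usub[OF is_uspace_udisc A separated_closedin[OF t2space_udisc Id_on_entourage _ sep]] j(2) by simp
  then have "realized C (udisc (j ` B))"
    by (rule realized_uiso[OF _ separated_uiso_udisc[OF is_uspace_udisc Id_on_entourage _ sep]]) (simp add: j(2))
  moreover have "bij_betw j B (j ` B)"
    using j(1) by (simp add: bij_betw_def)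
  ultimately show ?thesis
    using realized_uiso[OF _ uiso_sym[OF uiso_udisc]] by blast
qed

lemma realized_bool:
  assumes X: "X \<in> C" and ab: "a \<in> points X" "b \<in> points X" "a \<noteq> b"
  shows "realized C (udisc (UNIV :: bool set))"
proof -
  obtain E where E: "E \<in> entourages X" "(a, b) \<notin> E"
    using t2spaceD[OF T2Unif_t2space[OF C_T2Unif[OF X]] ab(1,2)] ab(3) by blast
  obtain D where D: "D \<in> usym X" "D \<subseteq> E"
    using usym_half[OF C_uspace[OF X] E(1)] by blast
  have "(a, b) \<notin> D" "(b, a) \<notin> D"
    using D(2) E(2) usym_sym[OF D(1)] by blast+
  then have "separated D {a, b}"
    by (auto simp: separated_def)
  then have "realized C (udisc {a, b})"
    using realized_separated[OF X usym_ent[OF D(1)]] ab by simp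
  moreover have "bij_betw (\<lambda>x. x = a) {a, b} UNIV"
    using ab(3) by (auto simp: bij_betw_def inj_on_def UNIV_bool)
  ultimately show ?thesis
    using realized_uiso uiso_udisc by blast
qed

text \<open>The indicators of the points embed A into a finite power of the two-point space. The
  finite set of coordinates may be taken to be all of A, which makes the image closed.\<close>

lemma realized_finite:
  fixes A :: "'c set"
  assumes two: "realized C (udisc (UNIV :: bool set))" and A: "finite A"
  shows "realized C (udisc A)"
proof (rule realized_initial[where I = A and f = "\<lambda>a x. x = a" and Y = "\<lambda>_. udisc UNIV"])
  show "initial_for (udisc A) A (\<lambda>a x. x = a) (\<lambda>_. udisc UNIV)"
    unfolding initial_for_def
  proof (intro conjI ballI)
    show "ucont (udisc A) (udisc UNIV) (\<lambda>x. x = a)" for a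
      by (rule ucont_udisc[OF is_uspace_udisc]) simp
    fix E assume E: "E \<in> entourages (udisc A)"
    have "init_ent A A (\<lambda>a x. x = a) (\<lambda>_. Id_on UNIV) \<subseteq> Id_on A"
      by (auto simp: init_ent_def Id_on_iff)
    also have "\<dots> \<subseteq> E"
      using E by (simp add: udisc_def)
    finally show "\<exists>J F. finite J \<and> J \<subseteq> A \<and> (\<forall>i\<in>J. F i \<in> entourages (udisc UNIV)) \<and>
        init_ent (points (udisc A)) J (\<lambda>a x. x = a) F \<subseteq> E"
      using A by (intro exI[of _ A] exI[of _ "\<lambda>_. Id_on UNIV"]) (simp add: Id_on_entourage)
  qed
  fix y :: "'c \<Rightarrow> bool"
  assume near: "\<And>J F. \<lbrakk>finite J; J \<subseteq> A; \<And>i. i \<in> J \<Longrightarrow> F i \<in> entourages (udisc UNIV)\<rbrakk> \<Longrightarrow>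
         \<exists>x\<in>points (udisc A). \<forall>i\<in>J. (y i, x = i) \<in> F i"
  show "\<exists>x\<in>points (udisc A). \<forall>i\<in>A. (x = i) = y i"
    using near[of A "\<lambda>_. Id_on UNIV"] A by (auto simp: Id_on_iff Id_on_entourage)
qed (use two A sm_finite t2space_udisc in auto)

lemma realized_cube:
  assumes "realized C (udisc (UNIV :: bool set))" "sm K"
  shows "realized C (cube K)"
  unfolding cube_def by (rule realized_uproduct[OF assms(2,1) is_uspace_udisc])

lemma sm_cube:
  assumes "sm K"
  shows "sm (points (cube K))"
  unfolding cube_def points_uproduct
  by (rule sm_PiE[OF assms]) (simp add: sm_finite)

end

section \<open>Membership through codes: compact spaces, punctured cubes, noncompact members\<close>

context image_closed
begin

text \<open>The limit map is onto, so membership of X is reduced to membership of its space of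
  convergent codes.\<close>

lemma limits_C:
  assumes X: "X \<in> T2Unif" and A: "unet X A" and R: "realized C (usub (codes X A) (conv X A))"
  shows "X \<in> C"
proof -
  have uX: "is_uspace X" and tX: "t2space X" and sX: "sm (points X)"
    using X T2Unif_uspace T2Unif_t2space T2Unif_sm by blast+
  have "dense_in X (ulimit X ` points (usub (codes X A) (conv X A)))"
    by (rule surj_dense_in[OF uX]) (simp add: ulimit_surj[OF tX A])
  then have "realized C X"
    by (rule realized_image[OF is_uspace_usub[OF is_uspace_codes conv_points] R tX sX ucont_ulimit[OF uX]])
  then show ?thesis
    using realized_C X by blast
qed

lemma compact_C:
  assumes two: "realized C (udisc (UNIV :: bool set))" and X: "X \<in> T2Unif"
    and comp: "compact_space (utopology X)"
  shows "X \<in> C"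
proof -
  have uX: "is_uspace X" and sX: "sm (points X)"
    using X T2Unif_uspace T2Unif_sm by blast+
  obtain A where A: "unet X A" "\<forall>E\<in>usym X. separated E (A E)"
    using ex_unet[OF uX] by blast
  have "finite (A E)" if "E \<in> usym X" for E
    using compact_separated_finite[OF uX comp usym_ent[OF that]] A that by (simp add: unet_def)
  then have RA: "realized C (udisc (A E))" if "E \<in> usym X" for E
    using realized_finite[OF two] that by blast
  have "sm (usym X)"
    using sm_subset[OF sm_entourages[OF uX sX]] by (simp add: usym_def)
  then have "realized C (codes X A)"
    unfolding codes_def using RA is_uspace_udisc by (rule realized_uproduct)
  then have "realized C (usub (codes X A) (conv X A))"
    by (rule realized_usub[OF is_uspace_codes _ closedin_conv[OF uX comp]])
  then show ?thesis
    by (rule limits_C[OF X A(1)])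
qed

text \<open>
  A map \<open>\<phi>\<close> into a cube that avoids \<open>0\<close> but has \<open>0\<close> in the closure of its image
  puts every cube punctured at \<open>0\<close> into the class: \<open>(w, x) \<mapsto> \<phi> w \<or> x\<close> avoids \<open>0\<close> and has dense image.
\<close>

lemma realized_nonzero:
  fixes W :: "'w uspace" and M :: "'m set" and S :: "'s set"
  assumes two: "realized C (udisc (UNIV :: bool set))" and W: "is_uspace W" and RW: "realized C W"
    and \<phi>: "\<And>m. m \<in> M \<Longrightarrow> ucont W (udisc UNIV) (\<lambda>w. \<phi> w m)"
    and nz: "\<And>w. w \<in> points W \<Longrightarrow> \<exists>m\<in>M. \<phi> w m"
    and near: "\<And>J. finite J \<Longrightarrow> J \<subseteq> M \<Longrightarrow> \<exists>w\<in>points W. \<forall>m\<in>J. \<not> \<phi> w m"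
    and sM: "sm M" and sS: "sm S"
  shows "realized C (usub (cube (S <+> M)) (nonzero (S <+> M)))"
proof -
  let ?K = "S <+> M"
  have sK: "sm ?K"
    unfolding Plus_def using sM sS by (intro sm_Un sm_image)
  obtain W' a b where W': "W' \<in> C" "uiso W W' a b"
    using RW by (auto simp: realized_def)
  obtain Q c d where Q: "Q \<in> C" "uiso (cube ?K) Q c d"
    using realized_cube[OF two sK] by (auto simp: realized_def)
  define V where "V = uproduct (UNIV :: bool set) (\<lambda>t. if t then W' else Q)"
  have VC: "(if t then W' else Q) \<in> C" for t
    using W'(1) Q(1) by simp
  have RV: "realized C V"
    unfolding V_def by (rule realized_uproduct_C[OF sm_finite VC]) simp
  have uV: "is_uspace V"
    unfolding V_def by (rule is_uspace_uproduct) (rule C_uspace[OF VC])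
  have ev: "ucont V W' (\<lambda>v. v True)" "ucont V Q (\<lambda>v. v False)"
    using ucont_proj[of True UNIV "\<lambda>t. if t then W' else Q"] ucont_proj[of False UNIV "\<lambda>t. if t then W' else Q"]
    by (simp_all add: V_def)
  \<comment> \<open>The coordinates in S only enlarge the cube to the index set wanted later; \<phi>
    is extended to them by \<open>False\<close>.\<close>
  define \<psi> where "\<psi> w k = (case k of Inl s \<Rightarrow> False | Inr m \<Rightarrow> \<phi> w m)" for w and k :: "'s + 'm"
  define g where "g v = (\<lambda>k\<in>?K. \<psi> (b (v True)) k \<or> d (v False) k)" for v
  have bW: "ucont V W (\<lambda>v. b (v True))"
    by (rule ucont_comp[OF ev(1) uiso_ucont'[OF W'(2)]])
  have dQ: "ucont V (cube ?K) (\<lambda>v. d (v False))"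
    by (rule ucont_comp[OF ev(2) uiso_ucont'[OF Q(2)]])
  have \<psi>: "ucont V (udisc UNIV) (\<lambda>v. \<psi> (b (v True)) k)" if k: "k \<in> ?K" for k
  proof (cases k)
    case (Inl s)
    then show ?thesis
      unfolding ucont_udisc_iff[OF uV] \<psi>_def using ent_top[OF uV] by auto
  next
    case (Inr m)
    then have "m \<in> M"
      using k by auto
    then show ?thesis
      using ucont_comp[OF bW \<phi>] Inr by (simp add: \<psi>_def)
  qed
  have gK: "ucont V (cube ?K) g"
  proof (rule ucont_into_cube[OF uV])
    fix k assume k: "k \<in> ?K"
    have "ucont V (udisc UNIV) (\<lambda>v. d (v False) k)"
      using ucont_comp[OF dQ] ucont_proj[OF k, of "\<lambda>_. udisc UNIV"] unfolding cube_def by blast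
    then have "ucont V (udisc UNIV) (\<lambda>v. \<psi> (b (v True)) k \<or> d (v False) k)"
      by (rule ucont_disj[OF uV \<psi>[OF k]])
    then show "ucont V (udisc UNIV) (\<lambda>v. g v k)"
      using k by (simp add: g_def)
  qed (simp add: g_def)
  have "g ` points V \<subseteq> nonzero ?K"
  proof
    fix x assume "x \<in> g ` points V"
    then obtain v where v: "v \<in> points V" "x = g v"
      by blast
    obtain m where m: "m \<in> M" "\<phi> (b (v True)) m"
      using nz[OF ucontD[OF bW v(1)]] by blast
    then have "Inr m \<in> ?K" "g v (Inr m)"
      by (auto simp: g_def \<psi>_def)
    then show "x \<in> nonzero ?K"
      using ucontD[OF gK v(1)] v(2) by (auto simp: nonzero_def)
  qed
  then have g: "ucont V (usub (cube ?K) (nonzero ?K)) g"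
    by (rule ucont_into_usub[OF uV gK])
  have "dense_in (usub (cube ?K) (nonzero ?K)) (g ` points V)"
    unfolding dense_in_def points_usub
  proof (intro ballI)
    fix y E assume y: "y \<in> nonzero ?K" and "E \<in> entourages (usub (cube ?K) (nonzero ?K))"
    then obtain D where D: "D \<in> entourages (cube ?K)" "E = D \<inter> nonzero ?K \<times> nonzero ?K"
      by (auto simp: entourages_usub)
    have yK: "y \<in> points (cube ?K)"
      using y nonzero_points by blast
    \<comment> \<open>Only the coordinates in J matter. With \<phi> zero on the M-part of J and y as
      cube component, the disjunction equals y on J, while another coordinate of \<phi> keeps it
      away from 0.\<close>
    obtain J where J: "finite J" "J \<subseteq> ?K"
      "\<forall>f\<in>PiE ?K (\<lambda>_. UNIV). \<forall>h\<in>PiE ?K (\<lambda>_. UNIV). (\<forall>i\<in>J. f i = h i) \<longrightarrow> (f, h) \<in> D"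
      using entourage_agree[OF D(1)[unfolded cube_def]] by (elim exE conjE) (rule that)
    have "finite (Inr -` J :: 'm set)" "Inr -` J \<subseteq> M"
      using J(1,2) by (auto intro: finite_vimageI)
    then obtain w where w: "w \<in> points W" "\<forall>m\<in>Inr -` J. \<not> \<phi> w m"
      using near by blast
    define v where "v t = (if t then a w else c y)" for t :: bool
    have v: "v \<in> points V"
      using ucontD[OF uiso_ucont[OF W'(2)] w(1)] ucontD[OF uiso_ucont[OF Q(2)] yK] by (auto simp: V_def v_def)
    have "g v k = y k" if "k \<in> J" for k
    proof -
      have "\<not> \<psi> w k"
        using that w(2) by (auto simp: \<psi>_def split: sum.splits)
      then show ?thesis
        using that J(2) uiso_left[OF W'(2) w(1)] uiso_left[OF Q(2) yK] by (auto simp: g_def v_def)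
    qed
    then have "(y, g v) \<in> D"
      using J(3) yK ucontD[OF gK v] unfolding cube_def points_uproduct points_udisc by simp
    moreover have "g v \<in> nonzero ?K"
      using ucontD[OF g v] by simp
    ultimately show "\<exists>s\<in>g ` points V. (y, s) \<in> E"
      using y v D(2) by blast
  qed
  moreover have "sm (points (usub (cube ?K) (nonzero ?K)))"
    using sm_subset[OF sm_cube[OF sK] nonzero_points] by simp
  ultimately show ?thesis
    by (intro realized_image[OF uV RV t2space_usub[OF t2space_cube nonzero_points] _ g])
qed

text \<open>For a code i without limit, \<open>f i x\<close> marks the coordinates at which x
  differs from i, so it is 0 exactly when x is i. Asking for nonzero values at all such i cuts out
  \<open>conv X A\<close>, closed or not. The coordinates in M are constantly \<open>False\<close>
  and serve to match the punctured cube that is available.\<close>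

lemma absorb:
  fixes W :: "'w uspace" and M :: "'m set"
  assumes two: "realized C (udisc (UNIV :: bool set))" and W: "is_uspace W" and RW: "realized C W"
    and \<phi>: "\<And>m. m \<in> M \<Longrightarrow> ucont W (udisc UNIV) (\<lambda>w. \<phi> w m)"
    and nz: "\<And>w. w \<in> points W \<Longrightarrow> \<exists>m\<in>M. \<phi> w m"
    and near: "\<And>J. finite J \<Longrightarrow> J \<subseteq> M \<Longrightarrow> \<exists>w\<in>points W. \<forall>m\<in>J. \<not> \<phi> w m"
    and sM: "sm M"
    and X: "X \<in> T2Unif" and A: "unet X A" and RA: "\<And>E. E \<in> usym X \<Longrightarrow> realized C (udisc (A E))"
  shows "X \<in> C"
proof -
  have uX: "is_uspace X" and sX: "sm (points X)"
    using X T2Unif_uspace T2Unif_sm by blast+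
  have sS: "sm (usym X)"
    using sm_subset[OF sm_entourages[OF uX sX]] by (simp add: usym_def)
  let ?P = "codes X A" and ?K = "usym X <+> M"
  have RP: "realized C ?P"
    unfolding codes_def by (rule realized_uproduct[OF sS RA is_uspace_udisc])
  define I where "I = points ?P - conv X A"
  have sI: "sm I"
    using sm_subset[OF realized_sm[OF RP]] by (simp add: I_def Diff_subset)
  define f where "f i x = (\<lambda>k\<in>?K. case k of Inl E \<Rightarrow> x E \<noteq> i E | Inr m \<Rightarrow> False)" for i x :: "('a \<times> 'a) set \<Rightarrow> 'a"
  have f: "ucont ?P (cube ?K) (f i)" for i
  proof (rule ucont_into_cube[OF is_uspace_codes])
    fix k assume k: "k \<in> ?K"
    show "ucont ?P (udisc UNIV) (\<lambda>x. f i x k)"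
    proof (cases k)
      case (Inl E)
      then have E: "E \<in> usym X"
        using k by auto
      have "ucont ?P (udisc UNIV) (\<lambda>x. x E \<noteq> i E)"
        unfolding codes_def
        by (rule ucont_udisc_comp[OF is_uspace_uproduct ucont_proj[OF E, of "\<lambda>E. udisc (A E)"], of "\<lambda>a. a \<noteq> i E"])
          (simp_all add: is_uspace_udisc)
      then show ?thesis
        using Inl k by (simp add: f_def)
    next
      case (Inr m)
      then show ?thesis
        unfolding ucont_udisc_iff[OF is_uspace_codes] f_def using ent_top[OF is_uspace_codes] k by auto
    qed
  qed (simp add: f_def)
  have "realized C (usub ?P {x \<in> points ?P. \<forall>i\<in>I. f i x \<in> nonzero ?K})"
    by (rule realized_vimage[OF sI is_uspace_codes RP t2space_cube nonzero_points
          realized_nonzero[OF two W RW \<phi> nz near sM sS] f])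
  moreover have "f i x \<in> nonzero ?K \<longleftrightarrow> x \<noteq> i" if x: "x \<in> points ?P" and i: "i \<in> points ?P" for x i
  proof
    assume "x \<noteq> i"
    then obtain E where "E \<in> usym X" "x E \<noteq> i E"
      using PiE_ext[of x "usym X" A i] x i unfolding points_codes by blast
    then have "Inl E \<in> ?K \<and> f i x (Inl E)"
      by (simp add: f_def InlI)
    then show "f i x \<in> nonzero ?K"
      using ucontD[OF f x] unfolding nonzero_def by blast
  next
    assume "f i x \<in> nonzero ?K"
    then show "x \<noteq> i"
      by (auto simp: nonzero_def f_def split: sum.splits)
  qed
  then have "{x \<in> points ?P. \<forall>i\<in>I. f i x \<in> nonzero ?K} = conv X A"
    using conv_points[of X A] unfolding I_def by blast
  ultimately show ?thesis
    using limits_C[OF X A] by simp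
qed

lemma noncompact_absorb:
  assumes two: "realized C (udisc (UNIV :: bool set))" and Z: "Z \<in> C" and nc: "\<not> compact_space (utopology Z)"
    and X: "X \<in> T2Unif" and A: "unet X A" and RA: "\<And>E. E \<in> usym X \<Longrightarrow> realized C (udisc (A E))"
  shows "X \<in> C"
proof (cases "\<exists>E\<in>entourages Z. \<exists>D. D \<subseteq> points Z \<and> separated E D \<and> infinite D")
  case True
  then obtain E D where D: "E \<in> entourages Z" "D \<subseteq> points Z" "separated E D" "infinite D"
    by blast
  have "realized C (udisc D)"
    by (rule realized_separated[OF Z D(1-3)])
  moreover have "sm D"
    using sm_subset D(2) C_T2Unif[OF Z] T2Unif_sm by blast
  moreover have "\<exists>w\<in>points (udisc D). \<forall>m\<in>J. \<not> w = m" if "finite J" "J \<subseteq> D" for J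
  proof -
    have "D - J \<noteq> {}"
      using infinite_imp_nonempty[OF Diff_infinite_finite[OF that(1) D(4)]] .
    then obtain w where "w \<in> D" "w \<notin> J"
      by blast
    then show ?thesis
      by (intro bexI[of _ w]) auto
  qed
  moreover have "ucont (udisc D) (udisc UNIV) (\<lambda>w. w = m)" for m
    by (rule ucont_udisc[OF is_uspace_udisc]) simp
  ultimately show ?thesis
    by (intro absorb[OF two is_uspace_udisc[of D] _ _ _ _ _ X A RA, where M = D and \<phi> = "\<lambda>w m. w = m"]) auto
next
  case False
  have uZ: "is_uspace Z" and tZ: "t2space Z" and sZ: "sm (points Z)"
    using C_T2Unif[OF Z] T2Unif_uspace T2Unif_t2space T2Unif_sm by blast+
  obtain B where B: "unet Z B" "\<forall>E\<in>usym Z. separated E (B E)"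
    using ex_unet[OF uZ] by blast
  have fin: "finite (B E)" if "E \<in> usym Z" for E
    using False usym_ent[OF that] B that unfolding unet_def by blast
  have sS: "sm (usym Z)"
    using sm_subset[OF sm_entourages[OF uZ sZ]] by (simp add: usym_def)
  let ?P = "codes Z B"
  have "\<not> closedin (utopology ?P) (conv Z B)"
    using compact_of_closed_conv[OF tZ B(1) fin] nc by blast
  then obtain f where f: "f \<in> points ?P" "f \<notin> conv Z B"
    and fnear: "\<forall>D\<in>entourages ?P. \<exists>g\<in>conv Z B. (f, g) \<in> D"
    unfolding closedin_utopology[OF is_uspace_codes] using conv_points by blast
  \<comment> \<open>Pairs of a code and its limit. Keeping the limit as an extra coordinate prevents
    it from being lost: a family approximated by such pairs has a point of Z in its last component,
    and this point is the limit.\<close>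
  define S where "S = {p. fst p \<in> points ?P \<and> ulim Z (fst p) (snd p)}"
  define I where "I = insert None (Some ` usym Z)"
  define Y where "Y n = (case n of None \<Rightarrow> Z | Some E \<Rightarrow> udisc (B E))" for n
  define q :: "('a \<times> 'a) set option \<Rightarrow> (('a \<times> 'a) set \<Rightarrow> 'a) \<times> 'a \<Rightarrow> 'a"
    where "q n = (case n of None \<Rightarrow> snd | Some E \<Rightarrow> (\<lambda>p. fst p E))" for n
  define W where "W = uinit S I q Y"
  have Yt: "t2space (Y n)" if "n \<in> I" for n
    using tZ by (simp add: Y_def t2space_udisc split: option.splits)
  have Yu: "is_uspace (Y n)" if "n \<in> I" for n
    by (rule t2space_uspace[OF Yt[OF that]])
  have qY: "q n p \<in> points (Y n)" if "n \<in> I" "p \<in> S" for n p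
    using that by (auto simp: I_def q_def Y_def S_def ulim_def points_codes)
  have tW: "t2space W"
    unfolding W_def
  proof (rule t2space_uinit[OF Yt qY])
    fix x y assume xy: "x \<in> S" "y \<in> S" and eq: "\<And>n. n \<in> I \<Longrightarrow> q n x = q n y"
    have "snd x = snd y"
      using eq[of None] by (simp add: I_def q_def)
    moreover have "fst x = fst y"
    proof (rule PiE_ext)
      show "fst x \<in> PiE (usym Z) B" "fst y \<in> PiE (usym Z) B"
        using xy by (simp_all add: S_def points_codes)
      show "fst x E = fst y E" if "E \<in> usym Z" for E
        using eq[of "Some E"] that by (simp add: I_def q_def)
    qed
    ultimately show "x = y"
      by (simp add: prod_eq_iff)
  qed
  have init: "initial_for W I q Y"
    unfolding W_def by (rule initial_for_uinit[OF qY])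
  have pW: "points W = S"
    by (simp add: W_def)
  have "realized C W"
  proof (rule realized_initial[OF tW _ _ init])
    show "sm I"
      unfolding I_def using sm_Un[OF sm_finite[of "{None}"] sm_image[OF sS, of Some]] by simp
    show "realized C (Y n)" if "n \<in> I" for n
      using that C_realized[OF Z] realized_finite[OF two fin] by (auto simp: I_def Y_def)
    fix y assume y: "\<And>n. n \<in> I \<Longrightarrow> y n \<in> points (Y n)"
      and near: "\<And>J F. \<lbrakk>finite J; J \<subseteq> I; \<And>n. n \<in> J \<Longrightarrow> F n \<in> entourages (Y n)\<rbrakk> \<Longrightarrow>
         \<exists>x\<in>points W. \<forall>n\<in>J. (y n, q n x) \<in> F n"
    let ?x = "\<lambda>E\<in>usym Z. y (Some E)" and ?z = "y None"
    have "ulim Z ?x ?z"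
      unfolding ulim_def
    proof (intro conjI ballI)
      show "?z \<in> points Z"
        using y[of None] by (simp add: I_def Y_def)
      fix E F assume E: "E \<in> usym Z" and F: "F \<in> usym Z"
      \<comment> \<open>One half of F is the clause of \<open>ulim\<close> for the approximating
        pair, the other half the step from its limit to \<open>?z\<close>. The two E-steps stay
        unchanged because the coordinate E is discrete.\<close>
      obtain G where G: "G \<in> usym Z" "G O G \<subseteq> F"
        using usym_half[OF uZ usym_ent[OF F]] by blast
      have "\<exists>p\<in>points W. \<forall>n\<in>{None, Some E}. (y n, q n p) \<in> (case n of None \<Rightarrow> G | Some E \<Rightarrow> Id_on (B E))"
        by (rule near) (use E usym_ent[OF G(1)] in \<open>auto simp: I_def Y_def Id_on_entourage\<close>)
      then obtain p where pS: "p \<in> S"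
        and pn: "\<forall>n\<in>{None, Some E}. (y n, q n p) \<in> (case n of None \<Rightarrow> G | Some E \<Rightarrow> Id_on (B E))"
        unfolding pW by blast
      have p: "p \<in> S" "(?z, snd p) \<in> G" "(y (Some E), fst p E) \<in> Id_on (B E)"
        using pS bspec[OF pn, of None] bspec[OF pn, of "Some E"] by (simp_all add: q_def)
      have "(fst p E, snd p) \<in> E O E O G"
        using p(1) E G(1) by (simp add: S_def ulim_def)
      moreover have "y (Some E) = fst p E"
        using p(3) by (auto simp: Id_on_iff)
      moreover have "(snd p, ?z) \<in> G"
        by (rule usym_sym[OF G(1) p(2)])
      ultimately have "(?x E, ?z) \<in> (E O E O G) O G"
        using E by auto
      then show "(?x E, ?z) \<in> E O E O F"
        using G(2) by blast
    qed
    moreover have "?x \<in> points ?P"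
      using y[of "Some _"] by (auto simp: points_codes I_def Y_def)
    ultimately have "(?x, ?z) \<in> S"
      by (simp add: S_def)
    moreover have "q n (?x, ?z) = y n" if "n \<in> I" for n
      using that by (auto simp: I_def q_def)
    ultimately show "\<exists>x\<in>points W. \<forall>n\<in>I. q n x = y n"
      unfolding pW by blast
  qed
  moreover have "ucont W (udisc UNIV) (\<lambda>p. fst p E \<noteq> f E)" if E: "E \<in> usym Z" for E
  proof -
    have "ucont W (udisc (B E)) (\<lambda>p. fst p E)"
      using initial_for_ucont[OF init, of "Some E"] E by (simp add: I_def q_def Y_def)
    then show ?thesis
      using ucont_udisc_comp[OF t2space_uspace[OF tW], of "B E" "\<lambda>p. fst p E" "\<lambda>a. a \<noteq> f E" UNIV] by simp
  qed
  moreover have "\<exists>E\<in>usym Z. fst p E \<noteq> f E" if p: "p \<in> points W" for p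
  proof (rule ccontr)
    assume no: "\<not> (\<exists>E\<in>usym Z. fst p E \<noteq> f E)"
    have fp: "fst p \<in> points ?P" "ulim Z (fst p) (snd p)"
      using p by (simp_all add: pW S_def)
    have "fst p = f"
      using PiE_ext[of "fst p" "usym Z" B f] fp(1) f(1) no unfolding points_codes by blast
    then show False
      using f fp by (auto simp: conv_def)
  qed
  moreover have "\<exists>p\<in>points W. \<forall>E\<in>J. \<not> fst p E \<noteq> f E" if J: "finite J" "J \<subseteq> usym Z" for J
  proof -
    obtain D where D: "D \<in> entourages ?P" "\<forall>f g. (f, g) \<in> D \<longrightarrow> (\<forall>i\<in>J. f i = g i)"
      using agree_entourage[OF J, of B] unfolding codes_def by blast
    obtain g where g: "g \<in> conv Z B" "(f, g) \<in> D"
      using fnear D(1) by blast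
    then obtain z where z: "ulim Z g z" "g \<in> points ?P"
      by (auto simp: conv_def)
    have "(g, z) \<in> points W"
      using z by (simp add: pW S_def)
    moreover have "\<forall>E\<in>J. g E = f E"
      using D(2) g(2) by metis
    ultimately show ?thesis
      by (intro bexI[of _ "(g, z)"]) simp_all
  qed
  ultimately show ?thesis
    by (rule absorb[OF two t2space_uspace[OF tW] _ _ _ _ sS X A RA])
qed

text \<open>The case of an empty family: a space with at most one point is a closed subspace of the
  empty product.\<close>

lemma trivial_C:
  assumes X: "X \<in> T2Unif" and le1: "\<And>a b. a \<in> points X \<Longrightarrow> b \<in> points X \<Longrightarrow> a = b"
  shows "X \<in> C"
proof -
  have uX: "is_uspace X"
    by (rule T2Unif_uspace[OF X])
  have "realized C X"
  proof (rule realized_initial[where I = "{} :: 'a set" and f = "\<lambda>_ _. undefined" and Y = "\<lambda>_. udisc UNIV :: 'a uspace"])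
    show "t2space X"
      by (rule T2Unif_t2space[OF X])
    show "initial_for X {} (\<lambda>_ _. undefined) (\<lambda>_. udisc UNIV :: 'a uspace)"
      unfolding initial_for_def
    proof (intro conjI ballI)
      fix E assume E: "E \<in> entourages X"
      have "(x, y) \<in> E" if "x \<in> points X" "y \<in> points X" for x y
        using le1[OF that] ent_refl[OF uX E that(1)] by simp
      then show "\<exists>J F. finite J \<and> J \<subseteq> {} \<and> (\<forall>i\<in>J. F i \<in> entourages (udisc UNIV :: 'a uspace)) \<and>
          init_ent (points X) J (\<lambda>_ _. undefined) F \<subseteq> E"
        by (intro exI[of _ "{}"] exI[of _ "\<lambda>_. {}"]) (auto simp: init_ent_def)
    qed simp
    fix y :: "'a \<Rightarrow> 'a"
    assume near: "\<And>J F. \<lbrakk>finite J; J \<subseteq> {}; \<And>i. i \<in> J \<Longrightarrow> F i \<in> entourages (udisc UNIV :: 'a uspace)\<rbrakk> \<Longrightarrow>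
         \<exists>x\<in>points X. \<forall>i\<in>J. (y i, undefined) \<in> F i"
    show "\<exists>x\<in>points X. \<forall>i\<in>{}. undefined = y i"
      using near[of "{}" "\<lambda>_. {}"] by simp
  qed (simp_all add: sm_finite)
  then show ?thesis
    using realized_C X by blast
qed

lemma classification:
  "C = {X \<in> T2Unif. \<forall>a\<in>points X. \<forall>b\<in>points X. a = b} \<or>
   C = {X \<in> T2Unif. compact_space (utopology X)} \<or>
   (\<exists>l0 :: 'a rel. Cinfinite l0 \<and> l0 <o |UNIV :: 'a set| \<and> C = {X \<in> T2Unif. separated_below X l0}) \<or>
   C = T2Unif"
proof (cases "\<exists>X\<in>C. \<exists>a\<in>points X. \<exists>b\<in>points X. a \<noteq> b")
  case False
  have "C = {X \<in> T2Unif. \<forall>a\<in>points X. \<forall>b\<in>points X. a = b}"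
  proof (intro subset_antisym subsetI)
    fix X :: "'a uspace" assume "X \<in> {X \<in> T2Unif. \<forall>a\<in>points X. \<forall>b\<in>points X. a = b}"
    then show "X \<in> C"
      by (intro trivial_C) auto
  qed (use False C_T2Unif in auto)
  then show ?thesis
    by blast
next
  case True
  then have two: "realized C (udisc (UNIV :: bool set))"
    by (elim bexE) (rule realized_bool)
  show ?thesis
  proof (cases "\<forall>X\<in>C. compact_space (utopology X)")
    case True
    then have "C = {X \<in> T2Unif. compact_space (utopology X)}"
    proof (intro subset_antisym subsetI)
      fix X :: "'a uspace" assume "X \<in> {X \<in> T2Unif. compact_space (utopology X)}"
      then show "X \<in> C"
        by (intro compact_C[OF two]) auto
    qed (use True C_T2Unif in auto)
    then show ?thesis
      by blast
  next
    case False
    then obtain Z where Z: "Z \<in> C" "\<not> compact_space (utopology Z)"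
      by blast
    \<comment> \<open>Sizes of the small discrete spaces outside C. A nonempty set of cardinals has
      a least member, the bound \<open>l0\<close>; if \<open>R\<close> is empty, every net occurring
      in a space is admissible and C is everything.\<close>
    define R where "R = {|A| | A :: 'a set. sm A \<and> \<not> realized C (udisc A)}"
    show ?thesis
    proof (cases "R = {}")
      case True
      have "X \<in> C" if X: "X \<in> T2Unif" for X
      proof -
        have uX: "is_uspace X" and sX: "sm (points X)"
          using X T2Unif_uspace T2Unif_sm by blast+
        obtain A where A: "unet X A"
          using ex_unet[OF uX] by blast
        have "realized C (udisc (A E))" if "E \<in> usym X" for E
        proof -
          have "sm (A E)"
            using sm_subset[OF sX] A that by (simp add: unet_def)
          then show ?thesis
            using True by (auto simp: R_def)
        qed
        then show ?thesis
          by (rule noncompact_absorb[OF two Z X A])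
      qed
      then have "C = T2Unif"
        using C_T2Unif by blast
      then show ?thesis
        by blast
    next
      case False
      have "\<forall>r\<in>R. Card_order r"
        by (auto simp: R_def card_of_card_order_on card_of_Card_order)
      then obtain l0 where l0: "l0 \<in> R" "\<forall>r\<in>R. l0 \<le>o r"
        using exists_minim_Card_order[OF False] by blast
      then obtain A0 :: "'a set" where A0: "l0 = |A0|" "sm A0" "\<not> realized C (udisc A0)"
        by (auto simp: R_def)
      \<comment> \<open>A two-point discrete space in C brings in all finite ones, so the bound is
        infinite, as the listed form demands.\<close>
      have "infinite A0"
        using A0(3) realized_finite[OF two] by blast
      then have "Cinfinite l0"
        unfolding A0(1) by (simp add: cinfinite_def Field_card_of card_of_card_order_on)
      moreover have "l0 <o |UNIV :: 'a set|"
        using A0(1,2) by (simp add: U)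
      moreover have "C = {X \<in> T2Unif. separated_below X l0}"
      proof (intro subset_antisym subsetI)
        fix X assume X: "X \<in> C"
        have "|A| <o l0" if "E \<in> entourages X" "A \<subseteq> points X" "separated E A" for E A
        proof (rule ccontr)
          assume "\<not> |A| <o l0"
          then have "|A0| \<le>o |A|"
            unfolding A0(1) using not_ordLess_iff_ordLeq[OF card_of_Well_order card_of_Well_order] by blast
          then show False
            using A0(3) realized_udisc_ordLeq[OF realized_separated[OF X that]] by blast
        qed
        then show "X \<in> {X \<in> T2Unif. separated_below X l0}"
          using C_T2Unif[OF X] by (simp add: separated_below_def)
      next
        fix X :: "'a uspace" assume "X \<in> {X \<in> T2Unif. separated_below X l0}"
        then have X: "X \<in> T2Unif" "separated_below X l0"
          by simp_all
        have uX: "is_uspace X" and sX: "sm (points X)"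
          using X T2Unif_uspace T2Unif_sm by blast+
        obtain A where A: "unet X A" "\<forall>E\<in>usym X. separated E (A E)"
          using ex_unet[OF uX] by blast
        have "realized C (udisc (A E))" if E: "E \<in> usym X" for E
        proof (rule ccontr)
          assume no: "\<not> realized C (udisc (A E))"
          have AX: "A E \<subseteq> points X"
            using A(1) E by (simp add: unet_def)
          then have "|A E| \<in> R"
            using no sm_subset[OF sX] by (auto simp: R_def)
          then have "l0 \<le>o |A E|"
            using l0(2) by blast
          moreover have "|A E| <o l0"
            using X(2) usym_ent[OF E] AX A(2) E by (simp add: separated_below_def)
          ultimately show False
            using not_ordLess_ordLeq by blast
        qed
        then show "X \<in> C"
          by (rule noncompact_absorb[OF two Z X(1) A(1)])
      qed
      ultimately show ?thesis
        by blast
    qed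
  qed
qed

end


section \<open>Epireflectivity\<close>

lemma subcategory_uiso:
  assumes C: "subcategory C" and R: "R \<in> C" and X: "X \<in> T2Unif" and iso: "uiso X R r g"
  shows "X \<in> C"
proof -
  have "R \<in> T2Unif"
    using C R by (auto simp: subcategory_def)
  then show ?thesis
    using C[unfolded subcategory_def, THEN conjunct2, rule_format, OF R X]
      uiso_isomorphism[OF T2Unif_uspace T2Unif_uspace[OF X] uiso_sym[OF iso]] by blast
qed

lemma reflection_ex:
  assumes "reflection_arrow C X R r" "Y \<in> C" "f \<in> hom X Y"
  shows "\<exists>g. g \<in> hom R Y \<and> (\<forall>x\<in>points X. g (r x) = f x)"
proof -
  obtain g where "g \<in> hom R Y" "comp_from X g r = f"
    using assms(1)[unfolded reflection_arrow_def, THEN conjunct2, THEN conjunct2, rule_format, OF assms(2,3)]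
    by blast
  then show ?thesis
    by (metis compose_eq)
qed

lemma reflection_unique:
  assumes "reflection_arrow C X R r" "Y \<in> C" "f \<in> hom X Y" "g \<in> hom R Y" "h \<in> hom R Y"
    "\<And>x. x \<in> points X \<Longrightarrow> g (r x) = f x" "\<And>x. x \<in> points X \<Longrightarrow> h (r x) = f x"
  shows "g = h"
proof -
  have fe: "f \<in> extensional (points X)"
    using assms(3) by (simp add: hom_iff)
  have "comp_from X g r = f" "comp_from X h r = f"
    using assms(6,7) by (simp_all add: compose_eq_restrict[OF fe])
  then show ?thesis
    using assms(1)[unfolded reflection_arrow_def, THEN conjunct2, THEN conjunct2, rule_format, OF assms(2,3)]
      assms(4,5) by blast
qed

context inaccessible
begin

text \<open>The reflection arrow is an epimorphism and hence dense, so its left inverse g is also a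
  right inverse and X is isomorphic to R.\<close>

lemma epireflective_retract:
  fixes C :: "'u uspace set"
  assumes C: "subcategory C" and epi: "epireflective C" and X: "X \<in> T2Unif"
    and r: "reflection_arrow C X R r" and g: "g \<in> hom R X" and gr: "\<And>x. x \<in> points X \<Longrightarrow> g (r x) = x"
  shows "X \<in> C"
proof -
  have RC: "R \<in> C" and rh: "r \<in> hom X R"
    using r by (auto simp: reflection_arrow_def)
  have RT: "R \<in> T2Unif"
    using C RC by (auto simp: subcategory_def)
  have "epimorphism X R r"
    using epi X r by (simp add: epireflective_def)
  then have dense: "dense_in R (r ` points X)"
    by (rule epimorphism_dense[OF X RT])
  have "r (g z) = z" if "z \<in> points R" for z
    by (rule ucont_dense_id[OF T2Unif_t2space[OF RT] ucont_comp[OF hom_ucont[OF g] hom_ucont[OF rh]] dense _ that])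
      (use gr in auto)
  then have "uiso X R r g"
    using gr hom_ucont[OF g] hom_ucont[OF rh] by (simp add: uiso_def)
  then show ?thesis
    by (rule subcategory_uiso[OF C RC X])
qed

text \<open>The projections extend along the reflection arrow of P. Assembled by the universal
  property they give a map back to P, and its composite with the arrow has the projections of the
  identity, so P is a retract of its reflection.\<close>

lemma epireflective_products:
  fixes C :: "'u uspace set"
  assumes C: "subcategory C" and epi: "epireflective C"
  shows "closed_under_products C"
  unfolding closed_under_products_def
proof (intro allI impI)
  fix I X P p assume a: "small I \<and> (\<forall>i\<in>I. X i \<in> C) \<and> is_product I X P p"
  then have XC: "\<And>i. i \<in> I \<Longrightarrow> X i \<in> C" and P: "is_product I X P p"
    by auto
  have PT: "P \<in> T2Unif" and p: "\<And>i. i \<in> I \<Longrightarrow> p i \<in> hom P (X i)"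
    using P by (auto simp: is_product_def)
  note univ = P[unfolded is_product_def, THEN conjunct2, THEN conjunct2, rule_format]
  obtain R r where r: "reflection_arrow C P R r"
    using epi PT by (auto simp: epireflective_def reflective_def)
  have rh: "r \<in> hom P R" and RT: "R \<in> T2Unif"
    using r C by (auto simp: reflection_arrow_def subcategory_def)
  have uP: "is_uspace P"
    by (rule T2Unif_uspace[OF PT])
  have "\<forall>i\<in>I. \<exists>q. q \<in> hom R (X i) \<and> (\<forall>x\<in>points P. q (r x) = p i x)"
    using reflection_ex[OF r XC p] by blast
  then obtain q where q: "\<And>i. i \<in> I \<Longrightarrow> q i \<in> hom R (X i) \<and> (\<forall>x\<in>points P. q i (r x) = p i x)"
    unfolding bchoice_iff by blast
  obtain g where g: "g \<in> hom R P" "\<And>i. i \<in> I \<Longrightarrow> comp_from R (p i) g = q i"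
    using univ[OF RT, of q] q by blast
  have eq: "comp_from P g r = ident P"
  proof -
    have "\<exists>!h. h \<in> hom P P \<and> (\<forall>i\<in>I. comp_from P (p i) h = p i)"
      using univ[OF PT, of p] p by blast
    moreover have "comp_from P g r \<in> hom P P" "ident P \<in> hom P P"
      using comp_from_hom[OF uP rh g(1)] ident_hom[OF uP] by blast+
    moreover have "comp_from P (p i) (comp_from P g r) = p i" if i: "i \<in> I" for i
    proof -
      have "p i (g (r x)) = p i x" if x: "x \<in> points P" for x
      proof -
        have "p i (g (r x)) = q i (r x)"
          using fun_cong[OF g(2)[OF i], of "r x"] hom_point[OF rh x] by (simp add: compose_eq)
        then show ?thesis
          using q[OF i] x by simp
      qed
      then show ?thesis
        using p[OF i] by (simp add: compose_eq_restrict compose_eq hom_iff)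
    qed
    moreover have "comp_from P (p i) (ident P) = p i" if i: "i \<in> I" for i
      using p[OF i] by (simp add: compose_eq_restrict ident_def hom_iff)
    ultimately show ?thesis
      by blast
  qed
  have gr: "g (r x) = x" if "x \<in> points P" for x
    using fun_cong[OF eq, of x] that by (simp add: compose_eq ident_def)
  show "P \<in> C"
    by (rule epireflective_retract[OF C epi PT r g(1) gr])
qed

text \<open>An extremal monomorphism into a member of C factors through the reflection arrow, which
  is an epimorphism and therefore an isomorphism.\<close>

lemma epireflective_extremal_subobjects:
  fixes C :: "'u uspace set"
  assumes C: "subcategory C" and epi: "epireflective C"
  shows "closed_under_extremal_subobjects C"
  unfolding closed_under_extremal_subobjects_def
proof (intro ballI allI impI)
  fix Y X m assume Y: "Y \<in> C" and X: "X \<in> T2Unif" and m: "extremal_mono X Y m"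
  obtain R r where r: "reflection_arrow C X R r"
    using epi X by (auto simp: epireflective_def reflective_def)
  have RC: "R \<in> C" and RT: "R \<in> T2Unif"
    using r C by (auto simp: reflection_arrow_def subcategory_def)
  have mh: "m \<in> hom X Y"
    using m by (simp add: extremal_mono_def monomorphism_def)
  obtain g where g: "g \<in> hom R Y" "\<forall>x\<in>points X. g (r x) = m x"
    using reflection_ex[OF r Y mh] by blast
  have "m = comp_from X g r"
    using g(2) mh compose_eq_restrict[of m "points X" g r] by (simp add: hom_iff)
  moreover have "epimorphism X R r"
    using epi X r by (simp add: epireflective_def)
  ultimately have "isomorphism X R r"
    using m[unfolded extremal_mono_def, THEN conjunct2, rule_format, OF RT] g(1) by blast
  then obtain k where "uiso X R r k"
    using isomorphism_uiso by blast
  then show "X \<in> C"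
    by (rule subcategory_uiso[OF C RC X])
qed

end

section \<open>Existence of reflections in classes closed under products and closed
  subspaces\<close>

context prod_closed
begin

lemma closure_C:
  assumes Y: "Y \<in> C" and f: "f \<in> hom X Y" and X: "is_uspace X"
  defines "L \<equiv> utopology Y closure_of (f ` points X)"
  shows "L \<subseteq> points Y" "usub Y L \<in> C" "f \<in> hom X (usub Y L)" "dense_in (usub Y L) (f ` points X)"
proof -
  have uY: "is_uspace Y"
    by (rule C_uspace[OF Y])
  have L: "closedin (utopology Y) L"
    by (simp add: L_def)
  show LY: "L \<subseteq> points Y"
    by (rule closedin_points[OF uY L])
  show "usub Y L \<in> C"
    by (rule usub_C[OF Y L])
  have fL: "f ` points X \<subseteq> L"
    unfolding L_def using hom_point[OF f] topspace_utopology[OF uY] by (intro closure_of_subset) auto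
  show "f \<in> hom X (usub Y L)"
    using ucont_into_usub[OF X hom_ucont[OF f] fL] f by (simp add: hom_iff)
  show "dense_in (usub Y L) (f ` points X)"
    unfolding dense_in_closure_of[OF is_uspace_usub[OF uY LY]] utopology_usub[OF uY LY] closure_of_subtopology
    using fL by (simp add: L_def Int_absorb1)
qed

text \<open>The arrow factors through the closure of its image, again a member of C. Uniqueness
  forces the resulting endomorphism of R to be the identity, so this closure is all of R.\<close>

lemma reflection_epimorphism:
  assumes X: "X \<in> T2Unif" and r: "reflection_arrow C X R r"
  shows "epimorphism X R r"
proof -
  have uX: "is_uspace X"
    by (rule T2Unif_uspace[OF X])
  have RC: "R \<in> C" and rh: "r \<in> hom X R"
    using r by (auto simp: reflection_arrow_def)
  have uR: "is_uspace R"
    by (rule C_uspace[OF RC])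
  let ?L = "utopology R closure_of (r ` points X)"
  note L = closure_C[OF RC rh uX]
  obtain g where g: "g \<in> hom R (usub R ?L)" "\<forall>x\<in>points X. g (r x) = r x"
    using reflection_ex[OF r L(2,3)] by blast
  have "ucont R R g"
    using ucont_comp[OF hom_ucont[OF g(1)] ucont_usub_incl[OF L(1)]] by simp
  then have gR: "g \<in> hom R R"
    using g(1) by (simp add: hom_iff)
  have "g = ident R"
    by (rule reflection_unique[OF r RC rh gR ident_hom[OF uR]])
      (use g(2) hom_point[OF rh] in \<open>simp_all add: ident_def\<close>)
  then have "z \<in> ?L" if "z \<in> points R" for z
    using hom_point[OF g(1) that] that by (simp add: ident_def)
  then have "dense_in R (r ` points X)"
    unfolding dense_in_closure_of[OF uR] by blast
  then show ?thesis
    by (rule dense_epimorphism[OF C_T2Unif[OF RC] rh])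
qed

text \<open>In a Hausdorff space a point is determined by the traces of its balls on a dense set. A
  space in which X has dense image thus has no more points than the double power set of X; this
  bound provides the solution set for the reflection.\<close>

lemma dense_points_bound:
  assumes Y: "t2space Y" and dense: "dense_in Y (f ` X)"
  shows "inj_on (\<lambda>y. (\<lambda>E. {x \<in> X. (y, f x) \<in> E}) ` entourages Y) (points Y)"
proof (rule inj_onI)
  have uY: "is_uspace Y"
    by (rule t2space_uspace[OF Y])
  fix y z assume y: "y \<in> points Y" and z: "z \<in> points Y"
    and eq: "(\<lambda>E. {x \<in> X. (y, f x) \<in> E}) ` entourages Y = (\<lambda>E. {x \<in> X. (z, f x) \<in> E}) ` entourages Y"
  show "y = z"
  proof (rule t2spaceD[OF Y y z])
    fix E assume "E \<in> entourages Y"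
    then obtain D where D: "D \<in> usym Y" "D O D \<subseteq> E"
      using usym_half[OF uY] by blast
    have "{x \<in> X. (y, f x) \<in> D} \<in> (\<lambda>E. {x \<in> X. (z, f x) \<in> E}) ` entourages Y"
      unfolding eq[symmetric] using usym_ent[OF D(1)] by blast
    then obtain F where F: "F \<in> entourages Y" "{x \<in> X. (y, f x) \<in> D} = {x \<in> X. (z, f x) \<in> F}"
      by blast
    obtain x where x: "x \<in> X" "(z, f x) \<in> F \<inter> D"
      using dense z ent_Int[OF uY F(1) usym_ent[OF D(1)]] unfolding dense_in_def by blast
    then have "x \<in> {x \<in> X. (y, f x) \<in> D}"
      unfolding F(2) by blast
    then have "(y, f x) \<in> D" "(f x, z) \<in> D"
      using x usym_sym[OF D(1)] by blast+
    then show "(y, z) \<in> E"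
      using D(2) by blast
  qed
qed

lemma reflective: "reflective C"
  unfolding reflective_def
proof
  fix X :: "'u uspace" assume X: "X \<in> T2Unif"
  have uX: "is_uspace X" and sX: "sm (points X)"
    using X T2Unif_uspace T2Unif_sm by blast+
  have sPP: "sm (Pow (Pow (points X)))"
    by (intro sm_Pow sX)
  obtain j :: "'u set set \<Rightarrow> 'u" where j: "inj_on j (Pow (Pow (points X)))"
    using sm_ex_inj[OF sPP] by blast
  define S where "S = j ` Pow (Pow (points X))"
  have sS: "sm S"
    unfolding S_def by (rule sm_image[OF sPP])
  \<comment> \<open>The solution set: all morphisms from X to members of C whose points lie in the
    fixed set \<open>S\<close>, a copy of the double power set of X.\<close>
  define I where "I = {i. fst i \<in> C \<and> points (fst i) \<subseteq> S \<and> snd i \<in> hom X (fst i)}"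
  have sI: "sm I"
  proof (rule sm_inj_on)
    \<comment> \<open>A space is recorded by its two fields and a morphism by its graph, which
      embeds the index set into a small set.\<close>
    let ?c = "\<lambda>i. (points (fst i), entourages (fst i), (\<lambda>x. (x, snd i x)) ` points X)"
    show "sm (Pow S \<times> Pow (Pow (S \<times> S)) \<times> Pow (points X \<times> S))"
      by (intro sm_Times sm_Pow sS sX)
    show "?c ` I \<subseteq> Pow S \<times> Pow (Pow (S \<times> S)) \<times> Pow (points X \<times> S)"
    proof
      fix t assume "t \<in> ?c ` I"
      then obtain i where i: "i \<in> I" "t = ?c i"
        by blast
      then have iI: "fst i \<in> C" "points (fst i) \<subseteq> S" "snd i \<in> hom X (fst i)"
        by (simp_all add: I_def)
      have "E \<subseteq> S \<times> S" if "E \<in> entourages (fst i)" for E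
        using ent_sub[OF C_uspace[OF iI(1)] that] iI(2) by blast
      moreover have "snd i x \<in> S" if "x \<in> points X" for x
        using hom_point[OF iI(3) that] iI(2) by blast
      ultimately show "t \<in> Pow S \<times> Pow (Pow (S \<times> S)) \<times> Pow (points X \<times> S)"
        unfolding i(2) using iI(2) by auto
    qed
    show "inj_on ?c I"
    proof (rule inj_onI)
      fix i i' assume i: "i \<in> I" and i': "i' \<in> I" and eq: "?c i = ?c i'"
      have fst: "fst i = fst i'"
        using eq by simp
      have "snd i \<in> hom X (fst i)" "snd i' \<in> hom X (fst i)"
        using i i' fst by (simp_all add: I_def)
      then have "snd i = snd i'"
      proof (rule hom_eqI)
        fix x assume "x \<in> points X"
        then have "(x, snd i x) \<in> (\<lambda>x. (x, snd i' x)) ` points X"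
          using eq by blast
        then show "snd i x = snd i' x"
          by auto
      qed
      then show "i = i'"
        using fst by (simp add: prod_eq_iff)
    qed
  qed
  let ?P = "uproduct I fst"
  define d where "d x = (\<lambda>i\<in>I. snd i x)" for x
  have d: "ucont X ?P d"
  proof (rule ucont_into_uproduct[OF uX])
    fix i assume "i \<in> I"
    then show "ucont X (fst i) (\<lambda>x. d x i)"
      using hom_ucont[of "snd i" X "fst i"] by (simp add: d_def I_def)
  qed (simp add: d_def)
  have "realized C ?P"
    by (rule realized_uproduct_C[OF sI]) (simp add: I_def)
  then obtain Q a b where Q: "Q \<in> C" "uiso ?P Q a b"
    unfolding realized_def by blast
  define r where "r = restrict (\<lambda>x. a (d x)) (points X)"
  have rQ: "r \<in> hom X Q"
    unfolding r_def by (rule restrict_hom[OF uX ucont_comp[OF d uiso_ucont[OF Q(2)]]])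
  have br: "b (r x) = d x" if "x \<in> points X" for x
    using uiso_left[OF Q(2) ucontD[OF d that]] that by (simp add: r_def)
  define R where "R = usub Q (utopology Q closure_of (r ` points X))"
  note R = closure_C[OF Q(1) rQ uX, folded R_def]
  have uR: "is_uspace R"
    by (rule C_uspace[OF R(2)])
  have "reflection_arrow C X R r"
    unfolding reflection_arrow_def
  proof (intro conjI ballI R(2,3))
    fix Y f assume Y: "Y \<in> C" and f: "f \<in> hom X Y"
    let ?L = "utopology Y closure_of (f ` points X)"
    let ?Y = "usub Y ?L"
    note L = closure_C[OF Y f uX]
    have uYL: "is_uspace ?Y"
      by (rule C_uspace[OF L(2)])
    let ?t = "\<lambda>y. (\<lambda>E. {x \<in> points X. (y, f x) \<in> E}) ` entourages ?Y"
    have t: "inj_on ?t (points ?Y)"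
      by (rule dense_points_bound[OF T2Unif_t2space[OF C_T2Unif[OF L(2)]] L(4)])
    have tP: "?t ` points ?Y \<subseteq> Pow (Pow (points X))"
      by blast
    \<comment> \<open>Moves the closure of the image of f onto a subset of \<open>S\<close>; up to
      this renaming, f is one of the indexed morphisms and hence a coordinate of
      \<open>r\<close>.\<close>
    define \<theta> where "\<theta> y = j (?t y)" for y
    have \<theta>: "inj_on \<theta> (points ?Y)"
      unfolding \<theta>_def using comp_inj_on[OF t inj_on_subset[OF j tP]] by (simp add: comp_def)
    have \<theta>S: "\<theta> ` points ?Y \<subseteq> S"
      unfolding \<theta>_def S_def using tP by blast
    let ?Z = "ucopy \<theta> ?Y" and ?k = "inv_into (points ?Y) \<theta>"
    have iso: "uiso ?Y ?Z \<theta> ?k"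
      by (rule uiso_ucopy[OF uYL \<theta>])
    have "?Z \<in> T2Unif"
      unfolding T2Unif_sm using t2space_ucopy[OF T2Unif_t2space[OF C_T2Unif[OF L(2)]] \<theta>] sm_subset[OF sS \<theta>S]
      by simp
    then have ZC: "?Z \<in> C"
      by (rule C_uiso[OF L(2) _ iso])
    define i where "i = (?Z, restrict (\<lambda>x. \<theta> (f x)) (points X))"
    have iI: "i \<in> I"
      unfolding I_def i_def using ZC \<theta>S restrict_hom[OF uX ucont_comp[OF hom_ucont[OF L(3)] uiso_ucont[OF iso]]]
      by simp
    define g where "g = restrict (\<lambda>z. ?k (b z i)) (points R)"
    have proj: "ucont ?P ?Z (\<lambda>x. x i)"
      using ucont_proj[OF iI, of fst] by (simp add: i_def)
    have "ucont R ?P b"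
      unfolding R_def by (rule ucont_usub_restrict[OF uiso_ucont'[OF Q(2)] R(1)])
    then have "ucont R Y (\<lambda>z. ?k (b z i))"
      by (rule ucont_comp[OF ucont_comp[OF ucont_comp[OF _ proj] uiso_ucont'[OF iso]] ucont_usub_incl[OF L(1)]])
    then have gh: "g \<in> hom R Y"
      unfolding g_def by (rule restrict_hom[OF uR])
    have gr: "g (r x) = f x" if x: "x \<in> points X" for x
    proof -
      have "g (r x) = ?k (b (r x) i)"
        using hom_point[OF R(3) x] by (simp add: g_def)
      also have "b (r x) i = \<theta> (f x)"
        using br[OF x] iI x by (simp add: d_def i_def)
      also have "?k (\<theta> (f x)) = f x"
        by (rule uiso_left[OF iso hom_point[OF L(3) x]])
      finally show ?thesis .
    qed
    have fe: "f \<in> extensional (points X)"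
      using f by (simp add: hom_iff)
    show "\<exists>!g. g \<in> hom R Y \<and> comp_from X g r = f"
    proof (rule ex1I[of _ g], intro conjI gh)
      show "comp_from X g r = f"
        using gr by (simp add: compose_eq_restrict[OF fe])
      fix h assume h: "h \<in> hom R Y \<and> comp_from X h r = f"
      have "epimorphism X R r"
        by (rule dense_epimorphism[OF C_T2Unif[OF R(2)] R(3,4)])
      then show "h = g"
        unfolding epimorphism_def using C_T2Unif[OF Y] h gh \<open>comp_from X g r = f\<close> by metis
    qed
  qed
  then show "\<exists>R r. reflection_arrow C X R r"
    by blast
qed

lemma epireflective: "epireflective C"
  unfolding epireflective_def using reflective reflection_epimorphism by blast

end


section \<open>Covering character\<close>

lemma uniform_cover_entourage:
  assumes X: "is_uspace X" and E: "E \<in> entourages X"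
  shows "uniform_cover X {E `` {x} | x. x \<in> points X}"
  unfolding uniform_cover_def
proof (intro conjI bexI[OF _ E] ballI)
  have "x \<in> E `` {x}" if "x \<in> points X" for x
    using ent_refl[OF X E that] by simp
  then show "\<Union>{E `` {x} | x. x \<in> points X} = points X"
    using ent_sub[OF X E] by blast
  show "\<exists>A\<in>{E `` {x} | x. x \<in> points X}. E `` {x} \<subseteq> A" if "x \<in> points X" for x
    using that by blast
qed

text \<open>In a refinement of the cover by D-balls each member contains at most one point of A if
  \<open>D O D\<close> lies in E, so A injects into the refinement. Conversely, balls around a
  maximal D-separated set form a uniform cover that is no larger than this set.\<close>

lemma has_cover_base_below_iff:
  assumes X: "is_uspace X"
  shows "has_cover_base_below X l \<longleftrightarrow> separated_below X l"
proof
  assume "has_cover_base_below X l"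
  then obtain B where B: "\<forall>\<V>\<in>B. uniform_cover X \<V> \<and> |\<V>| <o l"
    "\<forall>\<U>. uniform_cover X \<U> \<longrightarrow> (\<exists>\<V>\<in>B. refines \<V> \<U>)"
    unfolding has_cover_base_below_def by (elim exE conjE)
  show "separated_below X l"
    unfolding separated_below_def
  proof (intro ballI allI impI)
    fix E A assume E: "E \<in> entourages X" and A: "A \<subseteq> points X \<and> separated E A"
    obtain D where D: "D \<in> usym X" "D O D \<subseteq> E"
      using usym_half[OF X E] by blast
    have "uniform_cover X {D `` {x} | x. x \<in> points X}"
      by (rule uniform_cover_entourage[OF X usym_ent[OF D(1)]])
    then obtain \<V> where V: "\<V> \<in> B" "refines \<V> {D `` {x} | x. x \<in> points X}"
      using B(2)[rule_format] by blast
    have cover: "\<Union>\<V> = points X" and less: "|\<V>| <o l"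
      using B(1) V(1) by (simp_all add: uniform_cover_def)
    have "\<forall>a\<in>A. \<exists>V. V \<in> \<V> \<and> a \<in> V"
      using A cover by blast
    then obtain v where v: "\<And>a. a \<in> A \<Longrightarrow> v a \<in> \<V> \<and> a \<in> v a"
      unfolding bchoice_iff by blast
    have "inj_on v A"
    proof (rule inj_onI)
      fix a b assume ab: "a \<in> A" "b \<in> A" "v a = v b"
      obtain x where x: "v a \<subseteq> D `` {x}"
        using V(2)[unfolded refines_def, rule_format, of "v a"] v[OF ab(1)] by blast
      have "a \<in> v a" "b \<in> v a"
        using v[OF ab(1)] v[OF ab(2)] ab(3) by simp_all
      then have "(x, a) \<in> D" "(x, b) \<in> D"
        using x by blast+
      then have "(a, b) \<in> E"
        using usym_sym[OF D(1)] D(2) by blast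
      then show "a = b"
        using A ab(1,2) unfolding separated_def by blast
    qed
    moreover have "v ` A \<subseteq> \<V>"
      using v by blast
    ultimately have "|A| \<le>o |\<V>|"
      using card_of_ordLeq by blast
    then show "|A| <o l"
      using less by (rule ordLeq_ordLess_trans)
  qed
next
  assume sep: "separated_below X l"
  show "has_cover_base_below X l"
    unfolding has_cover_base_below_def
  proof (intro exI[of _ "{\<V>. uniform_cover X \<V> \<and> |\<V>| <o l}"] conjI allI impI)
    fix \<U> assume "uniform_cover X \<U>"
    then obtain E where E: "E \<in> entourages X" "\<forall>x\<in>points X. \<exists>A\<in>\<U>. E `` {x} \<subseteq> A"
      unfolding uniform_cover_def by blast
    obtain D where D: "D \<in> usym X" "D O D \<subseteq> E"
      using usym_half[OF X E(1)] by blast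
    obtain A where A: "A \<subseteq> points X" "separated D A" "\<forall>z\<in>points X. \<exists>a\<in>A. (a, z) \<in> D"
      using ex_net[OF X D(1)] by blast
    \<comment> \<open>The radius is \<open>D O D\<close> because each D-ball has to lie inside one
      member of the cover.\<close>
    define \<V> where "\<V> = (\<lambda>a. (D O D) `` {a}) ` A"
    have "|A| <o l"
      using sep usym_ent[OF D(1)] A(1,2) by (simp add: separated_below_def)
    then have "|\<V>| <o l"
      unfolding \<V>_def by (rule ordLeq_ordLess_trans[OF card_of_image])
    moreover have near: "\<exists>V\<in>\<V>. D `` {x} \<subseteq> V" if x: "x \<in> points X" for x
    proof -
      obtain a where a: "a \<in> A" "(a, x) \<in> D"
        using A(3) x by blast
      then have "D `` {x} \<subseteq> (D O D) `` {a}"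
        by blast
      then show ?thesis
        unfolding \<V>_def using a(1) by blast
    qed
    have "uniform_cover X \<V>"
      unfolding uniform_cover_def
    proof (intro conjI bexI[OF _ usym_ent[OF D(1)]] ballI near)
      show "\<Union>\<V> = points X"
      proof (intro subset_antisym subsetI)
        fix x assume x: "x \<in> points X"
        then have "x \<in> D `` {x}"
          using usym_refl[OF X D(1)] by blast
        then show "x \<in> \<Union>\<V>"
          using near[OF x] by blast
      qed (use ent_sub[OF X usym_ent[OF D(1)]] in \<open>auto simp: \<V>_def\<close>)
    qed
    moreover have "refines \<V> \<U>"
      unfolding refines_def
    proof
      fix V assume "V \<in> \<V>"
      then obtain a where a: "a \<in> A" "V = (D O D) `` {a}"
        by (auto simp: \<V>_def)
      then have "V \<subseteq> E `` {a}"
        using D(2) by blast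
      moreover obtain W where "W \<in> \<U>" "E `` {a} \<subseteq> W"
        using E(2) a(1) A(1) by blast
      ultimately show "\<exists>W\<in>\<U>. V \<subseteq> W"
        by blast
    qed
    ultimately show "\<exists>\<V>\<in>{\<V>. uniform_cover X \<V> \<and> |\<V>| <o l}. refines \<V> \<U>"
      by blast
  qed simp
qed

lemma separated_below_mono: "separated_below X l \<Longrightarrow> l \<le>o l' \<Longrightarrow> separated_below X l'"
  unfolding separated_below_def using ordLess_ordLeq_trans by blast

text \<open>Every nonempty set of cardinals has a least member, so if \<open>l0\<close> is a bound
  for X, the least bound exists and is at most \<open>l0\<close>; conversely the condition is
  monotone in the bound.\<close>

lemma covering_character_le_iff:
  fixes X :: "'u uspace" and l0 :: "'u rel"
  assumes X: "is_uspace X" and l0: "Cinfinite l0"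
  shows "(\<exists>l. is_covering_character X l \<and> l \<le>o l0) \<longleftrightarrow> separated_below X l0"
proof
  assume "\<exists>l. is_covering_character X l \<and> l \<le>o l0"
  then obtain l :: "'u rel" where "separated_below X l" "l \<le>o l0"
    unfolding is_covering_character_def has_cover_base_below_iff[OF X] by blast
  then show "separated_below X l0"
    by (rule separated_below_mono)
next
  assume sep: "separated_below X l0"
  define R where "R = {m :: 'u rel. Cinfinite m \<and> separated_below X m}"
  have "l0 \<in> R"
    using l0 sep by (simp add: R_def)
  moreover have "\<forall>r\<in>R. Card_order r"
    by (simp add: R_def)
  ultimately obtain l where l: "l \<in> R" "\<forall>r\<in>R. l \<le>o r"
    using exists_minim_Card_order[of R] by blast
  then have "is_covering_character X l"
    unfolding is_covering_character_def has_cover_base_below_iff[OF X] by (simp add: R_def)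
  then show "\<exists>l. is_covering_character X l \<and> l \<le>o l0"
    using l(2) \<open>l0 \<in> R\<close> by blast
qed

text \<open>Each point of the separated set is D-close to the value of f at some chosen point of X.
  If two chosen points were G-close, the original points would be three D-steps apart; so the chosen
  points are distinct and G-separated.\<close>

lemma separated_below_dense_image:
  assumes X: "is_uspace X" and Y: "is_uspace Y" and sep: "separated_below X l"
    and f: "ucont X Y f" and dense: "dense_in Y (f ` points X)"
  shows "separated_below Y l"
  unfolding separated_below_def
proof (intro ballI allI impI)
  fix E A assume E: "E \<in> entourages Y" and A: "A \<subseteq> points Y \<and> separated E A"
  obtain D where D: "D \<in> entourages Y" "sym D" "D O D O D \<subseteq> E"
    using ent_quarter_sym[OF Y E] by blast
  have "\<forall>a\<in>A. \<exists>x. x \<in> points X \<and> (a, f x) \<in> D"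
    using A dense D(1) unfolding dense_in_def by blast
  then obtain p where p: "\<And>a. a \<in> A \<Longrightarrow> p a \<in> points X \<and> (a, f (p a)) \<in> D"
    unfolding bchoice_iff by blast
  obtain G where G: "G \<in> entourages X" "\<forall>x y. (x, y) \<in> G \<longrightarrow> (f x, f y) \<in> D"
    using ucont_entD[OF f D(1)] by blast
  have close: "a = b" if "a \<in> A" "b \<in> A" "(p a, p b) \<in> G" for a b
  proof -
    have "(a, f (p a)) \<in> D" "(f (p a), f (p b)) \<in> D" "(f (p b), b) \<in> D"
      using p that G(2) D(2) by (auto dest: symD)
    then have "(a, b) \<in> E"
      using D(3) by blast
    then show ?thesis
      using A that unfolding separated_def by blast
  qed
  have inj: "inj_on p A"
  proof (rule inj_onI)
    fix a b assume "a \<in> A" "b \<in> A" "p a = p b"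
    then show "a = b"
      using close ent_refl[OF X G(1)] p by simp
  qed
  have "separated G (p ` A)"
    unfolding separated_def using close by blast
  moreover have "p ` A \<subseteq> points X"
    using p by blast
  ultimately have "|p ` A| <o l"
    using sep G(1) by (simp add: separated_below_def)
  moreover have "|A| \<le>o |p ` A|"
    using inj card_of_ordLeq by blast
  ultimately show "|A| <o l"
    using ordLeq_ordLess_trans by blast
qed

lemma separated_below_usub:
  assumes "separated_below X l" "S \<subseteq> points X"
  shows "separated_below (usub X S) l"
  unfolding separated_below_def
proof (intro ballI allI impI)
  fix E A assume "E \<in> entourages (usub X S)" and A: "A \<subseteq> points (usub X S) \<and> separated E A"
  then obtain D where D: "D \<in> entourages X" "E = D \<inter> S \<times> S"
    by (auto simp: entourages_usub)
  have "separated D A"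
    using A unfolding D(2) separated_def by auto
  then have "A \<subseteq> points X \<and> separated D A"
    using A assms(2) by auto
  then show "|A| <o l"
    by (rule assms(1)[unfolded separated_below_def, rule_format, OF D(1)])
qed

lemma PiE_ordLess_Cinfinite:
  assumes l: "Cinfinite l" and "finite J" "\<And>i. i \<in> J \<Longrightarrow> |N i| <o l"
  shows "|PiE J N| <o l"
  using assms(2,3)
proof (induction J)
  case empty
  then show ?case
    by (simp add: finite_ordLess_Cinfinite[OF l])
next
  case (insert i J)
  have "|N i \<times> PiE J N| <o l"
    using insert by (intro Times_ordLess_Cinfinite[OF l]) simp_all
  then have "|(\<lambda>(y, g). g(i := y)) ` (N i \<times> PiE J N)| <o l"
    by (rule ordLeq_ordLess_trans[OF card_of_image])
  then show ?case
    by (simp add: PiE_insert_eq)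
qed

text \<open>An entourage of the product sees only finitely many coordinates. Assigning to each point
  nearby net points in these coordinates is injective on a separated set, and finite products of
  cardinals below the infinite \<open>l\<close> stay below \<open>l\<close>.\<close>

lemma separated_below_uproduct:
  assumes l: "Cinfinite l" and Y: "\<And>i. i \<in> I \<Longrightarrow> is_uspace (Y i)"
    and sep: "\<And>i. i \<in> I \<Longrightarrow> separated_below (Y i) l"
  shows "separated_below (uproduct I Y) l"
  unfolding separated_below_def
proof (intro ballI allI impI)
  fix E A assume E: "E \<in> entourages (uproduct I Y)" and A: "A \<subseteq> points (uproduct I Y) \<and> separated E A"
  obtain J F where J: "finite J" "J \<subseteq> I" "\<forall>i\<in>J. F i \<in> entourages (Y i)"
    "init_ent (points (uproduct I Y)) J (\<lambda>i x. x i) F \<subseteq> E"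
    by (rule initial_forE[OF initial_for_uproduct E])
  have "\<exists>D. D \<in> usym (Y i) \<and> D O D \<subseteq> F i" if "i \<in> J" for i
  proof -
    have "is_uspace (Y i)"
      using Y J(2) that by blast
    then show ?thesis
      using usym_half bspec[OF J(3) that] by blast
  qed
  then have "\<forall>i\<in>J. \<exists>D. D \<in> usym (Y i) \<and> D O D \<subseteq> F i"
    by blast
  then obtain D where D: "\<And>i. i \<in> J \<Longrightarrow> D i \<in> usym (Y i) \<and> D i O D i \<subseteq> F i"
    unfolding bchoice_iff by blast
  have "\<exists>N. N \<subseteq> points (Y i) \<and> separated (D i) N \<and> (\<forall>z\<in>points (Y i). \<exists>n\<in>N. (n, z) \<in> D i)" if "i \<in> J" for i
  proof -
    have "is_uspace (Y i)"
      using Y J(2) that by blast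
    then show ?thesis
      using D[OF that] by (intro ex_net) simp_all
  qed
  then have "\<forall>i\<in>J. \<exists>N. N \<subseteq> points (Y i) \<and> separated (D i) N \<and> (\<forall>z\<in>points (Y i). \<exists>n\<in>N. (n, z) \<in> D i)"
    by blast
  then obtain N where N: "\<forall>i\<in>J. N i \<subseteq> points (Y i) \<and> separated (D i) (N i) \<and>
      (\<forall>z\<in>points (Y i). \<exists>n\<in>N i. (n, z) \<in> D i)"
    unfolding bchoice_iff by blast
  have "|N i| <o l" if "i \<in> J" for i
  proof -
    have "separated_below (Y i) l" "D i \<in> entourages (Y i)"
      using sep J(2) that D[OF that] usym_ent by blast+
    then show ?thesis
      using bspec[OF N that] by (simp add: separated_below_def)
  qed
  then have PN: "|PiE J N| <o l"
    by (rule PiE_ordLess_Cinfinite[OF l J(1)])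
  define c where "c a = (\<lambda>i\<in>J. SOME n. n \<in> N i \<and> (n, a i) \<in> D i)" for a
  have c: "c a i \<in> N i \<and> (c a i, a i) \<in> D i" if "a \<in> A" "i \<in> J" for a i
  proof -
    have "a \<in> points (uproduct I Y)"
      using A that(1) by blast
    then have "a i \<in> points (Y i)"
      using J(2) that(2) by auto
    then have "\<exists>n. n \<in> N i \<and> (n, a i) \<in> D i"
      using bspec[OF N that(2)] by blast
    then have "(SOME n. n \<in> N i \<and> (n, a i) \<in> D i) \<in> N i \<and> ((SOME n. n \<in> N i \<and> (n, a i) \<in> D i), a i) \<in> D i"
      by (rule someI_ex)
    then show ?thesis
      using that(2) by (simp add: c_def)
  qed
  have "inj_on c A"
  proof (rule inj_onI)
    fix a b assume ab: "a \<in> A" "b \<in> A" "c a = c b"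
    have "(a i, b i) \<in> F i" if i: "i \<in> J" for i
    proof -
      have cD: "(c a i, a i) \<in> D i" "(c a i, b i) \<in> D i"
        using c[OF ab(1) i] c[OF ab(2) i] ab(3) by simp_all
      have "(a i, c a i) \<in> D i"
        by (rule usym_sym[OF conjunct1[OF D[OF i]] cD(1)])
      then have "(a i, b i) \<in> D i O D i"
        using cD(2) by (rule relcompI)
      then show ?thesis
        using D[OF i] by blast
    qed
    then have "(a, b) \<in> init_ent (points (uproduct I Y)) J (\<lambda>i x. x i) F"
      using A ab by (auto simp: init_ent_def simp del: points_uproduct)
    then have "(a, b) \<in> E"
      using J(4) by blast
    then show "a = b"
      using A ab(1,2) unfolding separated_def by blast
  qed
  moreover have "c ` A \<subseteq> PiE J N"
    using c by (auto simp: c_def)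
  ultimately have "|A| \<le>o |PiE J N|"
    using card_of_ordLeq by blast
  then show "|A| <o l"
    using PN by (rule ordLeq_ordLess_trans)
qed


section \<open>Closure properties of the classes in the list\<close>

lemma uiso_dense: "is_uspace Y \<Longrightarrow> uiso X Y j k \<Longrightarrow> dense_in Y (j ` points X)"
  by (rule surj_dense_in) (simp_all add: uiso_image)

lemma trivial_dense_image:
  assumes "is_uspace X" and Y: "t2space Y" and triv: "\<forall>a\<in>points X. \<forall>b\<in>points X. a = b"
    and f: "ucont X Y f" and dense: "dense_in Y (f ` points X)"
  shows "\<forall>a\<in>points Y. \<forall>b\<in>points Y. a = b"
proof (intro ballI)
  have uY: "is_uspace Y"
    by (rule t2space_uspace[OF Y])
  fix a b assume a: "a \<in> points Y" and b: "b \<in> points Y"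
  show "a = b"
  proof (rule t2spaceD[OF Y a b])
    fix E assume "E \<in> entourages Y"
    then obtain D where D: "D \<in> usym Y" "D O D \<subseteq> E"
      using usym_half[OF uY] by blast
    obtain x where x: "x \<in> points X" "(a, f x) \<in> D"
      using dense a usym_ent[OF D(1)] unfolding dense_in_def by blast
    obtain y where y: "y \<in> points X" "(b, f y) \<in> D"
      using dense b usym_ent[OF D(1)] unfolding dense_in_def by blast
    have "x = y"
      using triv x(1) y(1) by blast
    then show "(a, b) \<in> E"
      using x(2) usym_sym[OF D(1) y(2)] D(2) by blast
  qed
qed

text \<open>The image of a compact space is compact and hence closed in a Hausdorff space; being
  dense, it is everything.\<close>

lemma compact_dense_image:
  assumes X: "is_uspace X" and Y: "t2space Y" and comp: "compact_space (utopology X)"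
    and f: "ucont X Y f" and dense: "dense_in Y (f ` points X)"
  shows "f ` points X = points Y" "compact_space (utopology Y)"
proof -
  have uY: "is_uspace Y"
    by (rule t2space_uspace[OF Y])
  have "compactin (utopology Y) (f ` topspace (utopology X))"
    using image_compactin[OF _ ucont_continuous_map[OF X uY f]] comp unfolding compact_space_def by blast
  then have "closedin (utopology Y) (f ` points X)"
    using Y Hausdorff_utopology[OF uY] compactin_imp_closedin
    by (auto simp: topspace_utopology[OF X] t2space_def)
  then show surj: "f ` points X = points Y"
    using dense ucontD[OF f] unfolding dense_in_closure_of[OF uY] by (auto simp: closure_of_closedin)
  show "compact_space (utopology Y)"
    by (rule ucont_compact_image[OF X uY f surj comp])
qed

section \<open>Categorical closure conditions in concrete form, and their verification for the
  listed classes\<close>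

context inaccessible
begin

lemma image_closedI:
  fixes C :: "'u uspace set"
  assumes CT: "C \<subseteq> T2Unif"
    and step: "\<And>X Y f. X \<in> C \<Longrightarrow> Y \<in> T2Unif \<Longrightarrow> ucont X Y f \<Longrightarrow> dense_in Y (f ` points X) \<Longrightarrow> Y \<in> C"
  shows "closed_under_images epimorphism C"
  unfolding closed_under_images_def
proof (intro ballI allI impI)
  fix X Y e assume X: "X \<in> C" and Y: "Y \<in> T2Unif" and e: "epimorphism X Y e"
  have "dense_in Y (e ` points X)"
    using epimorphism_dense[OF _ Y e] CT X by blast
  then show "Y \<in> C"
    by (rule step[OF X Y hom_ucont[OF epimorphism_hom[OF e]]])
qed

lemma subobject_closedI:
  fixes C :: "'u uspace set"
  assumes C: "subcategory C"
    and step: "\<And>Y S. Y \<in> C \<Longrightarrow> closedin (utopology Y) S \<Longrightarrow> usub Y S \<in> C"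
  shows "closed_under_extremal_subobjects C"
  unfolding closed_under_extremal_subobjects_def
proof (intro ballI allI impI)
  fix Y X m assume Y: "Y \<in> C" and X: "X \<in> T2Unif" and m: "extremal_mono X Y m"
  have "Y \<in> T2Unif"
    using C Y by (auto simp: subcategory_def)
  then obtain S k where S: "closedin (utopology Y) S" "uiso X (usub Y S) m k"
    using extremal_mono_closed[OF X _ m] by blast
  show "X \<in> C"
    by (rule subcategory_uiso[OF C step[OF Y S(1)] X S(2)])
qed

lemma product_closedI:
  fixes C :: "'u uspace set"
  assumes CT: "C \<subseteq> T2Unif"
    and step: "\<And>(I :: 'u set) X P j k. \<lbrakk>small I; \<And>i. i \<in> I \<Longrightarrow> X i \<in> C; P \<in> T2Unif; uiso (uproduct I X) P j k\<rbrakk> \<Longrightarrow> P \<in> C"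
  shows "closed_under_products C"
  unfolding closed_under_products_def
proof (intro allI impI)
  fix I X P p assume a: "small I \<and> (\<forall>i\<in>I. X i \<in> C) \<and> is_product I X P p"
  then have XT: "X i \<in> T2Unif" if "i \<in> I" for i
    using CT that by blast
  obtain j k where "uiso P (uproduct I X) j k"
    using is_product_uiso[of I X P p] a XT by blast
  then have "uiso (uproduct I X) P k j"
    by (rule uiso_sym)
  moreover have "P \<in> T2Unif"
    using a by (simp add: is_product_def)
  ultimately show "P \<in> C"
    using step[of I X P k j] a by blast
qed

lemma listed_forms:
  fixes C :: "'u uspace set"
  shows "of_listed_form C \<longleftrightarrow>
   C = {X \<in> T2Unif. \<forall>a\<in>points X. \<forall>b\<in>points X. a = b} \<or>
   C = {X \<in> T2Unif. compact_space (utopology X)} \<or>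
   (\<exists>l0 :: 'u rel. Cinfinite l0 \<and> l0 <o |UNIV :: 'u set| \<and> C = {X \<in> T2Unif. separated_below X l0}) \<or>
   C = T2Unif"
proof -
  have "finite S \<and> card S \<le> 1 \<longleftrightarrow> (\<forall>a\<in>S. \<forall>b\<in>S. a = b)" for S :: "'u set"
  proof
    assume "\<forall>a\<in>S. \<forall>b\<in>S. a = b"
    then have "S = {} \<or> (\<exists>a. S = {a})"
      by blast
    then show "finite S \<and> card S \<le> 1"
      by auto
  next
    assume "finite S \<and> card S \<le> 1"
    then show "\<forall>a\<in>S. \<forall>b\<in>S. a = b"
      using card_le_Suc0_iff_eq[of S] by simp
  qed
  moreover have "{X \<in> T2Unif. \<exists>l. is_covering_character X l \<and> l \<le>o l0} =
      {X \<in> (T2Unif :: 'u uspace set). separated_below X l0}"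
    if "Cinfinite l0" for l0 :: "'u rel"
    by (intro Collect_cong conj_cong refl) (rule covering_character_le_iff[OF T2Unif_uspace that])
  ultimately show ?thesis
    unfolding of_listed_form_def by (intro disj_cong refl) (auto cong: conj_cong)
qed

lemma trivial_class:
  fixes C :: "'u uspace set"
  assumes C: "C = {X \<in> T2Unif. \<forall>a\<in>points X. \<forall>b\<in>points X. a = b}" and sub: "subcategory C"
  shows "closed_under_products C" "closed_under_extremal_subobjects C" "closed_under_images epimorphism C"
proof -
  show "closed_under_images epimorphism C"
  proof (rule image_closedI)
    fix X Y :: "'u uspace" and f assume "X \<in> C" "Y \<in> T2Unif" "ucont X Y f" "dense_in Y (f ` points X)"
    then show "Y \<in> C"
      using trivial_dense_image[of X Y f] T2Unif_uspace T2Unif_t2space unfolding C by blast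
  qed (simp add: C)
  show "closed_under_extremal_subobjects C"
  proof (rule subobject_closedI[OF sub])
    fix Y :: "'u uspace" and S assume Y: "Y \<in> C" and S: "closedin (utopology Y) S"
    have "Y \<in> T2Unif"
      using Y by (simp add: C)
    then have SY: "S \<subseteq> points Y" and "usub Y S \<in> T2Unif"
      using closedin_points[OF T2Unif_uspace S] usub_T2Unif by blast+
    then show "usub Y S \<in> C"
      using Y unfolding C by auto
  qed
  show "closed_under_products C"
  proof (rule product_closedI)
    fix I :: "'u set" and X :: "'u \<Rightarrow> 'u uspace" and P :: "'u uspace" and j k
    assume X: "\<And>i. i \<in> I \<Longrightarrow> X i \<in> C" and P: "P \<in> T2Unif" and iso: "uiso (uproduct I X) P j k"
    have "a = b" if a: "a \<in> points P" and b: "b \<in> points P" for a b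
    proof -
      have kab: "k a \<in> points (uproduct I X)" "k b \<in> points (uproduct I X)"
        using ucontD[OF uiso_ucont'[OF iso]] a b by blast+
      have "k a = k b"
      proof (rule PiE_ext)
        fix i assume i: "i \<in> I"
        then have "k a i \<in> points (X i)" "k b i \<in> points (X i)"
          using kab by auto
        then show "k a i = k b i"
          using X[OF i] unfolding C by blast
      qed (use kab in simp_all)
      then have "j (k a) = j (k b)"
        by (rule arg_cong)
      then show ?thesis
        unfolding uiso_right[OF iso a] uiso_right[OF iso b] .
    qed
    then show "P \<in> C"
      using P unfolding C by blast
  qed (simp add: C)
qed

lemma compact_class:
  fixes C :: "'u uspace set"
  assumes C: "C = {X \<in> T2Unif. compact_space (utopology X)}" and sub: "subcategory C"
  shows "closed_under_products C" "closed_under_extremal_subobjects C" "closed_under_images epimorphism C"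
proof -
  show "closed_under_images epimorphism C"
  proof (rule image_closedI)
    fix X Y :: "'u uspace" and f assume "X \<in> C" "Y \<in> T2Unif" "ucont X Y f" "dense_in Y (f ` points X)"
    then show "Y \<in> C"
      using compact_dense_image(2)[of X Y f] T2Unif_uspace T2Unif_t2space unfolding C by blast
  qed (simp add: C)
  show "closed_under_extremal_subobjects C"
  proof (rule subobject_closedI[OF sub])
    fix Y :: "'u uspace" and S assume Y: "Y \<in> C" and S: "closedin (utopology Y) S"
    have YT: "Y \<in> T2Unif" and comp: "compact_space (utopology Y)"
      using Y by (simp_all add: C)
    show "usub Y S \<in> C"
      using usub_T2Unif[OF YT closedin_points[OF T2Unif_uspace[OF YT] S]]
        compact_usub[OF T2Unif_uspace[OF YT] comp S] by (simp add: C)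
  qed
  show "closed_under_products C"
  proof (rule product_closedI)
    fix I :: "'u set" and X :: "'u \<Rightarrow> 'u uspace" and P :: "'u uspace" and j k
    assume X: "\<And>i. i \<in> I \<Longrightarrow> X i \<in> C" and P: "P \<in> T2Unif" and iso: "uiso (uproduct I X) P j k"
    have uX: "is_uspace (X i)" and cX: "compact_space (utopology (X i))" if "i \<in> I" for i
      using X[OF that] T2Unif_uspace by (auto simp: C)
    have uI: "is_uspace (uproduct I X)"
      by (rule is_uspace_uproduct) (rule uX)
    have "compact_space (utopology (uproduct I X))"
      by (rule compact_uproduct[OF uX cX])
    then have "compact_space (utopology P)"
      by (rule ucont_compact_image[OF uI T2Unif_uspace[OF P] uiso_ucont[OF iso] uiso_image[OF iso]])
    then show "P \<in> C"
      using P by (simp add: C)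
  qed (simp add: C)
qed

lemma separated_below_class:
  fixes C :: "'u uspace set"
  assumes C: "C = {X \<in> T2Unif. separated_below X l}" and l: "Cinfinite l" and sub: "subcategory C"
  shows "closed_under_products C" "closed_under_extremal_subobjects C" "closed_under_images epimorphism C"
proof -
  show "closed_under_images epimorphism C"
  proof (rule image_closedI)
    fix X Y :: "'u uspace" and f assume "X \<in> C" "Y \<in> T2Unif" "ucont X Y f" "dense_in Y (f ` points X)"
    then show "Y \<in> C"
      using separated_below_dense_image[of X Y l f] T2Unif_uspace unfolding C by blast
  qed (simp add: C)
  show "closed_under_extremal_subobjects C"
  proof (rule subobject_closedI[OF sub])
    fix Y :: "'u uspace" and S assume Y: "Y \<in> C" and S: "closedin (utopology Y) S"
    have YT: "Y \<in> T2Unif" and sep: "separated_below Y l"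
      using Y by (simp_all add: C)
    have SY: "S \<subseteq> points Y"
      by (rule closedin_points[OF T2Unif_uspace[OF YT] S])
    show "usub Y S \<in> C"
      using usub_T2Unif[OF YT SY] separated_below_usub[OF sep SY] by (simp add: C)
  qed
  show "closed_under_products C"
  proof (rule product_closedI)
    fix I :: "'u set" and X :: "'u \<Rightarrow> 'u uspace" and P :: "'u uspace" and j k
    assume X: "\<And>i. i \<in> I \<Longrightarrow> X i \<in> C" and P: "P \<in> T2Unif" and iso: "uiso (uproduct I X) P j k"
    have uX: "is_uspace (X i)" and sX: "separated_below (X i) l" if "i \<in> I" for i
      using X[OF that] T2Unif_uspace by (auto simp: C)
    have uP: "is_uspace P"
      by (rule T2Unif_uspace[OF P])
    have uI: "is_uspace (uproduct I X)"
      by (rule is_uspace_uproduct) (rule uX)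
    have "separated_below (uproduct I X) l"
      by (rule separated_below_uproduct[OF l uX sX])
    then have "separated_below P l"
      by (rule separated_below_dense_image[OF uI uP _ uiso_ucont[OF iso] uiso_dense[OF uP iso]])
    then show "P \<in> C"
      using P by (simp add: C)
  qed (simp add: C)
qed

lemma listed_closed:
  fixes C :: "'u uspace set"
  assumes "of_listed_form C" and sub: "subcategory C"
  shows "closed_under_products C \<and> closed_under_extremal_subobjects C \<and> closed_under_images epimorphism C"
proof -
  have "closed_under_products (T2Unif :: 'u uspace set)"
    by (rule product_closedI) simp_all
  moreover have "closed_under_extremal_subobjects (T2Unif :: 'u uspace set)"
    "closed_under_images epimorphism (T2Unif :: 'u uspace set)"
    by (simp_all add: closed_under_extremal_subobjects_def closed_under_images_def)
  ultimately have all: "closed_under_products C \<and> closed_under_extremal_subobjects C \<and>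
      closed_under_images epimorphism C" if "C = T2Unif"
    using that by simp
  show ?thesis
    using assms(1) unfolding listed_forms
  proof (elim disjE exE conjE)
    assume "C = {X \<in> T2Unif. \<forall>a\<in>points X. \<forall>b\<in>points X. a = b}"
    then show ?thesis
      by (intro conjI trivial_class[OF _ sub])
  next
    assume "C = {X \<in> T2Unif. compact_space (utopology X)}"
    then show ?thesis
      by (intro conjI compact_class[OF _ sub])
  next
    fix l0 :: "'u rel" assume "cinfinite l0" "Card_order l0" and eq: "C = {X \<in> T2Unif. separated_below X l0}"
    then have l: "Cinfinite l0"
      by simp
    show ?thesis
      using separated_below_class[OF eq l sub] by simp
  qed (rule all)
qed

lemma of_listed_form_iff:
  fixes C :: "'u uspace set"
  assumes sub: "subcategory C"
  shows "of_listed_form C \<longleftrightarrow>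
     closed_under_products C \<and> closed_under_extremal_subobjects C \<and> closed_under_images epimorphism C"
proof
  assume "closed_under_products C \<and> closed_under_extremal_subobjects C \<and> closed_under_images epimorphism C"
  then interpret image_closed U C
    using sub by unfold_locales simp_all
  show "of_listed_form C"
    unfolding listed_forms by (rule classification)
qed (rule listed_closed[OF _ sub])

lemma epireflective_iff:
  fixes C :: "'u uspace set"
  assumes sub: "subcategory C"
  shows "epireflective C \<longleftrightarrow> closed_under_products C \<and> closed_under_extremal_subobjects C"
proof
  assume "closed_under_products C \<and> closed_under_extremal_subobjects C"
  then interpret prod_closed U C
    using sub by unfold_locales simp_all
  show "epireflective C"
    by (rule epireflective)
qed (use epireflective_products[OF sub] epireflective_extremal_subobjects[OF sub] in blast)

lemma epimorphism_images_iff: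
  fixes C :: "'u uspace set"
  assumes sub: "subcategory C"
  shows "closed_under_images epimorphism C \<longleftrightarrow> closed_under_images bimorphism C \<and> closed_under_images extremal_epi C"
proof
  assume "closed_under_images epimorphism C"
  then show "closed_under_images bimorphism C \<and> closed_under_images extremal_epi C"
    unfolding closed_under_images_def bimorphism_def extremal_epi_def by blast
next
  assume img: "closed_under_images bimorphism C \<and> closed_under_images extremal_epi C"
  show "closed_under_images epimorphism C"
    unfolding closed_under_images_def
  proof (intro ballI allI impI)
    fix X Y e assume X: "X \<in> C" and Y: "Y \<in> T2Unif" and e: "epimorphism X Y e"
    have XT: "X \<in> T2Unif"
      using sub X by (auto simp: subcategory_def)
    obtain Q q m where Q: "Q \<in> T2Unif" "extremal_epi X Q q" "bimorphism Q Y m"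
      using epimorphism_factor[OF XT Y e] by blast
    have "Q \<in> C"
      using img X Q(1,2) unfolding closed_under_images_def by blast
    then show "Y \<in> C"
      using img Y Q(3) unfolding closed_under_images_def by blast
  qed
qed

end


section \<open>Independence of the four closure properties\<close>

lemma subcategoryI:
  assumes "C \<subseteq> T2Unif"
    and "\<And>X Y j k. X \<in> C \<Longrightarrow> Y \<in> T2Unif \<Longrightarrow> uiso X Y j k \<Longrightarrow> Y \<in> C"
  shows "subcategory C"
  unfolding subcategory_def
proof (intro conjI assms(1) ballI impI)
  fix X Y assume X: "X \<in> C" and Y: "Y \<in> T2Unif" and "\<exists>f. isomorphism X Y f"
  then obtain f k where "uiso X Y f k"
    using isomorphism_uiso by blast
  then show "Y \<in> C"
    by (rule assms(2)[OF X Y])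
qed

lemma closed_map_compact_Hausdorff:
  assumes X: "compact_space X" and Y: "Hausdorff_space Y" and f: "continuous_map X Y f"
  shows "closed_map X Y f"
  unfolding closed_map_def
proof (intro allI impI)
  fix S assume "closedin X S"
  then have "compactin X S"
    by (rule closedin_compact_space[OF X])
  then show "closedin Y (f ` S)"
    by (intro compactin_imp_closedin[OF Y] image_compactin[OF _ f])
qed

lemma t2space_Hausdorff: "t2space X \<Longrightarrow> Hausdorff_space (utopology X)"
  using Hausdorff_utopology t2space_uspace unfolding t2space_def by blast

text \<open>The known notion of an omega-bounded space. It passes to products, closed subspaces and
  images under surjections, but not to dense images, as required of a class that fails only
  closedness under bimorphic images.\<close>

definition omega_bounded :: "'a uspace \<Rightarrow> bool" where
  "omega_bounded X \<longleftrightarrow> (\<forall>A. A \<subseteq> points X \<and> countable A \<longrightarrow> (\<exists>K. compactin (utopology X) K \<and> A \<subseteq> K))"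

lemma omega_bounded_image:
  assumes X: "is_uspace X" and Y: "is_uspace Y" and b: "omega_bounded X" and f: "ucont X Y f"
    and surj: "f ` points X = points Y"
  shows "omega_bounded Y"
  unfolding omega_bounded_def
proof (intro allI impI)
  fix A assume A: "A \<subseteq> points Y \<and> countable A"
  define g where "g = inv_into (points X) f"
  have g: "g a \<in> points X" "f (g a) = a" if "a \<in> A" for a
  proof -
    have "a \<in> f ` points X"
      using A surj that by blast
    then show "g a \<in> points X" "f (g a) = a"
      by (simp_all add: g_def inv_into_into f_inv_into_f)
  qed
  have "g ` A \<subseteq> points X \<and> countable (g ` A)"
    using g(1) A by blast
  then obtain K where K: "compactin (utopology X) K" "g ` A \<subseteq> K"
    using b unfolding omega_bounded_def by blast
  have "compactin (utopology Y) (f ` K)"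
    by (rule image_compactin[OF K(1) ucont_continuous_map[OF X Y f]])
  moreover have "A \<subseteq> f ` K"
  proof
    fix a assume a: "a \<in> A"
    then have "g a \<in> K"
      using K(2) by blast
    then show "a \<in> f ` K"
      using g(2)[OF a] by (metis imageI)
  qed
  ultimately show "\<exists>K. compactin (utopology Y) K \<and> A \<subseteq> K"
    by blast
qed

lemma omega_bounded_usub:
  assumes X: "is_uspace X" and b: "omega_bounded X" and S: "closedin (utopology X) S"
  shows "omega_bounded (usub X S)"
  unfolding omega_bounded_def
proof (intro allI impI)
  have SX: "S \<subseteq> points X"
    by (rule closedin_points[OF X S])
  fix A assume A: "A \<subseteq> points (usub X S) \<and> countable A"
  then have "A \<subseteq> points X \<and> countable A"
    using SX by auto
  then obtain K where K: "compactin (utopology X) K" "A \<subseteq> K"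
    using b unfolding omega_bounded_def by blast
  then have "compactin (utopology (usub X S)) (S \<inter> K)"
    unfolding utopology_usub[OF X SX] compactin_subtopology using closed_Int_compactin[OF S] by blast
  then show "\<exists>K. compactin (utopology (usub X S)) K \<and> A \<subseteq> K"
    using K(2) A by (intro exI[of _ "S \<inter> K"]) auto
qed

lemma omega_bounded_uproduct:
  assumes Y: "\<And>i. i \<in> I \<Longrightarrow> is_uspace (Y i)" and b: "\<And>i. i \<in> I \<Longrightarrow> omega_bounded (Y i)"
  shows "omega_bounded (uproduct I Y)"
  unfolding omega_bounded_def
proof (intro allI impI)
  fix A assume A: "A \<subseteq> points (uproduct I Y) \<and> countable A"
  have "\<exists>K. compactin (utopology (Y i)) K \<and> (\<lambda>x. x i) ` A \<subseteq> K" if i: "i \<in> I" for i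
  proof -
    have "(\<lambda>x. x i) ` A \<subseteq> points (Y i) \<and> countable ((\<lambda>x. x i) ` A)"
      using A i by auto
    then show ?thesis
      using b[OF i] unfolding omega_bounded_def by blast
  qed
  then have "\<forall>i\<in>I. \<exists>K. compactin (utopology (Y i)) K \<and> (\<lambda>x. x i) ` A \<subseteq> K"
    by blast
  then obtain K where K: "\<And>i. i \<in> I \<Longrightarrow> compactin (utopology (Y i)) (K i) \<and> (\<lambda>x. x i) ` A \<subseteq> K i"
    unfolding bchoice_iff by blast
  have "compactin (product_topology (\<lambda>i. utopology (Y i)) I) (PiE I K)"
    using K by (simp add: compactin_PiE)
  moreover have "continuous_map (product_topology (\<lambda>i. utopology (Y i)) I) (utopology (uproduct I Y)) (\<lambda>x. x)"
    by (rule uproduct_topology(1)) (rule Y)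
  ultimately have "compactin (utopology (uproduct I Y)) (PiE I K)"
    using image_compactin by fastforce
  moreover have "A \<subseteq> PiE I K"
  proof
    fix x assume x: "x \<in> A"
    have "x i \<in> K i" if "i \<in> I" for i
      using K[OF that] x by blast
    moreover have "x \<in> extensional I"
      using A x by (auto simp: PiE_def)
    ultimately show "x \<in> PiE I K"
      by (simp add: PiE_iff)
  qed
  ultimately show "\<exists>K. compactin (utopology (uproduct I Y)) K \<and> A \<subseteq> K"
    by blast
qed

text \<open>
  The points of countable support form an \<open>\<omega>\<close>-bounded dense subspace of an uncountable cube, but deleting
  the point \<open>1\<close> from the cube leaves a countable set without compact closure.
\<close>

definition countable_support :: "(real \<Rightarrow> bool) set" where
  "countable_support = {x. countable {k. x k}}"

definition punctured :: "(real \<Rightarrow> bool) set" where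
  "punctured = UNIV - {\<lambda>_. True}"

lemma points_cube_UNIV [simp]: "points (cube UNIV) = UNIV"
  by (simp add: points_cube)

lemma cube_entourage_agree:
  assumes "D \<in> entourages (cube (UNIV :: 'k set))"
  shows "\<exists>J. finite J \<and> (\<forall>f g. (\<forall>i\<in>J. f i = g i) \<longrightarrow> (f, g) \<in> D)"
  using entourage_agree[OF assms[unfolded cube_def]] by (simp add: PiE_UNIV_domain)

text \<open>Countably many points of countable support have supports with a countable union T. The
  points supported in T form a closed subset of the compact cube, and all of them have countable
  support.\<close>

lemma omega_bounded_countable_support: "omega_bounded (usub (cube UNIV) countable_support)"
  unfolding omega_bounded_def
proof (intro allI impI)
  fix A assume A: "A \<subseteq> points (usub (cube UNIV) countable_support) \<and> countable A"
  define T where "T = (\<Union>x\<in>A. {k. x k})"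
  have T: "countable T"
    unfolding T_def using A by (intro countable_UN) (auto simp: countable_support_def)
  define K where "K = {x. \<forall>k. x k \<longrightarrow> k \<in> T}"
  have "compact_space (utopology (cube (UNIV :: real set)))"
    unfolding cube_def by (intro compact_uproduct is_uspace_udisc finite_compact) simp
  moreover have "closedin (utopology (cube UNIV)) K"
    unfolding closedin_utopology[OF is_uspace_cube]
  proof (intro conjI ballI impI)
    fix x assume near: "\<forall>E\<in>entourages (cube UNIV). \<exists>s\<in>K. (x, s) \<in> E"
    have "k \<in> T" if k: "x k" for k
    proof -
      obtain D where D: "D \<in> entourages (cube UNIV)" "\<forall>f g. (f, g) \<in> D \<longrightarrow> (\<forall>i\<in>{k}. f i = g i)"
        using agree_entourage[of "{k}" UNIV "\<lambda>_. UNIV :: bool set"] unfolding cube_def by blast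
      obtain s where s: "s \<in> K" "(x, s) \<in> D"
        using near D(1) by blast
      then have "s k"
        using D(2) k by blast
      then show ?thesis
        using s(1) by (simp add: K_def)
    qed
    then show "x \<in> K"
      by (simp add: K_def)
  qed simp
  ultimately have "compactin (utopology (cube UNIV)) K"
    by (rule closedin_compact_space)
  moreover have "K \<subseteq> countable_support"
    unfolding K_def countable_support_def by (intro Collect_mono impI countable_subset[OF _ T]) blast
  ultimately have "compactin (utopology (usub (cube UNIV) countable_support)) K"
    by (simp add: utopology_usub[OF is_uspace_cube] compactin_subtopology)
  moreover have "A \<subseteq> K"
    by (auto simp: K_def T_def)
  ultimately show "\<exists>K. compactin (utopology (usub (cube UNIV) countable_support)) K \<and> A \<subseteq> K"
    by blast
qed

text \<open>The points \<open>a n\<close>, which differ from the deleted point at a single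
  coordinate, converge to it. A compact set containing all of them is closed in the cube and so
  would contain the deleted point.\<close>

lemma not_omega_bounded_punctured: "\<not> omega_bounded (usub (cube UNIV) punctured)"
proof
  assume b: "omega_bounded (usub (cube UNIV) punctured)"
  define a :: "nat \<Rightarrow> real \<Rightarrow> bool" where "a n k \<longleftrightarrow> k \<noteq> real n" for n k
  have "a n \<noteq> (\<lambda>_. True)" for n
  proof
    assume "a n = (\<lambda>_. True)"
    from fun_cong[OF this, of "real n"] show False
      by (simp add: a_def)
  qed
  then have "range a \<subseteq> points (usub (cube UNIV) punctured) \<and> countable (range a)"
    by (auto simp: punctured_def)
  then obtain K where "compactin (utopology (usub (cube UNIV) punctured)) K" and aK: "range a \<subseteq> K"
    using b unfolding omega_bounded_def by blast
  then have K: "compactin (utopology (cube UNIV)) K" "K \<subseteq> punctured"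
    by (simp_all add: utopology_usub[OF is_uspace_cube] compactin_subtopology)
  have closed: "closedin (utopology (cube UNIV)) K"
    by (rule compactin_imp_closedin[OF t2space_Hausdorff[OF t2space_cube] K(1)])
  have "\<exists>s\<in>K. (\<lambda>_. True, s) \<in> E" if E: "E \<in> entourages (cube UNIV)" for E
  proof -
    obtain J where J: "finite J" "\<forall>f g. (\<forall>i\<in>J. f i = g i) \<longrightarrow> (f, g) \<in> E"
      using cube_entourage_agree[OF E] by blast
    have "finite (real -` J)"
      using J(1) by (intro finite_vimageI) (auto simp: inj_on_def)
    then obtain n where "real n \<notin> J"
      using infinite_UNIV_nat by (metis UNIV_eq_I vimageI)
    then have "\<forall>i\<in>J. True = a n i"
      by (auto simp: a_def)
    then have "(\<lambda>_. True, a n) \<in> E"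
      using J(2)[rule_format, of "\<lambda>_. True" "a n"] by blast
    then show ?thesis
      using aK by blast
  qed
  then have "(\<lambda>_. True) \<in> K"
    using closed unfolding closedin_utopology[OF is_uspace_cube] by simp
  then show False
    using K(2) by (auto simp: punctured_def)
qed

lemma countable_support_punctured: "countable_support \<subseteq> punctured"
  using uncountable_UNIV_real by (auto simp: countable_support_def punctured_def)

lemma countable_support_dense: "dense_in (usub (cube UNIV) punctured) countable_support"
  unfolding dense_in_def
proof (intro ballI)
  fix y E assume y: "y \<in> points (usub (cube UNIV) punctured)" and "E \<in> entourages (usub (cube UNIV) punctured)"
  then obtain D where D: "D \<in> entourages (cube UNIV)" "E = D \<inter> punctured \<times> punctured"
    by (auto simp: entourages_usub)
  obtain J where J: "finite J" "\<forall>f g. (\<forall>i\<in>J. f i = g i) \<longrightarrow> (f, g) \<in> D"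
    using cube_entourage_agree[OF D(1)] by blast
  \<comment> \<open>Truncating y to the finitely many relevant coordinates leaves a finite
    support.\<close>
  define s where "s k \<longleftrightarrow> k \<in> J \<and> y k" for k
  have "{k. s k} \<subseteq> J"
    by (auto simp: s_def)
  then have s: "s \<in> countable_support"
    using J(1) countable_finite finite_subset unfolding countable_support_def by blast
  moreover have "(y, s) \<in> D"
    by (rule J(2)[rule_format]) (simp add: s_def)
  ultimately show "\<exists>s\<in>countable_support. (y, s) \<in> E"
    using y D(2) countable_support_punctured by auto
qed

definition totally_disconnected :: "'a uspace \<Rightarrow> bool" where
  "totally_disconnected X \<longleftrightarrow> (\<forall>S. connectedin (utopology X) S \<longrightarrow> (\<forall>a\<in>S. \<forall>b\<in>S. a = b))"

lemma totally_disconnected_preimage: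
  assumes X: "is_uspace X" and Y: "\<And>i. i \<in> I \<Longrightarrow> is_uspace (Y i)" and td: "\<And>i. i \<in> I \<Longrightarrow> totally_disconnected (Y i)"
    and f: "\<And>i. i \<in> I \<Longrightarrow> ucont X (Y i) (f i)"
    and sep: "\<And>a b. a \<in> points X \<Longrightarrow> b \<in> points X \<Longrightarrow> (\<And>i. i \<in> I \<Longrightarrow> f i a = f i b) \<Longrightarrow> a = b"
  shows "totally_disconnected X"
  unfolding totally_disconnected_def
proof (intro allI impI ballI)
  fix S a b assume S: "connectedin (utopology X) S" and ab: "a \<in> S" "b \<in> S"
  have SX: "S \<subseteq> points X"
    using connectedin_subset_topspace[OF S] topspace_utopology[OF X] by simp
  show "a = b"
  proof (rule sep)
    show "a \<in> points X" "b \<in> points X"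
      using SX ab by blast+
    fix i assume i: "i \<in> I"
    have "connectedin (utopology (Y i)) (f i ` S)"
      by (rule connectedin_continuous_map_image[OF ucont_continuous_map[OF X Y[OF i] f[OF i]] S])
    then show "f i a = f i b"
      using td[OF i] ab unfolding totally_disconnected_def by blast
  qed
qed

text \<open>A continuous bijection from a compact space onto a Hausdorff space is a homeomorphism,
  so connected sets pull back. Injectivity matters: the Cantor set maps onto the unit
  interval.\<close>

lemma totally_disconnected_bijection:
  assumes X: "is_uspace X" and Y: "t2space Y" and comp: "compact_space (utopology X)"
    and td: "totally_disconnected X" and f: "ucont X Y f" and inj: "inj_on f (points X)"
    and surj: "f ` points X = points Y"
  shows "totally_disconnected Y"
  unfolding totally_disconnected_def
proof (intro allI impI ballI)
  have uY: "is_uspace Y"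
    by (rule t2space_uspace[OF Y])
  have cont: "continuous_map (utopology X) (utopology Y) f"
    by (rule ucont_continuous_map[OF X uY f])
  have homeo: "homeomorphic_map (utopology X) (utopology Y) f"
    by (rule bijective_closed_imp_homeomorphic_map[OF cont
          closed_map_compact_Hausdorff[OF comp t2space_Hausdorff[OF Y] cont]])
      (simp_all add: topspace_utopology[OF X] topspace_utopology[OF uY] inj surj)
  fix S a b assume S: "connectedin (utopology Y) S" and ab: "a \<in> S" "b \<in> S"
  define T where "T = {x \<in> points X. f x \<in> S}"
  have "S \<subseteq> points Y"
    using connectedin_subset_topspace[OF S] topspace_utopology[OF uY] by simp
  then have T: "f ` T = S"
    using surj by (auto simp: T_def)
  have "T \<subseteq> topspace (utopology X)"
    by (auto simp: T_def topspace_utopology[OF X])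
  then have "connectedin (utopology X) T"
    using homeomorphic_map_connectedness[OF homeo, of T] S unfolding T by blast
  then have T1: "\<forall>x\<in>T. \<forall>y\<in>T. x = y"
    using td by (simp add: totally_disconnected_def)
  obtain x where x: "x \<in> T" "a = f x"
    using ab(1) T by blast
  obtain y where y: "y \<in> T" "b = f y"
    using ab(2) T by blast
  have "x = y"
    using T1 x(1) y(1) by blast
  then show "a = b"
    using x(2) y(2) by simp
qed

lemma totally_disconnected_udisc: "totally_disconnected (udisc A)"
proof -
  have "openin (utopology (udisc A)) S \<longleftrightarrow> openin (discrete_topology A) S" for S
  proof -
    have "\<exists>E\<in>entourages (udisc A). E `` {x} \<subseteq> S" if "x \<in> S" for x
      using that by (intro bexI[of _ "Id_on A"] Id_on_entourage) auto
    then show ?thesis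
      by (auto simp: openin_utopology[OF is_uspace_udisc])
  qed
  then have "utopology (udisc A) = discrete_topology A"
    by (simp add: topology_eq)
  then show ?thesis
    by (auto simp: totally_disconnected_def connectedin_discrete_topology)
qed

text \<open>The metric uniformity on a compact connected space with more than one point. It shows
  that the compact totally disconnected spaces are not a class of the list.\<close>

definition unit_interval :: "real uspace" where
  "unit_interval = ugen {0..1} ((\<lambda>e. {(x, y). x \<in> {0..1} \<and> y \<in> {0..1} \<and> dist x y < e}) ` {0<..})"

lemma entourages_unit_interval:
  "E \<in> entourages unit_interval \<longleftrightarrow> E \<subseteq> {0..1} \<times> {0..1} \<and>
     (\<exists>e>0. \<forall>x\<in>{0..1}. \<forall>y\<in>{0..1}. dist x y < e \<longrightarrow> (x, y) \<in> E)"
proof -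
  let ?D = "\<lambda>e::real. {(x, y). x \<in> {0..1::real} \<and> y \<in> {0..1} \<and> dist x y < e}"
  have D: "?D e \<subseteq> E \<longleftrightarrow> (\<forall>x\<in>{0..1}. \<forall>y\<in>{0..1}. dist x y < e \<longrightarrow> (x, y) \<in> E)" for e
    by (simp add: subset_iff Ball_def imp_conjL)
  have "(\<exists>D\<in>?D ` {0<..}. D \<subseteq> E) \<longleftrightarrow> (\<exists>e>0. ?D e \<subseteq> E)"
    unfolding bex_simps(7) by (simp only: Bex_def greaterThan_iff)
  then show ?thesis
    unfolding unit_interval_def entourages_ugen D by (rule conj_cong[OF refl])
qed

lemma t2space_unit_interval: "t2space unit_interval"
  unfolding t2space_def
proof (intro conjI ballI impI)
  let ?D = "\<lambda>e::real. {(x, y). x \<in> {0..1::real} \<and> y \<in> {0..1} \<and> dist x y < e}"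
  show "is_uspace unit_interval"
    unfolding unit_interval_def
  proof (rule is_uspace_ugen)
    let ?B = "?D ` {0<..}"
    have B: "?D e \<in> ?B" if "0 < e" for e
      using that by (intro imageI) simp
    show "?B \<noteq> {}"
      using B[of 1] by auto
    fix D assume "D \<in> ?B"
    then obtain e where e: "0 < e" "D = ?D e"
      by (elim imageE) simp
    show "Id_on {0..1} \<subseteq> D" "D \<subseteq> {0..1} \<times> {0..1}"
      using e by auto
    show "\<exists>D'\<in>?B. D' \<subseteq> D\<inverse>"
      by (rule bexI[OF _ B[OF e(1)]]) (auto simp: e(2) dist_commute)
    have "?D (e / 2) O ?D (e / 2) \<subseteq> D"
      unfolding e(2) by (auto intro: dist_triangle_half_l simp: dist_commute)
    then show "\<exists>D'\<in>?B. D' O D' \<subseteq> D"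
      by (rule bexI[OF _ B]) (use e(1) in simp)
    fix D' assume "D' \<in> ?B"
    then obtain e' where e': "0 < e'" "D' = ?D e'"
      by (elim imageE) simp
    show "\<exists>D''\<in>?B. D'' \<subseteq> D \<inter> D'"
      by (rule bexI[OF _ B[of "min e e'"]]) (use e e' in auto)
  qed
  fix x y :: real assume xy: "x \<in> points unit_interval" "y \<in> points unit_interval" "x \<noteq> y"
  have "?D (dist x y) \<in> entourages unit_interval"
    unfolding entourages_unit_interval using xy(3) by (intro conjI exI[of _ "dist x y"]) auto
  then show "\<exists>E\<in>entourages unit_interval. (x, y) \<notin> E"
    by (rule bexI[rotated]) simp
qed

lemma points_unit_interval: "points unit_interval = {0..1}"
  by (simp add: unit_interval_def)

lemma utopology_unit_interval: "utopology unit_interval = top_of_set {0..1}"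
  unfolding topology_eq
proof (intro allI)
  fix S
  have "(\<exists>E\<in>entourages unit_interval. E `` {x} \<subseteq> S) \<longleftrightarrow> (\<exists>e>0. \<forall>y\<in>{0..1}. dist y x < e \<longrightarrow> y \<in> S)"
    if x: "x \<in> {0..1}" for x
  proof
    assume "\<exists>E\<in>entourages unit_interval. E `` {x} \<subseteq> S"
    then obtain E where E0: "E \<in> entourages unit_interval" and E: "E `` {x} \<subseteq> S"
      by (rule bexE)
    obtain e where e: "0 < e" "\<forall>x\<in>{0..1}. \<forall>y\<in>{0..1}. dist x y < e \<longrightarrow> (x, y) \<in> E"
      using E0[unfolded entourages_unit_interval, THEN conjunct2] by (elim exE conjE) (rule that)
    have "y \<in> S" if y: "y \<in> {0..1}" "dist y x < e" for y
    proof -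
      have "(x, y) \<in> E"
        using e(2)[rule_format, OF x y(1)] y(2) by (simp add: dist_commute)
      then show ?thesis
        using E by blast
    qed
    then show "\<exists>e>0. \<forall>y\<in>{0..1}. dist y x < e \<longrightarrow> y \<in> S"
      using e(1) by blast
  next
    assume "\<exists>e>0. \<forall>y\<in>{0..1}. dist y x < e \<longrightarrow> y \<in> S"
    then obtain e where e: "0 < e" "\<forall>y\<in>{0..1}. dist y x < e \<longrightarrow> y \<in> S"
      by blast
    have "{(x, y). x \<in> {0..1} \<and> y \<in> {0..1} \<and> dist x y < e} \<in> entourages unit_interval"
      unfolding entourages_unit_interval using e(1) by (intro conjI exI[of _ e]) auto
    then show "\<exists>E\<in>entourages unit_interval. E `` {x} \<subseteq> S"
      by (rule bexI[rotated]) (use e(2) in \<open>auto simp: dist_commute\<close>)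
  qed
  then show "openin (utopology unit_interval) S \<longleftrightarrow> openin (top_of_set {0..1}) S"
    unfolding openin_utopology[OF t2space_uspace[OF t2space_unit_interval]] points_unit_interval
      openin_euclidean_subtopology_iff by blast
qed

section \<open>The four witnessing classes\<close>

context inaccessible
begin

text \<open>Dedekind cuts embed the reals into the power set of the rationals.\<close>

lemma sm_real: "sm (UNIV :: real set)"
proof (rule sm_inj_on)
  have "sm (UNIV :: rat set)"
    by (rule sm_inj_on[OF sm_nat inj_to_nat]) simp
  then show "sm (Pow (UNIV :: rat set))"
    by (rule sm_Pow)
  show "inj_on (\<lambda>r :: real. {q. real_of_rat q < r}) UNIV"
  proof (rule inj_onI, rule ccontr)
    fix x y :: real
    assume eq: "{q. real_of_rat q < x} = {q. real_of_rat q < y}" and "x \<noteq> y"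
    then have "x < y \<or> y < x"
      by auto
    then obtain q where "x < real_of_rat q \<and> real_of_rat q < y \<or> y < real_of_rat q \<and> real_of_rat q < x"
      using of_rat_dense by metis
    then have "q \<in> {q. real_of_rat q < x} \<longleftrightarrow> q \<notin> {q. real_of_rat q < y}"
      by auto
    then show False
      using eq by blast
  qed
qed simp

lemma image_closed_of_listed:
  fixes C :: "'u uspace set"
  assumes "subcategory C" "of_listed_form C"
  shows "image_closed U C"
  using of_listed_form_iff[OF assms(1)] assms by unfold_locales simp_all

lemma products_independent:
  "\<exists>C :: 'u uspace set. subcategory C \<and> closed_under_extremal_subobjects C \<and>
     closed_under_images bimorphism C \<and> closed_under_images extremal_epi C \<and> \<not> of_listed_form C"
proof -
  \<comment> \<open>Subsets and surjective images do not increase the number of points, and dense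
    images of finite spaces are onto. A listed class with a two-point discrete space contains every
    finite discrete one, in particular one with three points.\<close>
  define C :: "'u uspace set" where "C = {X \<in> T2Unif. finite (points X) \<and> card (points X) \<le> 2}"
  have sub: "subcategory C"
  proof (rule subcategoryI)
    fix X Y :: "'u uspace" and j k assume X: "X \<in> C" and Y: "Y \<in> T2Unif" and iso: "uiso X Y j k"
    show "Y \<in> C"
      using X Y card_image_le[of "points X" j] finite_imageI[of "points X" j]
      by (auto simp: C_def uiso_image[OF iso])
  qed (simp add: C_def)
  have "closed_under_extremal_subobjects C"
  proof (rule subobject_closedI[OF sub])
    fix Y :: "'u uspace" and S assume Y: "Y \<in> C" and S: "closedin (utopology Y) S"
    have YT: "Y \<in> T2Unif"
      using Y by (simp add: C_def)
    have SY: "S \<subseteq> points Y"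
      by (rule closedin_points[OF T2Unif_uspace[OF YT] S])
    then have "finite S" "card S \<le> 2"
      using Y finite_subset card_mono[OF _ SY] unfolding C_def by auto
    then show "usub Y S \<in> C"
      using usub_T2Unif[OF YT SY] by (simp add: C_def)
  qed
  moreover have "closed_under_images epimorphism C"
  proof (rule image_closedI)
    fix X Y :: "'u uspace" and f
    assume X: "X \<in> C" and Y: "Y \<in> T2Unif" and f: "ucont X Y f" "dense_in Y (f ` points X)"
    have XT: "X \<in> T2Unif" and fin: "finite (points X)" "card (points X) \<le> 2"
      using X by (simp_all add: C_def)
    have "f ` points X = points Y"
      by (rule compact_dense_image(1)[OF T2Unif_uspace[OF XT] T2Unif_t2space[OF Y]
            finite_compact[OF T2Unif_uspace[OF XT] fin(1)] f])
    then show "Y \<in> C"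
      using Y fin card_image_le[OF fin(1), of f] unfolding C_def by (metis (mono_tags, lifting) finite_imageI le_trans mem_Collect_eq)
  qed (simp add: C_def)
  moreover have "\<not> of_listed_form C"
  proof
    assume "of_listed_form C"
    then interpret image_closed U C
      by (rule image_closed_of_listed[OF sub])
    obtain A where A: "A \<subseteq> U" "finite A" "card A = 3"
      using infinite_arbitrarily_large[OF infinite_univ] by blast
    obtain B where B: "B \<subseteq> A" "card B = 2"
      using obtain_subset_with_card_n[of 2 A] A(3) by auto
    have "finite B"
      using B(1) A(2) finite_subset by blast
    then have "udisc B \<in> C"
      using B(2) by (simp add: C_def udisc_T2Unif sm_finite)
    moreover obtain a b where "a \<in> B" "b \<in> B" "a \<noteq> b"
      using B(2) by (auto simp: card_2_iff)
    ultimately have "realized C (udisc (UNIV :: bool set))"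
      by (intro realized_bool[of "udisc B" a b]) simp_all
    then have "realized C (udisc A)"
      using A(2) by (rule realized_finite)
    then have "udisc A \<in> C"
      by (rule realized_C) (simp add: udisc_T2Unif sm_finite A(2))
    then show False
      using A(3) by (simp add: C_def)
  qed
  ultimately show ?thesis
    using sub epimorphism_images_iff[OF sub] by blast
qed

lemma extremal_subobjects_independent:
  "\<exists>C :: 'u uspace set. subcategory C \<and> closed_under_products C \<and>
     closed_under_images bimorphism C \<and> closed_under_images extremal_epi C \<and> \<not> of_listed_form C"
proof -
  \<comment> \<open>Nonemptiness passes to products by choice and to the target of any map, but a
    listed class is closed under closed subspaces and so contains the empty space.\<close>
  define C :: "'u uspace set" where "C = {X \<in> T2Unif. points X \<noteq> {}}"
  have sub: "subcategory C"
  proof (rule subcategoryI)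
    fix X Y :: "'u uspace" and j k assume X: "X \<in> C" and Y: "Y \<in> T2Unif" and iso: "uiso X Y j k"
    show "Y \<in> C"
      using X Y uiso_image[OF iso] by (auto simp: C_def)
  qed (simp add: C_def)
  have "closed_under_products C"
  proof (rule product_closedI)
    fix I :: "'u set" and X :: "'u \<Rightarrow> 'u uspace" and P :: "'u uspace" and j k
    assume X: "\<And>i. i \<in> I \<Longrightarrow> X i \<in> C" and P: "P \<in> T2Unif" and iso: "uiso (uproduct I X) P j k"
    have "points (uproduct I X) \<noteq> {}"
      using X by (simp add: PiE_eq_empty_iff C_def)
    then have "points P \<noteq> {}"
      unfolding uiso_image[OF iso, symmetric] by simp
    then show "P \<in> C"
      using P by (simp add: C_def)
  qed (simp add: C_def)
  moreover have "closed_under_images epimorphism C"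
  proof (rule image_closedI)
    fix X Y :: "'u uspace" and f
    assume X: "X \<in> C" and Y: "Y \<in> T2Unif" and f: "ucont X Y f"
    obtain x where "x \<in> points X"
      using X by (auto simp: C_def)
    then have "points Y \<noteq> {}"
      using ucontD[OF f] by blast
    then show "Y \<in> C"
      using Y by (simp add: C_def)
  qed (simp add: C_def)
  moreover have "\<not> of_listed_form C"
  proof
    assume "of_listed_form C"
    then interpret image_closed U C
      by (rule image_closed_of_listed[OF sub])
    have "udisc {undefined} \<in> C"
      by (simp add: C_def udisc_T2Unif sm_finite)
    then have "usub (udisc {undefined}) {} \<in> C"
      by (rule usub_C) simp
    then show False
      by (simp add: C_def)
  qed
  ultimately show ?thesis
    using sub epimorphism_images_iff[OF sub] by blast
qed

lemma bimorphic_images_independent: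
  "\<exists>C :: 'u uspace set. subcategory C \<and> closed_under_products C \<and> closed_under_extremal_subobjects C \<and>
     closed_under_images extremal_epi C \<and> \<not> of_listed_form C"
proof -
  \<comment> \<open>A listed class is closed under all dense images, so together with the points of
    countable support it would contain the punctured cube.\<close>
  define C :: "'u uspace set" where "C = {X \<in> T2Unif. omega_bounded X}"
  have sub: "subcategory C"
  proof (rule subcategoryI)
    fix X Y :: "'u uspace" and j k assume X: "X \<in> C" and Y: "Y \<in> T2Unif" and iso: "uiso X Y j k"
    have "X \<in> T2Unif" "omega_bounded X"
      using X by (simp_all add: C_def)
    then have "omega_bounded Y"
      using omega_bounded_image[OF T2Unif_uspace T2Unif_uspace[OF Y] _ uiso_ucont[OF iso] uiso_image[OF iso]] by blast
    then show "Y \<in> C"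
      using Y by (simp add: C_def)
  qed (simp add: C_def)
  have "closed_under_products C"
  proof (rule product_closedI)
    fix I :: "'u set" and X :: "'u \<Rightarrow> 'u uspace" and P :: "'u uspace" and j k
    assume X: "\<And>i. i \<in> I \<Longrightarrow> X i \<in> C" and P: "P \<in> T2Unif" and iso: "uiso (uproduct I X) P j k"
    have uX: "is_uspace (X i)" and bX: "omega_bounded (X i)" if "i \<in> I" for i
      using X[OF that] T2Unif_uspace by (auto simp: C_def)
    have uI: "is_uspace (uproduct I X)"
      by (rule is_uspace_uproduct) (rule uX)
    have "omega_bounded P"
      by (rule omega_bounded_image[OF uI T2Unif_uspace[OF P] omega_bounded_uproduct[OF uX bX]
            uiso_ucont[OF iso] uiso_image[OF iso]])
    then show "P \<in> C"
      using P by (simp add: C_def)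
  qed (simp add: C_def)
  moreover have "closed_under_extremal_subobjects C"
  proof (rule subobject_closedI[OF sub])
    fix Y :: "'u uspace" and S assume Y: "Y \<in> C" and S: "closedin (utopology Y) S"
    have YT: "Y \<in> T2Unif" and b: "omega_bounded Y"
      using Y by (simp_all add: C_def)
    show "usub Y S \<in> C"
      using usub_T2Unif[OF YT closedin_points[OF T2Unif_uspace[OF YT] S]]
        omega_bounded_usub[OF T2Unif_uspace[OF YT] b S] by (simp add: C_def)
  qed
  moreover have "closed_under_images extremal_epi C"
    unfolding closed_under_images_def
  proof (intro ballI allI impI)
    fix X Y :: "'u uspace" and e assume X: "X \<in> C" and Y: "Y \<in> T2Unif" and e: "extremal_epi X Y e"
    have XT: "X \<in> T2Unif" and b: "omega_bounded X"
      using X by (simp_all add: C_def)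
    have "e \<in> hom X Y"
      using e by (simp add: extremal_epi_def epimorphism_def)
    then have "omega_bounded Y"
      by (rule omega_bounded_image[OF T2Unif_uspace[OF XT] T2Unif_uspace[OF Y] b hom_ucont
            extremal_epi_surj[OF XT Y e]])
    then show "Y \<in> C"
      using Y by (simp add: C_def)
  qed
  moreover have "\<not> of_listed_form C"
  proof
    assume "of_listed_form C"
    then interpret image_closed U C
      by (rule image_closed_of_listed[OF sub])
    let ?X = "usub (cube (UNIV :: real set)) countable_support"
    let ?Y = "usub (cube (UNIV :: real set)) punctured"
    have uX: "is_uspace ?X"
      by (rule is_uspace_usub[OF is_uspace_cube]) simp
    have tX: "t2space ?X" and tY: "t2space ?Y"
      by (rule t2space_usub[OF t2space_cube], simp)+
    have sQ: "sm (UNIV :: (real \<Rightarrow> bool) set)"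
      using sm_cube[OF sm_real] by simp
    have sX: "sm (points ?X)" and sY: "sm (points ?Y)"
      using sm_subset[OF sQ subset_UNIV] by blast+
    have realized_iff: "omega_bounded Z" if Z: "realized C Z" "is_uspace Z" for Z :: "(real \<Rightarrow> bool) uspace"
    proof -
      obtain Q j k where Q: "Q \<in> C" "uiso Z Q j k"
        using Z(1) unfolding realized_def by blast
      have "omega_bounded Q"
        using Q(1) by (simp add: C_def)
      then show ?thesis
        by (rule omega_bounded_image[OF C_uspace[OF Q(1)] Z(2) _ uiso_ucont'[OF Q(2)]
              uiso_image[OF uiso_sym[OF Q(2)]]])
    qed
    obtain X' :: "'u uspace" and j k where X': "X' \<in> T2Unif" "uiso ?X X' j k"
      using ex_copy[OF tX sX] by blast
    have "omega_bounded X'"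
      by (rule omega_bounded_image[OF uX T2Unif_uspace[OF X'(1)] omega_bounded_countable_support
            uiso_ucont[OF X'(2)] uiso_image[OF X'(2)]])
    then have "realized C ?X"
      unfolding realized_def using X' by (auto simp: C_def)
    moreover have "ucont ?X ?Y (\<lambda>x. x)"
      by (rule ucont_into_usub[OF uX ucont_usub_incl]) (use countable_support_punctured in auto)
    ultimately have "realized C ?Y"
      using realized_image[OF uX _ tY sY] countable_support_dense by simp
    then show False
      using realized_iff[OF _ t2space_uspace[OF tY]] not_omega_bounded_punctured by blast
  qed
  ultimately show ?thesis
    using sub by blast
qed

lemma extremal_epi_images_independent:
  "\<exists>C :: 'u uspace set. subcategory C \<and> closed_under_products C \<and> closed_under_extremal_subobjects C \<and>
     closed_under_images bimorphism C \<and> \<not> of_listed_form C"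
proof -
  \<comment> \<open>A bimorphism from a compact space is a bijection onto its Hausdorff target,
    hence a homeomorphism, so total disconnectedness survives. A listed class with a two-point
    member contains every compact space, among them the unit interval.\<close>
  define C :: "'u uspace set" where "C = {X \<in> T2Unif. compact_space (utopology X) \<and> totally_disconnected X}"
  have bij: "Y \<in> C" if X: "X \<in> C" and Y: "Y \<in> T2Unif" and f: "ucont X Y f" "inj_on f (points X)"
      "dense_in Y (f ` points X)" for X Y :: "'u uspace" and f
  proof -
    have uX: "is_uspace X" and comp: "compact_space (utopology X)" and td: "totally_disconnected X"
      using X T2Unif_uspace by (auto simp: C_def)
    note img = compact_dense_image[OF uX T2Unif_t2space[OF Y] comp f(1,3)]
    have "totally_disconnected Y"
      by (rule totally_disconnected_bijection[OF uX T2Unif_t2space[OF Y] comp td f(1,2) img(1)])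
    then show ?thesis
      using Y img(2) by (simp add: C_def)
  qed
  have sub: "subcategory C"
  proof (rule subcategoryI)
    fix X Y :: "'u uspace" and j k assume X: "X \<in> C" and Y: "Y \<in> T2Unif" and iso: "uiso X Y j k"
    show "Y \<in> C"
      by (rule bij[OF X Y uiso_ucont[OF iso] uiso_inj_on[OF iso] uiso_dense[OF T2Unif_uspace[OF Y] iso]])
  qed (simp add: C_def)
  have "closed_under_products C"
  proof (rule product_closedI)
    fix I :: "'u set" and X :: "'u \<Rightarrow> 'u uspace" and P :: "'u uspace" and j k
    assume X: "\<And>i. i \<in> I \<Longrightarrow> X i \<in> C" and P: "P \<in> T2Unif" and iso: "uiso (uproduct I X) P j k"
    have uX: "is_uspace (X i)" and cX: "compact_space (utopology (X i))" and tX: "totally_disconnected (X i)"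
      if "i \<in> I" for i
      using X[OF that] T2Unif_uspace by (auto simp: C_def)
    have uI: "is_uspace (uproduct I X)"
      by (rule is_uspace_uproduct) (rule uX)
    have "compact_space (utopology (uproduct I X))"
      by (rule compact_uproduct[OF uX cX])
    moreover have "totally_disconnected (uproduct I X)"
      by (rule totally_disconnected_preimage[OF uI uX tX ucont_proj]) (auto intro: PiE_ext)
    ultimately have cP: "compact_space (utopology P)" and tP: "totally_disconnected P"
      using ucont_compact_image[OF uI T2Unif_uspace[OF P] uiso_ucont[OF iso] uiso_image[OF iso]]
        totally_disconnected_bijection[OF uI T2Unif_t2space[OF P] _ _ uiso_ucont[OF iso] uiso_inj_on[OF iso]
          uiso_image[OF iso]] by blast+
    then show "P \<in> C"
      using P by (simp add: C_def)
  qed (simp add: C_def)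
  moreover have "closed_under_extremal_subobjects C"
  proof (rule subobject_closedI[OF sub])
    fix Y :: "'u uspace" and S assume Y: "Y \<in> C" and S: "closedin (utopology Y) S"
    have YT: "Y \<in> T2Unif" and comp: "compact_space (utopology Y)" and td: "totally_disconnected Y"
      using Y by (simp_all add: C_def)
    have uY: "is_uspace Y"
      by (rule T2Unif_uspace[OF YT])
    have SY: "S \<subseteq> points Y"
      by (rule closedin_points[OF uY S])
    have "totally_disconnected (usub Y S)"
      using td unfolding totally_disconnected_def utopology_usub[OF uY SY] connectedin_subtopology by blast
    then show "usub Y S \<in> C"
      using usub_T2Unif[OF YT SY] compact_usub[OF uY comp S] by (simp add: C_def)
  qed
  moreover have "closed_under_images bimorphism C"
    unfolding closed_under_images_def
  proof (intro ballI allI impI)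
    fix X Y :: "'u uspace" and e assume X: "X \<in> C" and Y: "Y \<in> T2Unif" and e: "bimorphism X Y e"
    have XT: "X \<in> T2Unif"
      using X by (simp add: C_def)
    have e': "e \<in> hom X Y" "inj_on e (points X)" "dense_in Y (e ` points X)"
      using e epimorphism_dense[OF XT Y] monomorphism_iff[OF T2Unif_uspace[OF XT]]
      unfolding bimorphism_def by blast+
    show "Y \<in> C"
      by (rule bij[OF X Y hom_ucont[OF e'(1)] e'(2,3)])
  qed
  moreover have "\<not> of_listed_form C"
  proof
    assume "of_listed_form C"
    then interpret image_closed U C
      by (rule image_closed_of_listed[OF sub])
    obtain B where B: "B \<subseteq> U" "finite B" "card B = 2"
      using infinite_arbitrarily_large[OF infinite_univ] by blast
    obtain a b where ab: "a \<in> B" "b \<in> B" "a \<noteq> b"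
      using B(3) by (auto simp: card_2_iff)
    have "udisc B \<in> C"
      using B(2) finite_compact[OF is_uspace_udisc, of B]
      by (simp add: C_def udisc_T2Unif sm_finite totally_disconnected_udisc)
    then have two: "realized C (udisc (UNIV :: bool set))"
      using ab by (intro realized_bool[of "udisc B" a b]) simp_all
    have uI: "is_uspace unit_interval"
      by (rule t2space_uspace[OF t2space_unit_interval])
    obtain X :: "'u uspace" and j k where X: "X \<in> T2Unif" "uiso unit_interval X j k"
      using ex_copy[OF t2space_unit_interval sm_subset[OF sm_real]] by blast
    have uX: "is_uspace X"
      by (rule T2Unif_uspace[OF X(1)])
    have "compact_space (utopology unit_interval)"
      unfolding utopology_unit_interval by (intro compact_space_subtopology) simp
    then have "compact_space (utopology X)"
      by (rule ucont_compact_image[OF uI uX uiso_ucont[OF X(2)] uiso_image[OF X(2)]])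
    then have "totally_disconnected X"
      using compact_C[OF two X(1)] by (simp add: C_def)
    moreover have "connectedin (utopology unit_interval) {0..1}"
      unfolding utopology_unit_interval connectedin_subtopology by simp
    then have "connectedin (utopology X) (j ` {0..1})"
      by (rule connectedin_continuous_map_image[OF ucont_continuous_map[OF uI uX uiso_ucont[OF X(2)]]])
    ultimately have "j 0 = j 1"
      unfolding totally_disconnected_def by auto
    then show False
      using inj_onD[OF uiso_inj_on[OF X(2)], of 0 1] by (simp add: points_unit_interval)
  qed
  ultimately show ?thesis
    using sub by blast
qed

end

theorem theorem2:
  assumes "strongly_inaccessible |UNIV :: 'u set|"
  shows
    "(\<forall>C :: 'u uspace set. subcategory C \<longrightarrow>
        (epireflective C \<and> closed_under_images epimorphism C \<longleftrightarrow> of_listed_form C))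
   \<and> (\<forall>C :: 'u uspace set. subcategory C \<longrightarrow>
        (epireflective C \<and> closed_under_images epimorphism C \<longleftrightarrow>
           closed_under_products C \<and> closed_under_extremal_subobjects C \<and>
           closed_under_images bimorphism C \<and> closed_under_images extremal_epi C))
   \<and> (\<exists>C :: 'u uspace set. subcategory C \<and>
        closed_under_extremal_subobjects C \<and>
        closed_under_images bimorphism C \<and> closed_under_images extremal_epi C \<and>
        \<not> of_listed_form C)
   \<and> (\<exists>C :: 'u uspace set. subcategory C \<and>
        closed_under_products C \<and>
        closed_under_images bimorphism C \<and> closed_under_images extremal_epi C \<and>
        \<not> of_listed_form C)
   \<and> (\<exists>C :: 'u uspace set. subcategory C \<and>
        closed_under_products C \<and> closed_under_extremal_subobjects C \<and>
        closed_under_images extremal_epi C \<and>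
        \<not> of_listed_form C)
   \<and> (\<exists>C :: 'u uspace set. subcategory C \<and>
        closed_under_products C \<and> closed_under_extremal_subobjects C \<and>
        closed_under_images bimorphism C \<and>
        \<not> of_listed_form C)"
proof -
  interpret inaccessible "UNIV :: 'u set"
    by unfold_locales (simp_all add: assms)
  show ?thesis
    using products_independent extremal_subobjects_independent bimorphic_images_independent
      extremal_epi_images_independent
    by (intro conjI) (simp_all add: epireflective_iff of_listed_form_iff epimorphism_images_iff)
qed

end
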